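(* Let $a$ be weakly degenerate (WD) or strongly degenerate (SD) at $0$. If $y$ is a mild solution of $$\begin{cases}y_{tt}+a(x)y_{xxxx}=0, & (t,x)\in(0,+\infty)\times(0,1),\\ y(t,0)=y(t,1)=0,\ y_x(t,0)=y_x(t,1)=0, & t\in(0,+\infty),\\ y(0,x)=y^0_T(x),\ y_t(0,x)=y^1_T(x), & x\in(0,1),\end{cases}$$ with $(y^0_T,y^1_T)\in\mathcal H_0$, then for any $T>0$ $$\int_0^Ty_{xx}^2(t,1)\,dt\le\Bigl(12T+4\max\Bigl\{\frac{4}{a(1)},1\Bigr\}\Bigr)E_y(0).$$
   Context: Degeneracy: for $a:[0,1]\to\mathbb R$ with $a(0)=0$, $a>0$ on $(0,1]$, put $K:=\sup_{x\in(0,1]}\frac{x|a'(x)|}{a(x)}$. $a$ is weakly degenerate at $0$ (WD) if $a\in C[0,1]\cap C^1(0,1]$, $a(0)=0$, $a>0$ on $(0,1]$ and $K\in(0,1)$. $a$ is strongly degenerate at $0$ (SD) if $a\in C^1[0,1]$, $a(0)=0$, $a>0$ on $(0,1]$ and $K\in[1,2)$. Spaces: $L^2_{\frac1a}(0,1):=\{u\in L^2(0,1):\int_0^1\frac{u^2}{a}dx<\infty\}$ with norm$^2$ $\int_0^1\frac{u^2}{a}dx$; $H^2_{\frac1a}(0,1):=L^2_{\frac1a}(0,1)\cap H^2_0(0,1)$; $\mathcal H_0:=H^2_{\frac1a}(0,1)\times L^2_{\frac1a}(0,1)$ with norm$^2$ $\|(u,v)\|^2_{\mathcal H_0}=\int_0^1(u'')^2dx+\int_0^1\frac{v^2}{a}dx$.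 Operators: $Au:=au''''$ on $D(A):=\{u\in H^2_{\frac1a}(0,1):au''''\in L^2_{\frac1a}(0,1)\}$; $\mathcal A(u,v):=(v,-Au)$ on $D(\mathcal A):=D(A)\times H^2_{\frac1a}(0,1)\subset\mathcal H_0$. $\mathcal A$ generates a contraction semigroup on $\mathcal H_0$; the mild solution $y$ with data in $\mathcal H_0$ is the first component of the semigroup orbit $(y,y_t)$, and it is a classical solution if the data lie in $D(\mathcal A)$. For mild solutions the trace $y_{xx}(\cdot,1)$ is understood as the limit in $L^2(0,T)$ of the traces of classical solutions with data in $D(\mathcal A)$ converging in $\mathcal H_0$. Energy: $E_y(t):=\frac12\int_0^1\Bigl(\frac{y_t^2(t,x)}{a(x)}+y_{xx}^2(t,x)\Bigr)dx$. *)

theory Defs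
  imports "HOL-Analysis.Analysis"
begin

text \<open>
  Elements of the function spaces are represented by functions on the real line of which only the
  values on the open unit interval matter, up to null sets: every function space below is
  closed under almost everywhere equality on the unit interval.
\<close>

subsection \<open>Degenerate coefficients\<close>

definition C1_on :: "real set \<Rightarrow> (real \<Rightarrow> real) \<Rightarrow> bool" where
  "C1_on I a \<longleftrightarrow> (\<exists>a'. continuous_on I a' \<and>
     (\<forall>x\<in>I. (a has_vector_derivative a' x) (at x within {0..1})))"

text \<open>The supremum is taken in the extended reals, so that the bounds on it below include
  its finiteness.\<close>

definition degeneracy :: "(real \<Rightarrow> real) \<Rightarrow> ereal" where
  "degeneracy a =
     (SUP x\<in>{0<..1}. ereal (x * \<bar>vector_derivative a (at x within {0..1})\<bar> / a x))"

definition weakly_degenerate :: "(real \<Rightarrow> real) \<Rightarrow> bool" where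
  "weakly_degenerate a \<longleftrightarrow> continuous_on {0..1} a \<and> C1_on {0<..1} a \<and>
     a 0 = 0 \<and> (\<forall>x\<in>{0<..1}. 0 < a x) \<and> 0 < degeneracy a \<and> degeneracy a < 1"

definition strongly_degenerate :: "(real \<Rightarrow> real) \<Rightarrow> bool" where
  "strongly_degenerate a \<longleftrightarrow> C1_on {0..1} a \<and>
     a 0 = 0 \<and> (\<forall>x\<in>{0<..1}. 0 < a x) \<and> 1 \<le> degeneracy a \<and> degeneracy a < 2"

subsection \<open>Weak derivatives and Sobolev spaces on the unit interval\<close>

abbreviation unit_leb :: "real measure" where
  "unit_leb \<equiv> lebesgue_on {0<..<1}"

definition L2 :: "real set \<Rightarrow> (real \<Rightarrow> real) set" where
  "L2 I = {u. u \<in> borel_measurable (lebesgue_on I) \<and>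
              integrable (lebesgue_on I) (\<lambda>x. (u x)\<^sup>2)}"

text \<open>A closed support inside the unit interval is bounded, hence compact.\<close>

definition test_fun :: "(real \<Rightarrow> real) \<Rightarrow> bool" where
  "test_fun \<phi> \<longleftrightarrow> (\<forall>k x. (deriv ^^ k) \<phi> differentiable (at x)) \<and>
     closure {x. \<phi> x \<noteq> 0} \<subseteq> {0<..<1}"

definition locally_integrable :: "(real \<Rightarrow> real) \<Rightarrow> bool" where
  "locally_integrable u \<longleftrightarrow> (\<forall>c d. 0 < c \<and> d < 1 \<longrightarrow> u absolutely_integrable_on {c..d})"

definition has_weak_deriv :: "nat \<Rightarrow> (real \<Rightarrow> real) \<Rightarrow> (real \<Rightarrow> real) \<Rightarrow> bool" where
  "has_weak_deriv k u w \<longleftrightarrow> locally_integrable u \<and> locally_integrable w \<and>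
     (\<forall>\<phi>. test_fun \<phi> \<longrightarrow>
        (\<integral>x. u x * (deriv ^^ k) \<phi> x \<partial>unit_leb) = (-1) ^ k * (\<integral>x. w x * \<phi> x \<partial>unit_leb))"

text \<open>Weak derivatives are unique up to null sets; this picks one representative.\<close>

definition weak_deriv :: "nat \<Rightarrow> (real \<Rightarrow> real) \<Rightarrow> real \<Rightarrow> real" where
  "weak_deriv k u = (SOME w. has_weak_deriv k u w)"

definition Sobolev :: "nat \<Rightarrow> (real \<Rightarrow> real) set" where
  "Sobolev m = {u \<in> L2 {0<..<1}. \<forall>k\<le>m. \<exists>w \<in> L2 {0<..<1}. has_weak_deriv k u w}"

text \<open>The closure of the test functions in the Sobolev norm.\<close>

definition Sobolev0 :: "nat \<Rightarrow> (real \<Rightarrow> real) set" where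
  "Sobolev0 m = {u \<in> Sobolev m. \<exists>\<phi>. (\<forall>n::nat. test_fun (\<phi> n)) \<and>
     (\<forall>k\<le>m. (\<lambda>n. \<integral>x. ((deriv ^^ k) (\<phi> n) x - weak_deriv k u x)\<^sup>2 \<partial>unit_leb)
               \<longlonglongrightarrow> 0)}"

definition L2_weighted :: "(real \<Rightarrow> real) \<Rightarrow> (real \<Rightarrow> real) set" where
  "L2_weighted a = {u \<in> L2 {0<..<1}. integrable unit_leb (\<lambda>x. (u x)\<^sup>2 / a x)}"

definition H2_weighted :: "(real \<Rightarrow> real) \<Rightarrow> (real \<Rightarrow> real) set" where
  "H2_weighted a = L2_weighted a \<inter> Sobolev0 2"

subsection \<open>The state space and the operators\<close>

type_synonym state = "(real \<Rightarrow> real) \<times> (real \<Rightarrow> real)"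

definition H0 :: "(real \<Rightarrow> real) \<Rightarrow> state set" where
  "H0 a = H2_weighted a \<times> L2_weighted a"

definition norm_H0 :: "(real \<Rightarrow> real) \<Rightarrow> state \<Rightarrow> real" where
  "norm_H0 a p = sqrt ((\<integral>x. (weak_deriv 2 (fst p) x)\<^sup>2 \<partial>unit_leb)
                     + (\<integral>x. (snd p x)\<^sup>2 / a x \<partial>unit_leb))"

definition lincomb :: "real \<Rightarrow> state \<Rightarrow> real \<Rightarrow> state \<Rightarrow> state" where
  "lincomb c p d q =
     (\<lambda>x. c * fst p x + d * fst q x, \<lambda>x. c * snd p x + d * snd q x)"

definition dist_H0 :: "(real \<Rightarrow> real) \<Rightarrow> state \<Rightarrow> state \<Rightarrow> real" where
  "dist_H0 a p q = norm_H0 a (lincomb 1 p (-1) q)"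

definition state_eq :: "state \<Rightarrow> state \<Rightarrow> bool" (infix "\<approx>" 50) where
  "p \<approx> q \<longleftrightarrow> (AE x in unit_leb. fst p x = fst q x \<and> snd p x = snd q x)"

definition A_op :: "(real \<Rightarrow> real) \<Rightarrow> (real \<Rightarrow> real) \<Rightarrow> real \<Rightarrow> real" where
  "A_op a u = (\<lambda>x. a x * weak_deriv 4 u x)"

definition dom_A :: "(real \<Rightarrow> real) \<Rightarrow> (real \<Rightarrow> real) set" where
  "dom_A a = {u \<in> H2_weighted a. (\<exists>w. has_weak_deriv 4 u w) \<and> A_op a u \<in> L2_weighted a}"

definition wave_op :: "(real \<Rightarrow> real) \<Rightarrow> state \<Rightarrow> state" where
  "wave_op a p = (snd p, \<lambda>x. - A_op a (fst p) x)"

definition dom_wave_op :: "(real \<Rightarrow> real) \<Rightarrow> state set" where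
  "dom_wave_op a = dom_A a \<times> H2_weighted a"

subsection \<open>The semigroup and its orbits\<close>

definition contraction_semigroup :: "(real \<Rightarrow> real) \<Rightarrow> (real \<Rightarrow> state \<Rightarrow> state) \<Rightarrow> bool" where
  "contraction_semigroup a S \<longleftrightarrow>
     (\<forall>t\<ge>0. \<forall>p\<in>H0 a. S t p \<in> H0 a) \<and>
     (\<forall>t\<ge>0. \<forall>p\<in>H0 a. \<forall>q\<in>H0 a. \<forall>c d.
        S t (lincomb c p d q) \<approx> lincomb c (S t p) d (S t q)) \<and>
     (\<forall>t\<ge>0. \<forall>p\<in>H0 a. norm_H0 a (S t p) \<le> norm_H0 a p) \<and>
     (\<forall>p\<in>H0 a. S 0 p \<approx> p) \<and>
     (\<forall>s\<ge>0. \<forall>t\<ge>0. \<forall>p\<in>H0 a. S (s + t) p \<approx> S s (S t p)) \<and>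
     (\<forall>p\<in>H0 a. ((\<lambda>t. dist_H0 a (S t p) p) \<longlongrightarrow> 0) (at_right 0))"

text \<open>The infinitesimal generator of \<open>S\<close>, domain included, is \<open>wave_op a\<close> on
  \<open>dom_wave_op a\<close>.\<close>

definition generated_by_wave_op :: "(real \<Rightarrow> real) \<Rightarrow> (real \<Rightarrow> state \<Rightarrow> state) \<Rightarrow> bool" where
  "generated_by_wave_op a S \<longleftrightarrow> (\<forall>p\<in>H0 a. \<forall>q\<in>H0 a.
     ((\<lambda>h. dist_H0 a (lincomb (1 / h) (S h p) (- 1 / h) p) q) \<longlongrightarrow> 0) (at_right 0) \<longleftrightarrow>
     p \<in> dom_wave_op a \<and> q \<approx> wave_op a p)"

text \<open>A solution is given as the pair of position and velocity. Equation, clamped boundary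
  conditions and initial conditions are encoded in the semigroup.\<close>

definition mild_solution :: "(real \<Rightarrow> real) \<Rightarrow> (real \<Rightarrow> state) \<Rightarrow> state \<Rightarrow> bool" where
  "mild_solution a Y p \<longleftrightarrow> p \<in> H0 a \<and>
     (\<exists>S. contraction_semigroup a S \<and> generated_by_wave_op a S \<and> (\<forall>t\<ge>0. Y t \<approx> S t p))"

definition classical_solution :: "(real \<Rightarrow> real) \<Rightarrow> (real \<Rightarrow> state) \<Rightarrow> state \<Rightarrow> bool" where
  "classical_solution a Y p \<longleftrightarrow> mild_solution a Y p \<and> p \<in> dom_wave_op a"

definition energy :: "(real \<Rightarrow> real) \<Rightarrow> (real \<Rightarrow> state) \<Rightarrow> real \<Rightarrow> real" where
  "energy a Y t =
     1 / 2 * (\<integral>x. (snd (Y t) x)\<^sup>2 / a x + (weak_deriv 2 (fst (Y t)) x)\<^sup>2 \<partial>unit_leb)"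

subsection \<open>The boundary trace of the second derivative\<close>

text \<open>The value at \<open>1\<close> of the representative of the second weak derivative that is
  continuous up to \<open>1\<close>. It exists on \<open>dom_A a\<close>, where the fourth derivative is square
  integrable near \<open>1\<close>.\<close>

definition trace_xx :: "(real \<Rightarrow> real) \<Rightarrow> real" where
  "trace_xx u = (THE c. \<exists>w. has_weak_deriv 2 u w \<and> (w \<longlongrightarrow> c) (at_left 1))"

definition tendsto_L2 :: "real set \<Rightarrow> (nat \<Rightarrow> real \<Rightarrow> real) \<Rightarrow> (real \<Rightarrow> real) \<Rightarrow> bool" where
  "tendsto_L2 I f g \<longleftrightarrow> (\<forall>n. f n \<in> L2 I) \<and> g \<in> L2 I \<and>
     (\<lambda>n. \<integral>t. (f n t - g t)\<^sup>2 \<partial>lebesgue_on I) \<longlonglongrightarrow> 0"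

text \<open>\<open>z\<close> is the trace at \<open>x = 1\<close>, on the time interval from \<open>0\<close> to \<open>T\<close>, of the second space
  derivative of the mild solution with data \<open>p\<close>.\<close>

definition mild_trace_xx :: "(real \<Rightarrow> real) \<Rightarrow> real \<Rightarrow> state \<Rightarrow> (real \<Rightarrow> real) \<Rightarrow> bool" where
  "mild_trace_xx a T p z \<longleftrightarrow> (\<exists>P W.
     (\<forall>n::nat. classical_solution a (W n) (P n)) \<and>
     (\<lambda>n. dist_H0 a (P n) p) \<longlonglongrightarrow> 0 \<and>
     tendsto_L2 {0<..<T} (\<lambda>n t. trace_xx (fst (W n t))) z)"

end

theory Submission
  imports Defs
begin

text \<open>
  Let \<open>(u, v)\<close> be a state in the domain of the generator. Multiplying the equation by
  \<open>x u\<^sub>x / a\<close> and integrating by parts in \<open>x\<close> gives the identity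
  \<open>u\<^sub>x\<^sub>x(1)\<^sup>2 / 2 = B(A(u,v), (u,v)) + B((u,v), A(u,v)) + 3/2 \<integral> u\<^sub>x\<^sub>x\<^sup>2 + 1/2 \<integral> (1 - x a' / a) v\<^sup>2 / a\<close>
  with the bilinear form \<open>B(p, q) = \<integral> v\<^sub>p x (u\<^sub>q)\<^sub>x / a\<close>. Since \<open>x |a'| \<le> 2 a\<close>, the quotient
  \<open>x\<^sup>2 / a\<close> is bounded by \<open>1 / a(1)\<close>; hence \<open>B\<close> is bounded on the energy space, all boundary terms
  at \<open>0\<close> vanish, and the right-hand side is at most the time derivative of \<open>B\<close> along the orbit plus
  \<open>3/2\<close> times the squared norm. Integrating in time bounds the trace of classical solutions; by
  linearity the bound passes to differences, so it yields the existence of the trace for mild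
  solutions by completeness of \<open>L\<^sup>2(0,T)\<close> and survives the limit.
\<close>

subsection \<open>Square integrable functions\<close>

text \<open>The obstacle is the degenerate end point. For \<open>u\<close> in \<open>dom_A a\<close>
  the function \<open>sqrt a * u''''\<close> is square integrable, so the bound on
  \<open>x\<^sup>2 / a\<close> gives \<open>x * u''''\<close> in \<open>L2\<close> and nothing
  better near 0. Cauchy-Schwarz against \<open>1 / x\<close> on \<open>[e, 1]\<close> turns this
  into growth of \<open>u'''\<close> like \<open>1 / sqrt e\<close>; one more integration makes
  \<open>u''\<close> bounded, and \<open>u'\<close> decays like \<open>e\<close>. Hence every
  integration by parts runs on \<open>[e, 1]\<close>, and the boundary terms at \<open>e\<close>
  vanish as \<open>e\<close> tends to 0. All spaces consist of almost everywhere classes; point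
  values of \<open>u\<close> and \<open>u'\<close> come from writing them as primitives of
  \<open>g = weak_deriv 2 u\<close> based at 0. In time, the bilinear form is differentiated along
  orbits using only norm convergence of difference quotients, and the growth of the norm is
  controlled by contractivity alone. The estimate obtained has the factor
  \<open>3 * T + 2 * max (1 / a 1) 1\<close> in front of the squared norm, which is twice the
  initial energy; the stated constant results from enlarging this factor.\<close>

definition sq_int :: "'a measure \<Rightarrow> ('a \<Rightarrow> real) \<Rightarrow> bool" where
  "sq_int M f \<longleftrightarrow> f \<in> borel_measurable M \<and> integrable M (\<lambda>x. (f x)\<^sup>2)"

text \<open>Kept over an arbitrary measure because it serves on the unit interval in space and on
  \<open>(0, T)\<close> in time. Without integrability of the square the integral defaults to 0,
  which is why \<open>sq_int\<close> accompanies it.\<close>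

definition l2norm :: "'a measure \<Rightarrow> ('a \<Rightarrow> real) \<Rightarrow> real" where
  "l2norm M f = sqrt (\<integral>x. (f x)\<^sup>2 \<partial>M)"

lemma sq_int_measurable: "sq_int M f \<Longrightarrow> f \<in> borel_measurable M"
  by (simp add: sq_int_def)

lemma sq_int_integrable_sq: "sq_int M f \<Longrightarrow> integrable M (\<lambda>x. (f x)\<^sup>2)"
  by (simp add: sq_int_def)

lemma sq_int_mult_integrable:
  assumes "sq_int M f" "sq_int M g"
  shows "integrable M (\<lambda>x. f x * g x)"
proof (rule Bochner_Integration.integrable_bound)
  show "integrable M (\<lambda>x. (f x)\<^sup>2 + (g x)\<^sup>2)"
    using assms by (simp add: sq_int_def)
  show "(\<lambda>x. f x * g x) \<in> borel_measurable M"
    using assms by (auto simp: sq_int_def)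
  have "\<bar>s * t\<bar> \<le> s\<^sup>2 + t\<^sup>2" for s t :: real
  proof -
    have "2 * (\<bar>s\<bar> * \<bar>t\<bar>) \<le> s\<^sup>2 + t\<^sup>2"
      using sum_squares_bound[of "\<bar>s\<bar>" "\<bar>t\<bar>"] by (simp add: mult.assoc)
    moreover have "0 \<le> \<bar>s\<bar> * \<bar>t\<bar>" by simp
    ultimately show ?thesis unfolding abs_mult by linarith
  qed
  then show "AE x in M. norm (f x * g x) \<le> norm ((f x)\<^sup>2 + (g x)\<^sup>2)"
    by (intro AE_I2) (simp add: abs_mult)
qed

lemma sq_int_lincomb:
  assumes "sq_int M f" "sq_int M g"
  shows "sq_int M (\<lambda>x. c * f x + d * g x)"
proof -
  have "(\<lambda>x. (c * f x + d * g x)\<^sup>2) = (\<lambda>x. c\<^sup>2 * (f x)\<^sup>2 + d\<^sup>2 * (g x)\<^sup>2 + (2 * c * d) * (f x * g x))"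
    by (auto simp: fun_eq_iff power2_eq_square algebra_simps)
  then have "integrable M (\<lambda>x. (c * f x + d * g x)\<^sup>2)"
    using assms sq_int_mult_integrable[OF assms] by (simp add: sq_int_def)
  then show ?thesis using assms by (auto simp: sq_int_def)
qed

lemma sq_int_diff: "sq_int M f \<Longrightarrow> sq_int M g \<Longrightarrow> sq_int M (\<lambda>x. f x - g x)"
  using sq_int_lincomb[of M f g 1 "-1"] by simp

lemma sq_int_cmult: "sq_int M f \<Longrightarrow> sq_int M (\<lambda>x. c * f x)"
  using sq_int_lincomb[of M f f c 0] by simp

lemma l2norm_nonneg [simp]: "0 \<le> l2norm M f"
  by (simp add: l2norm_def)

lemma l2norm_power2: "(l2norm M f)\<^sup>2 = (\<integral>x. (f x)\<^sup>2 \<partial>M)"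
  by (simp add: l2norm_def)

lemma sq_int_Cauchy_Schwarz:
  assumes "sq_int M f" "sq_int M g"
  shows "\<bar>\<integral>x. f x * g x \<partial>M\<bar> \<le> l2norm M f * l2norm M g"
proof -
  define F G P where "F = (\<integral>x. (f x)\<^sup>2 \<partial>M)" and "G = (\<integral>x. (g x)\<^sup>2 \<partial>M)"
    and "P = (\<integral>x. f x * g x \<partial>M)"
  have i: "integrable M (\<lambda>x. (f x)\<^sup>2)" "integrable M (\<lambda>x. (g x)\<^sup>2)" "integrable M (\<lambda>x. f x * g x)"
    using assms sq_int_mult_integrable[OF assms] by (auto simp: sq_int_def)
  have quad: "0 \<le> s\<^sup>2 * F + 2 * s * P + G" for s
  proof -
    have "0 \<le> (\<integral>x. (s * f x + g x)\<^sup>2 \<partial>M)" by simp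
    also have "(\<lambda>x. (s * f x + g x)\<^sup>2) = (\<lambda>x. s\<^sup>2 * (f x)\<^sup>2 + 2 * s * (f x * g x) + (g x)\<^sup>2)"
      by (auto simp: fun_eq_iff power2_eq_square algebra_simps)
    also have "(\<integral>x. s\<^sup>2 * (f x)\<^sup>2 + 2 * s * (f x * g x) + (g x)\<^sup>2 \<partial>M) = s\<^sup>2 * F + 2 * s * P + G"
      using i by (simp add: F_def G_def P_def)
    finally show ?thesis .
  qed
  have F0: "0 \<le> F" by (simp add: F_def)
  have "P\<^sup>2 \<le> F * G"
  proof (cases "F = 0")
    case True
    then have "AE x in M. (f x)\<^sup>2 = 0"
      using integral_nonneg_eq_0_iff_AE[OF i(1)] by (simp add: F_def)
    then have "AE x in M. f x * g x = 0" by eventually_elim simp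
    then have "P = 0" unfolding P_def by (rule integral_eq_zero_AE)
    then show ?thesis using True by simp
  next
    case False
    then have F: "F > 0" using F0 by simp
    \<comment> \<open>\<open>s = -P/F\<close> minimises the quadratic; the factor \<open>F\<close>
      clears the denominator.\<close>
    have "0 \<le> F * ((-P/F)\<^sup>2 * F + 2 * (-P/F) * P + G)" using quad[of "-P/F"] F by simp
    also have "\<dots> = F * G - P\<^sup>2" using F by (simp add: power2_eq_square field_simps)
    finally show ?thesis by simp
  qed
  then have "sqrt (P\<^sup>2) \<le> sqrt (F * G)" by (rule real_sqrt_le_mono)
  then show ?thesis by (simp add: l2norm_def real_sqrt_mult F_def G_def P_def)
qed

lemma l2norm_triangle:
  assumes "sq_int M f" "sq_int M g"
  shows "l2norm M (\<lambda>x. f x + g x) \<le> l2norm M f + l2norm M g"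
proof (rule power2_le_imp_le)
  have i: "integrable M (\<lambda>x. (f x)\<^sup>2)" "integrable M (\<lambda>x. (g x)\<^sup>2)" "integrable M (\<lambda>x. f x * g x)"
    using assms sq_int_mult_integrable[OF assms] by (auto simp: sq_int_def)
  have "(\<lambda>x. (f x + g x)\<^sup>2) = (\<lambda>x. (f x)\<^sup>2 + 2 * (f x * g x) + (g x)\<^sup>2)"
    by (auto simp: fun_eq_iff power2_eq_square algebra_simps)
  then have "(l2norm M (\<lambda>x. f x + g x))\<^sup>2 = (l2norm M f)\<^sup>2 + 2 * (\<integral>x. f x * g x \<partial>M) + (l2norm M g)\<^sup>2"
    using i by (simp add: l2norm_power2)
  also have "\<dots> \<le> (l2norm M f + l2norm M g)\<^sup>2"
    using sq_int_Cauchy_Schwarz[OF assms] by (simp add: power2_sum)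
  finally show "(l2norm M (\<lambda>x. f x + g x))\<^sup>2 \<le> (l2norm M f + l2norm M g)\<^sup>2" .
qed (simp add: add_nonneg_nonneg)

lemma l2norm_scale: "l2norm M (\<lambda>x. c * f x) = \<bar>c\<bar> * l2norm M f"
  by (simp add: l2norm_def power_mult_distrib real_sqrt_mult)

lemma l2norm_minus_commute: "l2norm M (\<lambda>x. f x - g x) = l2norm M (\<lambda>x. g x - f x)"
  by (simp add: l2norm_def power2_commute)

lemma l2norm_triangle_diff:
  assumes "sq_int M f" "sq_int M g" "sq_int M h"
  shows "l2norm M (\<lambda>x. f x - h x) \<le> l2norm M (\<lambda>x. f x - g x) + l2norm M (\<lambda>x. g x - h x)"
  using l2norm_triangle[OF sq_int_diff[OF assms(1,2)] sq_int_diff[OF assms(2,3)]] by simp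

lemma l2norm_diff_abs:
  assumes "sq_int M f" "sq_int M g"
  shows "\<bar>l2norm M f - l2norm M g\<bar> \<le> l2norm M (\<lambda>x. f x - g x)"
  using l2norm_triangle[OF sq_int_diff[OF assms] assms(2)]
    l2norm_triangle[OF sq_int_diff[OF assms(2,1)] assms(1)]
  by (simp add: l2norm_minus_commute[of M g f])

lemma l2norm_cong_AE:
  assumes "f \<in> borel_measurable M" "g \<in> borel_measurable M" "AE x in M. f x = g x"
  shows "l2norm M f = l2norm M g"
proof -
  have "(\<integral>x. (f x)\<^sup>2 \<partial>M) = (\<integral>x. (g x)\<^sup>2 \<partial>M)"
    using assms by (intro integral_cong_AE) (auto elim: eventually_mono)
  then show ?thesis by (simp add: l2norm_def)
qed

lemma sq_int_cong_AE:
  assumes "sq_int M f" "g \<in> borel_measurable M" "AE x in M. f x = g x"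
  shows "sq_int M g"
proof -
  have "integrable M (\<lambda>x. (g x)\<^sup>2)"
  proof (rule Bochner_Integration.integrable_bound)
    show "integrable M (\<lambda>x. (f x)\<^sup>2)" using assms(1) by (simp add: sq_int_def)
    show "(\<lambda>x. (g x)\<^sup>2) \<in> borel_measurable M" using assms(2) by simp
    show "AE x in M. norm ((g x)\<^sup>2) \<le> norm ((f x)\<^sup>2)" using assms(3) by eventually_elim simp
  qed
  then show ?thesis using assms(2) by (simp add: sq_int_def)
qed

lemma l2norm_tendsto_iff:
  "(\<lambda>n. l2norm M (f n)) \<longlonglongrightarrow> 0 \<longleftrightarrow> (\<lambda>n. \<integral>x. (f n x)\<^sup>2 \<partial>M) \<longlonglongrightarrow> 0"
proof
  assume "(\<lambda>n. l2norm M (f n)) \<longlonglongrightarrow> 0"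
  then have "(\<lambda>n. (l2norm M (f n))\<^sup>2) \<longlonglongrightarrow> 0\<^sup>2" by (rule tendsto_power)
  then show "(\<lambda>n. \<integral>x. (f n x)\<^sup>2 \<partial>M) \<longlonglongrightarrow> 0" by (simp add: l2norm_power2)
next
  assume "(\<lambda>n. \<integral>x. (f n x)\<^sup>2 \<partial>M) \<longlonglongrightarrow> 0"
  then have "(\<lambda>n. sqrt (\<integral>x. (f n x)\<^sup>2 \<partial>M)) \<longlonglongrightarrow> sqrt 0" by (rule tendsto_real_sqrt)
  then show "(\<lambda>n. l2norm M (f n)) \<longlonglongrightarrow> 0" by (simp add: l2norm_def)
qed

lemma sq_int_integrable:
  assumes "finite_measure M" "sq_int M f"
  shows "integrable M f"
proof -
  interpret finite_measure M by fact
  have "sq_int M (\<lambda>x. 1)" by (simp add: sq_int_def)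
  from sq_int_mult_integrable[OF assms(2) this] show ?thesis by simp
qed

text \<open>On a finite measure space an \<open>L2\<close> Cauchy sequence is Cauchy in
  \<open>L1\<close>, so a subsequence converges almost everywhere; Fatou's lemma along it shows that
  the pointwise limit is the \<open>L2\<close> limit of the whole sequence. This will produce the
  trace of a mild solution.\<close>

lemma l2_complete:
  fixes f :: "nat \<Rightarrow> 'a \<Rightarrow> real"
  assumes fin: "finite_measure M" and f: "\<And>n. sq_int M (f n)"
    and cauchy: "\<And>e. e > 0 \<Longrightarrow> \<exists>N. \<forall>i\<ge>N. \<forall>j\<ge>N. l2norm M (\<lambda>x. f i x - f j x) < e"
  obtains g where "sq_int M g" "(\<lambda>n. l2norm M (\<lambda>x. f n x - g x)) \<longlonglongrightarrow> 0"
proof -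
  interpret finite_measure M by fact
  have meas [measurable]: "f n \<in> borel_measurable M" for n using f by (simp add: sq_int_def)
  have one: "sq_int M (\<lambda>x. 1)" by (simp add: sq_int_def)
  have int: "integrable M (f n)" for n using sq_int_integrable[OF fin f] .
  define C where "C = l2norm M (\<lambda>x. 1)"
  have C: "C \<ge> 0" by (simp add: C_def)
  have L1: "(LINT x|M. norm (f i x - f j x)) \<le> l2norm M (\<lambda>x. f i x - f j x) * C" for i j
  proof -
    have "sq_int M (\<lambda>x. \<bar>f i x - f j x\<bar>)"
      using sq_int_diff[OF f f, of i j] by (simp add: sq_int_def)
    from sq_int_Cauchy_Schwarz[OF this one]
    show ?thesis by (simp add: C_def l2norm_def)
  qed
  obtain r where r: "strict_mono r" "AE x in M. Cauchy (\<lambda>i. f (r i) x)"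
  proof (rule cauchy_L1_AE_cauchy_subseq[of M f])
    show "integrable M (f n)" for n by fact
    fix e :: real assume "e > 0"
    \<comment> \<open>\<open>C + 1\<close> instead of \<open>C\<close>, since \<open>C\<close>
      vanishes when the whole space is null.\<close>
    then have "e / (C + 1) > 0" using C by simp
    from cauchy[OF this] obtain N where N: "\<forall>i\<ge>N. \<forall>j\<ge>N. l2norm M (\<lambda>x. f i x - f j x) < e / (C + 1)" by blast
    have "LINT x|M. norm (f i x - f j x) < e" if "i \<ge> N" "j \<ge> N" for i j
    proof -
      have "(LINT x|M. norm (f i x - f j x)) \<le> l2norm M (\<lambda>x. f i x - f j x) * C" by (rule L1)
      also have "\<dots> \<le> l2norm M (\<lambda>x. f i x - f j x) * (C + 1)" by (simp add: mult_left_mono)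
      also have "\<dots> < e / (C + 1) * (C + 1)" using N that C by (intro mult_strict_right_mono) auto
      finally show ?thesis using C by simp
    qed
    then show "\<exists>N. \<forall>i\<ge>N. \<forall>j\<ge>N. LINT x|M. norm (f i x - f j x) < e" by blast
  qed blast
  \<comment> \<open>Off the convergence set, on a null set, the value is 0, which keeps
    \<open>g\<close> measurable.\<close>
  define g where "g x = (if Cauchy (\<lambda>i. f (r i) x) then lim (\<lambda>i. f (r i) x) else 0)" for x
  have gm [measurable]: "g \<in> borel_measurable M" unfolding g_def by measurable
  have lim: "AE x in M. (\<lambda>i. f (r i) x) \<longlonglongrightarrow> g x"
    using r(2)
  proof eventually_elim
    case (elim x)
    then show ?case by (simp add: g_def real_Cauchy_convergent convergent_LIMSEQ_iff[symmetric])
  qed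
  \<comment> \<open>Fatou in the second index: \<open>n\<close> stays fixed while the subsequence
    runs to infinity, so a Cauchy bound becomes a bound against the limit. It also yields the
    integrability without which the Bochner integral would say nothing.\<close>
  have key: "integrable M (\<lambda>x. (f n x - g x)\<^sup>2) \<and> l2norm M (\<lambda>x. f n x - g x) \<le> e"
    if e: "e > 0" and N: "\<forall>j\<ge>N. l2norm M (\<lambda>x. f n x - f j x) < e" for n e N
  proof -
    have "(\<integral>\<^sup>+x. ennreal ((f n x - g x)\<^sup>2) \<partial>M) = (\<integral>\<^sup>+x. liminf (\<lambda>i. ennreal ((f n x - f (r i) x)\<^sup>2)) \<partial>M)"
    proof (rule nn_integral_cong_AE)
      show "AE x in M. ennreal ((f n x - g x)\<^sup>2) = liminf (\<lambda>i. ennreal ((f n x - f (r i) x)\<^sup>2))"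
        using lim
      proof eventually_elim
        case (elim x)
        then have "(\<lambda>i. ennreal ((f n x - f (r i) x)\<^sup>2)) \<longlonglongrightarrow> ennreal ((f n x - g x)\<^sup>2)"
          by (intro tendsto_intros)
        then have "liminf (\<lambda>i. ennreal ((f n x - f (r i) x)\<^sup>2)) = ennreal ((f n x - g x)\<^sup>2)"
            by (rule lim_imp_Liminf[OF trivial_limit_sequentially])
          then show ?case by (rule sym)
      qed
    qed
    also have "\<dots> \<le> liminf (\<lambda>i. \<integral>\<^sup>+x. ennreal ((f n x - f (r i) x)\<^sup>2) \<partial>M)"
      by (intro nn_integral_liminf) measurable
    also have "\<dots> \<le> ennreal (e\<^sup>2)"
    proof (rule order.trans)
      have "\<forall>\<^sub>F i in sequentially. (\<integral>\<^sup>+x. ennreal ((f n x - f (r i) x)\<^sup>2) \<partial>M) \<le> ennreal (e\<^sup>2)"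
        using eventually_ge_at_top[of N]
      proof eventually_elim
        case (elim i)
        then have "r i \<ge> N" using seq_suble[OF r(1), of i] by linarith
        then have "l2norm M (\<lambda>x. f n x - f (r i) x) < e" using N by blast
        then have "(l2norm M (\<lambda>x. f n x - f (r i) x))\<^sup>2 \<le> e\<^sup>2" by (simp add: power_mono)
        moreover have "integrable M (\<lambda>x. (f n x - f (r i) x)\<^sup>2)"
          using sq_int_diff[OF f f] by (simp add: sq_int_def)
        ultimately show ?case
          by (subst nn_integral_eq_integral) (auto simp: l2norm_power2 intro!: ennreal_leI)
      qed
      then show "liminf (\<lambda>i. \<integral>\<^sup>+x. ennreal ((f n x - f (r i) x)\<^sup>2) \<partial>M) \<le> liminf (\<lambda>i::nat. ennreal (e\<^sup>2))"
        by (rule Liminf_mono)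
    qed (simp add: Liminf_const)
    finally have *: "(\<integral>\<^sup>+x. ennreal ((f n x - g x)\<^sup>2) \<partial>M) \<le> ennreal (e\<^sup>2)" .
    have i: "integrable M (\<lambda>x. (f n x - g x)\<^sup>2)"
      using * by (intro integrableI_bounded) (use le_less_trans[OF _ ennreal_less_top] in auto)
    have "ennreal (\<integral>x. (f n x - g x)\<^sup>2 \<partial>M) \<le> ennreal (e\<^sup>2)"
      using * nn_integral_eq_integral[OF i] by simp
    then have "(\<integral>x. (f n x - g x)\<^sup>2 \<partial>M) \<le> e\<^sup>2" by (simp add: ennreal_le_iff)
    then have "sqrt (\<integral>x. (f n x - g x)\<^sup>2 \<partial>M) \<le> sqrt (e\<^sup>2)" by (rule real_sqrt_le_mono)
    then show ?thesis using i e by (simp add: l2norm_def)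
  qed
  have sqd: "sq_int M (\<lambda>x. f n x - g x)" if "\<forall>j\<ge>N. l2norm M (\<lambda>x. f n x - f j x) < e" "e > 0" for n e N
    using key[OF that(2,1)] by (simp add: sq_int_def)
  obtain N1 where N1: "\<forall>i\<ge>N1. \<forall>j\<ge>N1. l2norm M (\<lambda>x. f i x - f j x) < 1" using cauchy[of 1] by auto
  have "sq_int M (\<lambda>x. f N1 x - g x)" using sqd[of N1 N1 1] N1 by auto
  from sq_int_diff[OF f[of N1] this] have g: "sq_int M g" by simp
  have "(\<lambda>n. l2norm M (\<lambda>x. f n x - g x)) \<longlonglongrightarrow> 0"
  proof (rule LIMSEQ_I)
    fix e :: real assume "e > 0"
    then have e2: "e / 2 > 0" by simp
    from cauchy[OF e2] obtain N where N: "\<forall>i\<ge>N. \<forall>j\<ge>N. l2norm M (\<lambda>x. f i x - f j x) < e/2" by blast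
    have "l2norm M (\<lambda>x. f n x - g x) \<le> e/2" if "n \<ge> N" for n
      using key[OF e2, of N n] N that by auto
    then show "\<exists>N. \<forall>n\<ge>N. norm (l2norm M (\<lambda>x. f n x - g x) - 0) < e"
      using \<open>e > 0\<close> by (intro exI[of _ N]) force
  qed
  with g show thesis by (rule that)
qed

subsection \<open>Smooth functions and test functions\<close>

definition smooth :: "(real \<Rightarrow> real) \<Rightarrow> bool" where
  "smooth f \<longleftrightarrow> (\<forall>k x. (deriv ^^ k) f differentiable (at x))"

lemma smooth_has_deriv: "smooth f \<Longrightarrow> (f has_real_derivative deriv f x) (at x)"
  unfolding smooth_def
  by (metis DERIV_deriv_iff_real_differentiable funpow_0)

lemma smooth_deriv: "smooth f \<Longrightarrow> smooth (deriv f)"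
  unfolding smooth_def by (metis funpow_Suc_right o_apply)

text \<open>Iterated derivatives never leave a class that is closed under differentiation.\<close>

lemma smooth_coinduct:
  assumes "P f" and step: "\<And>g. P g \<Longrightarrow> \<exists>g'. P g' \<and> (\<forall>x. (g has_real_derivative g' x) (at x))"
  shows "smooth f"
proof -
  have "P ((deriv ^^ k) f)" for k
  proof (induction k)
    case (Suc k)
    obtain g' where g': "P g'" "\<forall>x. ((deriv ^^ k) f has_real_derivative g' x) (at x)"
      using step[OF Suc] by blast
    then have "deriv ((deriv ^^ k) f) = g'" by (auto intro!: DERIV_imp_deriv)
    then show ?case using g' by simp
  qed (use assms in simp)
  then show ?thesis
    unfolding smooth_def using step by (metis real_differentiable_def)
qed

text \<open>The powers of \<open>1 / x\<close> make the family closed under differentiation up to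
  linear combinations; \<open>k = 0\<close> is the classical function that is flat at 0.\<close>

definition exp_bump :: "nat \<Rightarrow> real \<Rightarrow> real" where
  "exp_bump k x = (if x > 0 then (1 / x) ^ k * exp (- (1 / x)) else 0)"

lemma exp_bump_deriv:
  "(exp_bump k has_real_derivative (exp_bump (k + 2) x + (- real k) * exp_bump (k + 1) x)) (at x)"
proof -
  consider "x > 0" | "x < 0" | "x = 0" by linarith
  then show ?thesis
  proof cases
    case 1
    have "((\<lambda>x. (1 / x) ^ k * exp (- (1 / x))) has_real_derivative
        (exp_bump (k + 2) x + (- real k) * exp_bump (k + 1) x)) (at x)"
    proof -
      define y where "y = 1 / x"
      have d: "((\<lambda>x. 1 / x) has_real_derivative (- y\<^sup>2)) (at x)"
        using 1 by (auto intro!: derivative_eq_intros simp: y_def power2_eq_square)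
      have "((\<lambda>x. (1 / x) ^ k * exp (- (1 / x))) has_real_derivative
          (real k * (- y\<^sup>2 * y ^ (k - Suc 0))) * exp (- (1 / x)) + (exp (- (1 / x)) * (- (- y\<^sup>2))) * (1 / x) ^ k) (at x)"
        using DERIV_mult[OF DERIV_power[OF d, of k] DERIV_fun_exp[OF DERIV_minus[OF d]]] by (simp only: y_def)
      moreover have "(real k * (- y\<^sup>2 * y ^ (k - Suc 0))) * exp (- (1 / x)) + (exp (- (1 / x)) * (- (- y\<^sup>2))) * (1 / x) ^ k
          = exp_bump (k + 2) x + (- real k) * exp_bump (k + 1) x"
        unfolding exp_bump_def y_def[symmetric] using 1
        by (cases k) (simp_all add: power2_eq_square algebra_simps)
      ultimately show ?thesis by simp
    qed
    then show ?thesis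
      by (rule DERIV_cong_ev[THEN iffD1, rotated 3])
        (use 1 eventually_nhds_in_open[of "{0<..}" x] in \<open>auto simp: exp_bump_def elim!: eventually_mono\<close>)
  next
    case 2
    have "((\<lambda>x. 0) has_real_derivative 0) (at x)" by simp
    then have "(exp_bump k has_real_derivative 0) (at x)"
      by (rule DERIV_cong_ev[THEN iffD1, rotated 3])
        (use 2 eventually_nhds_in_open[of "{..<0}" x] in \<open>auto simp: exp_bump_def elim!: eventually_mono\<close>)
    then show ?thesis using 2 by (simp add: exp_bump_def)
  next
    case 3
    \<comment> \<open>With \<open>y = 1 / h\<close> the right difference quotient at 0 is
      \<open>y ^ (k + 1) / exp y\<close>.\<close>
    have "((\<lambda>y. y ^ (k + 1) / exp y) \<longlongrightarrow> 0) (at_top :: real filter)"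
      by (rule tendsto_power_div_exp_0)
    then have "((\<lambda>h. (inverse h) ^ (k + 1) / exp (inverse h)) \<longlongrightarrow> 0) (at_right (0::real))"
      by (rule filterlim_compose[OF _ filterlim_inverse_at_top_right])
    then have R: "((\<lambda>h. exp_bump k h / h) \<longlongrightarrow> 0) (at_right 0)"
    proof (rule Lim_transform_eventually)
      show "\<forall>\<^sub>F h in at_right 0. inverse h ^ (k + 1) / exp (inverse h) = exp_bump k h / h"
        using eventually_at_right_less[of 0]
        by eventually_elim (simp add: exp_bump_def exp_minus field_simps)
    qed
    have L: "((\<lambda>h. exp_bump k h / h) \<longlongrightarrow> 0) (at_left 0)"
    proof (rule Lim_transform_eventually[OF tendsto_const])
      show "\<forall>\<^sub>F h in at_left 0. 0 = exp_bump k h / h"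
        using eventually_at_left_real[of "-1" 0]
        by (simp, elim eventually_mono) (simp add: exp_bump_def)
    qed
    have "((\<lambda>h. exp_bump k h / h) \<longlongrightarrow> 0) (at 0)"
      using L R by (simp add: filterlim_at_split)
    then show ?thesis using 3
      by (simp add: DERIV_def exp_bump_def)
  qed
qed

text \<open>An inductive closure replaces separate smoothness proofs: one derivative lemma for all
  generators feeds the coinduction. \<open>base\<close> admits arbitrary smooth functions as
  atoms.\<close>

inductive smooth_gen :: "(real \<Rightarrow> real) \<Rightarrow> bool" where
  base: "smooth f \<Longrightarrow> smooth_gen f"
| bump: "smooth_gen (exp_bump k)"
| const: "smooth_gen (\<lambda>x. c)"
| ident: "smooth_gen (\<lambda>x. x)"
| add: "smooth_gen f \<Longrightarrow> smooth_gen g \<Longrightarrow> smooth_gen (\<lambda>x. f x + g x)"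
| mult: "smooth_gen f \<Longrightarrow> smooth_gen g \<Longrightarrow> smooth_gen (\<lambda>x. f x * g x)"
| affine: "smooth_gen f \<Longrightarrow> smooth_gen (\<lambda>x. f (m * x + b))"

lemma smooth_gen_deriv:
  "smooth_gen f \<Longrightarrow> \<exists>f'. smooth_gen f' \<and> (\<forall>x. (f has_real_derivative f' x) (at x))"
proof (induction rule: smooth_gen.induct)
  case (base f)
  then show ?case
    by (intro exI[of _ "deriv f"] conjI allI smooth_gen.base smooth_deriv smooth_has_deriv)
next
  case (bump k)
  show ?case
    by (intro exI[of _ "\<lambda>x. exp_bump (k + 2) x + (- real k) * exp_bump (k + 1) x"] conjI allI
        exp_bump_deriv smooth_gen.add smooth_gen.mult smooth_gen.const smooth_gen.bump)
next
  case (const c)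
  show ?case by (intro exI[of _ "\<lambda>x. 0"] conjI allI smooth_gen.const DERIV_const)
next
  case ident
  show ?case by (intro exI[of _ "\<lambda>x. 1"] conjI allI smooth_gen.const DERIV_ident)
next
  case (add f g)
  then obtain f' g' where fg: "smooth_gen f'" "\<And>x. (f has_real_derivative f' x) (at x)"
    "smooth_gen g'" "\<And>x. (g has_real_derivative g' x) (at x)" by blast
  show ?case
    by (intro exI[of _ "\<lambda>x. f' x + g' x"] conjI allI DERIV_add fg smooth_gen.add)
next
  case (mult f g)
  then obtain f' g' where fg: "smooth_gen f'" "\<And>x. (f has_real_derivative f' x) (at x)"
    "smooth_gen g'" "\<And>x. (g has_real_derivative g' x) (at x)" by blast
  show ?case
    by (intro exI[of _ "\<lambda>x. f' x * g x + g' x * f x"] conjI allI DERIV_mult fg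
       smooth_gen.add smooth_gen.mult mult.hyps)
next
  case (affine f m b)
  then obtain f' where f': "smooth_gen f'" "\<And>x. (f has_real_derivative f' x) (at x)" by blast
  have "((\<lambda>x. f (m * x + b)) has_real_derivative f' (m * x + b) * m) (at x)" for x
    by (rule DERIV_chain2[OF f'(2)]) (auto intro!: derivative_eq_intros)
  moreover have "smooth_gen (\<lambda>x. f' (m * x + b) * m)"
    by (rule smooth_gen.mult[OF smooth_gen.affine[OF f'(1)] smooth_gen.const])
  ultimately show ?case by blast
qed

lemma smooth_gen_smooth: "smooth_gen f \<Longrightarrow> smooth f"
  by (rule smooth_coinduct[of smooth_gen]) (erule smooth_gen_deriv | assumption)+

lemma smooth_const [intro, simp]: "smooth (\<lambda>x. c)"
  by (intro smooth_gen_smooth smooth_gen.const)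
lemma smooth_add: "smooth f \<Longrightarrow> smooth g \<Longrightarrow> smooth (\<lambda>x. f x + g x)"
  by (rule smooth_gen_smooth[OF smooth_gen.add[OF smooth_gen.base smooth_gen.base]])
lemma smooth_mult: "smooth f \<Longrightarrow> smooth g \<Longrightarrow> smooth (\<lambda>x. f x * g x)"
  by (rule smooth_gen_smooth[OF smooth_gen.mult[OF smooth_gen.base smooth_gen.base]])

lemma smooth_exp_bump_affine: "smooth (\<lambda>x. exp_bump k (m * x + b))"
  by (rule smooth_gen_smooth[OF smooth_gen.affine[OF smooth_gen.bump]])

lemma smooth_polynomial: "real_polynomial_function p \<Longrightarrow> smooth p" for p :: "real \<Rightarrow> real"
proof (induction p rule: real_polynomial_function.induct)
  case (linear f)
  then obtain c where "f = (\<lambda>x. x * c)" by (auto simp: real_bounded_linear)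
  then show ?case by (simp add: smooth_gen_smooth smooth_gen.mult smooth_gen.ident smooth_gen.const)
qed (auto intro: smooth_add smooth_mult)

lemma smooth_continuous_on: "smooth f \<Longrightarrow> continuous_on S f"
  by (meson DERIV_isCont continuous_at_imp_continuous_on smooth_has_deriv)

text \<open>The closed support is compact, so its extremal points can serve as end points. Explicit
  end points with \<open>c < d\<close> are the form in which supports are used later.\<close>

lemma test_fun_iff:
  "test_fun \<phi> \<longleftrightarrow> smooth \<phi> \<and> (\<exists>c d. 0 < c \<and> c < d \<and> d < 1 \<and> (\<forall>x. x \<notin> {c..d} \<longrightarrow> \<phi> x = 0))"
proof safe
  assume t: "test_fun \<phi>"
  then show "smooth \<phi>" by (simp add: test_fun_def smooth_def)
  define K where "K = closure {x. \<phi> x \<noteq> 0}"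
  have K: "K \<subseteq> {0<..<1}" using t by (simp add: test_fun_def K_def)
  have "compact K"
    unfolding compact_eq_bounded_closed
    by (intro conjI bounded_subset[OF bounded_closed_interval[of 0 1]] order.trans[OF K]) (auto simp: K_def)
  show "\<exists>c d. 0 < c \<and> c < d \<and> d < 1 \<and> (\<forall>x. x \<notin> {c..d} \<longrightarrow> \<phi> x = 0)"
  proof (cases "K = {}")
    case True
    then have "\<phi> x = 0" for x using closure_subset[of "{x. \<phi> x \<noteq> 0}"] by (auto simp: K_def)
    then show ?thesis by (intro exI[of _ "1/3"] exI[of _ "2/3"]) auto
  next
    case False
    obtain c where c: "c \<in> K" "\<And>x. x \<in> K \<Longrightarrow> c \<le> x"
      using compact_attains_inf[OF \<open>compact K\<close> False] by blast
    obtain d where d: "d \<in> K" "\<And>x. x \<in> K \<Longrightarrow> x \<le> d"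
      using compact_attains_sup[OF \<open>compact K\<close> False] by blast
    have "0 < c" "d < 1" "c \<le> d" using K c d by auto
    moreover have "\<phi> x = 0" if "x \<notin> {c..d}" for x
      using that c d closure_subset[of "{x. \<phi> x \<noteq> 0}"] by (auto simp: K_def)
    \<comment> \<open>The extrema give only \<open>c \<le> d\<close>; moving the right end to the
      midpoint of \<open>d\<close> and 1 makes the inequality strict.\<close>
    ultimately show ?thesis
      by (intro exI[of _ c] exI[of _ "(d + 1) / 2"]) auto
  qed
next
  fix c d :: real
  assume a: "smooth \<phi>" "0 < c" "c < d" "d < 1" "\<forall>x. x \<notin> {c..d} \<longrightarrow> \<phi> x = 0"
  have "closure {x. \<phi> x \<noteq> 0} \<subseteq> {c..d}"
    using a by (intro closure_minimal) auto
  then show "test_fun \<phi>" using a unfolding test_fun_def smooth_def by auto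
qed

lemma test_funE:
  assumes "test_fun \<phi>"
  obtains c d where "0 < c" "c < d" "d < 1" "\<And>x. x \<notin> {c..d} \<Longrightarrow> \<phi> x = 0"
  using assms unfolding test_fun_iff by blast

lemma test_funI:
  assumes "smooth \<phi>" "0 < c" "c < d" "d < 1" "\<And>x. x \<notin> {c..d} \<Longrightarrow> \<phi> x = 0"
  shows "test_fun \<phi>"
  using assms unfolding test_fun_iff by blast

lemma test_fun_smooth: "test_fun \<phi> \<Longrightarrow> smooth \<phi>"
  by (simp add: test_fun_iff)

lemma test_fun_has_deriv: "test_fun \<phi> \<Longrightarrow> (\<phi> has_real_derivative deriv \<phi> x) (at x)"
  by (simp add: smooth_has_deriv test_fun_smooth)

lemma test_fun_continuous_on: "test_fun \<phi> \<Longrightarrow> continuous_on S \<phi>"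
  by (simp add: smooth_continuous_on test_fun_smooth)

lemma test_fun_deriv: assumes "test_fun \<phi>" shows "test_fun (deriv \<phi>)"
proof -
  obtain c d where cd: "0 < c" "c < d" "d < 1" "\<And>x. x \<notin> {c..d} \<Longrightarrow> \<phi> x = 0"
    using test_funE[OF assms] by blast
  show ?thesis
  proof (rule test_funI[OF _ cd(1-3)])
    show "smooth (deriv \<phi>)" by (simp add: assms smooth_deriv test_fun_smooth)
    fix x assume x: "x \<notin> {c..d}"
    have "open (- {c..d})" by (simp add: open_Compl)
    then have "\<forall>\<^sub>F y in nhds x. \<phi> y = 0"
      using eventually_nhds_in_open[of "- {c..d}" x] x cd(4) by (auto elim!: eventually_mono)
    then have "deriv \<phi> x = deriv (\<lambda>y. 0) x" by (rule deriv_cong_ev) simp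
    then show "deriv \<phi> x = 0" by simp
  qed
qed

lemma test_fun_higher_deriv: "test_fun \<phi> \<Longrightarrow> test_fun ((deriv ^^ k) \<phi>)"
  by (induction k) (auto intro: test_fun_deriv)

lemma test_fun_smooth_mult: 
  assumes "test_fun \<phi>" "smooth f"
  shows "test_fun (\<lambda>x. \<phi> x * f x)"
proof -
  obtain c d where cd: "0 < c" "c < d" "d < 1" "\<And>x. x \<notin> {c..d} \<Longrightarrow> \<phi> x = 0"
    using test_funE[OF assms(1)] by blast
  show ?thesis
    by (rule test_funI[OF _ cd(1-3)]) (use assms cd in \<open>auto intro: smooth_mult test_fun_smooth\<close>)
qed

lemma test_fun_scale: "test_fun \<phi> \<Longrightarrow> test_fun (\<lambda>x. c * \<phi> x)"
  using test_fun_smooth_mult[of \<phi> "\<lambda>x. c"] by (simp add: mult.commute)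

lemma test_fun_lincomb:
  assumes "test_fun \<phi>" "test_fun \<psi>"
  shows "test_fun (\<lambda>x. a * \<phi> x + b * \<psi> x)"
proof -
  obtain c d where cd: "0 < c" "c < d" "d < 1" "\<And>x. x \<notin> {c..d} \<Longrightarrow> \<phi> x = 0"
    using test_funE[OF assms(1)] by blast
  obtain c' d' where cd': "0 < c'" "c' < d'" "d' < 1" "\<And>x. x \<notin> {c'..d'} \<Longrightarrow> \<psi> x = 0"
    using test_funE[OF assms(2)] by blast
  show ?thesis
  proof (rule test_funI[of _ "min c c'" "max d d'"])
    show "smooth (\<lambda>x. a * \<phi> x + b * \<psi> x)"
      using assms by (auto intro!: smooth_add smooth_mult intro: test_fun_smooth)
    fix x assume "x \<notin> {min c c'..max d d'}"
    then have "x \<notin> {c..d}" "x \<notin> {c'..d'}" by auto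
    then show "a * \<phi> x + b * \<psi> x = 0" using cd(4) cd'(4) by simp
  qed (use cd cd' in auto)
qed

lemma deriv_test_lincomb:
  assumes "test_fun \<phi>" "test_fun \<psi>"
  shows "(deriv ^^ k) (\<lambda>x. a * \<phi> x + b * \<psi> x) = (\<lambda>x. a * (deriv ^^ k) \<phi> x + b * (deriv ^^ k) \<psi> x)"
proof (induction k)
  case (Suc k)
  have "((\<lambda>x. a * (deriv ^^ k) \<phi> x + b * (deriv ^^ k) \<psi> x) has_real_derivative
     a * deriv ((deriv ^^ k) \<phi>) x + b * deriv ((deriv ^^ k) \<psi>) x) (at x)" for x
    by (intro DERIV_add DERIV_cmult test_fun_has_deriv test_fun_higher_deriv assms)
  then have "deriv (\<lambda>x. a * (deriv ^^ k) \<phi> x + b * (deriv ^^ k) \<psi> x) =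
      (\<lambda>x. a * deriv ((deriv ^^ k) \<phi>) x + b * deriv ((deriv ^^ k) \<psi>) x)"
    by (auto intro!: DERIV_imp_deriv)
  then show ?case using Suc by simp
qed simp

text \<open>A product of two one-sided flat functions, positive exactly on the open interval, so
  that division by it is possible on compact subintervals.\<close>

definition bump_on :: "real \<Rightarrow> real \<Rightarrow> real \<Rightarrow> real" where
  "bump_on c d x = exp_bump 0 (x - c) * exp_bump 0 (d - x)"

lemma bump_on_pos: "c < x \<Longrightarrow> x < d \<Longrightarrow> bump_on c d x > 0"
  by (simp add: bump_on_def exp_bump_def)

lemma bump_on_zero: "x \<le> c \<or> d \<le> x \<Longrightarrow> bump_on c d x = 0"
  by (auto simp: bump_on_def exp_bump_def)

lemma bump_on_nonneg: "0 \<le> bump_on c d x"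
  by (simp add: bump_on_def exp_bump_def)

lemma bump_on_le_1: "bump_on c d x \<le> 1"
  unfolding bump_on_def by (rule mult_le_one) (auto simp: exp_bump_def)

lemma test_fun_bump_on:
  assumes "0 < c" "c < d" "d < 1"
  shows "test_fun (bump_on c d)"
proof (rule test_funI[OF _ assms])
  have "bump_on c d = (\<lambda>x. exp_bump 0 (1 * x + (- c)) * exp_bump 0 ((- 1) * x + d))"
    by (simp add: bump_on_def fun_eq_iff)
  then show "smooth (bump_on c d)"
    using smooth_mult[OF smooth_exp_bump_affine[of 0 1 "-c"] smooth_exp_bump_affine[of 0 "-1" d]] by simp
qed (auto simp: bump_on_zero)

text \<open>The zero mean is exactly what makes the primitive from 0 vanish again to the right of
  the support.\<close>

lemma test_fun_primitive:
  assumes "test_fun \<psi>" "integral {0..1} \<psi> = 0"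
  obtains \<phi> where "test_fun \<phi>" "deriv \<phi> = \<psi>"
proof -
  obtain c d where cd: "0 < c" "c < d" "d < 1" "\<And>x. x \<notin> {c..d} \<Longrightarrow> \<psi> x = 0"
    using test_funE[OF assms(1)] by blast
  have int: "\<psi> integrable_on {s..t}" for s t
    by (intro integrable_continuous_real test_fun_continuous_on assms)
  define \<phi> where "\<phi> x = integral {0..x} \<psi>" for x
  have \<phi>0: "\<phi> x = 0" if "x < c" for x
    unfolding \<phi>_def using that cd by (intro integral_unique has_integral_is_0) auto
  have \<phi>1: "\<phi> x = 0" if "d < x" for x
  proof (cases "x \<le> 1")
    case True
    have "integral {x..1} \<psi> = 0" using that cd True by (intro integral_unique has_integral_is_0) auto
    moreover have "integral {0..x} \<psi> + integral {x..1} \<psi> = integral {0..1} \<psi>"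
      by (rule Henstock_Kurzweil_Integration.integral_combine) (use that True cd int in auto)
    ultimately show ?thesis using assms by (simp add: \<phi>_def)
  next
    case False
    have "integral {1..x} \<psi> = 0" using that cd False by (intro integral_unique has_integral_is_0) auto
    moreover have "integral {0..1} \<psi> + integral {1..x} \<psi> = integral {0..x} \<psi>"
      by (rule Henstock_Kurzweil_Integration.integral_combine) (use that False cd int in auto)
    ultimately show ?thesis using assms by (simp add: \<phi>_def)
  qed
  have der: "(\<phi> has_real_derivative \<psi> x) (at x)" for x
  proof (cases "x < c")
    case True
    have "((\<lambda>x. 0) has_real_derivative 0) (at x)" by simp
    then have "(\<phi> has_real_derivative 0) (at x)"
      by (rule DERIV_cong_ev[THEN iffD1, rotated 3])
        (use True eventually_nhds_in_open[of "{..<c}" x] \<phi>0 in \<open>auto elim!: eventually_mono\<close>)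
    then show ?thesis using True cd by simp
  next
    case False
    have "(\<phi> has_real_derivative \<psi> x) (at x within {0..x+1})"
      unfolding \<phi>_def
      by (rule integral_has_real_derivative) (use False cd in \<open>auto intro: test_fun_continuous_on assms\<close>)
    then show ?thesis using False cd
      by (subst (asm) at_within_interior) auto
  qed
  then have d\<phi>: "deriv \<phi> = \<psi>" by (auto intro!: DERIV_imp_deriv)
  \<comment> \<open>The class consisting of \<open>\<phi>\<close> and all smooth functions is closed
    under differentiation, because the derivative of \<open>\<phi>\<close> is the smooth
    \<open>\<psi>\<close>.\<close>
  have "smooth \<phi>"
  proof (rule smooth_coinduct[of "\<lambda>f. f = \<phi> \<or> smooth f"])
    fix g assume "g = \<phi> \<or> smooth g"
    then show "\<exists>g'. (g' = \<phi> \<or> smooth g') \<and> (\<forall>x. (g has_real_derivative g' x) (at x))"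
      using der smooth_deriv smooth_has_deriv test_fun_smooth[OF assms(1)] by blast
  qed simp
  then have "test_fun \<phi>"
    by (rule test_funI[OF _ cd(1-3)]) (use \<phi>0 \<phi>1 in auto)
  from this d\<phi> show thesis by (rule that)
qed

subsection \<open>Density of test functions\<close>

lemma L2_iff_sq_int: "u \<in> L2 I \<longleftrightarrow> sq_int (lebesgue_on I) u"
  by (simp add: L2_def sq_int_def)

lemma finite_measure_unit_leb: "finite_measure unit_leb"
  by (rule finite_measure_lebesgue_on) simp

lemma unit_integrable_iff: "integrable unit_leb f \<longleftrightarrow> f absolutely_integrable_on {0..1}" for f :: "real \<Rightarrow> real"
  unfolding absolutely_integrable_on_Icc_iff_Ioo
  by (simp add: integrable_restrict_space set_integrable_def)

lemma unit_integral_eq: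
  fixes f :: "real \<Rightarrow> real"
  assumes "integrable unit_leb f"
  shows "integral\<^sup>L unit_leb f = integral {0..1} f"
  using lebesgue_integral_eq_integral[OF assms] by (simp add: integral_open_interval_real)

lemma continuous_measurable_unit:
  "continuous_on {0<..<1} f \<Longrightarrow> f \<in> borel_measurable unit_leb" for f :: "real \<Rightarrow> real"
  by (rule continuous_imp_measurable_on_sets_lebesgue) auto

lemma bounded_sq_int_unit:
  assumes "f \<in> borel_measurable unit_leb" "\<And>x. x \<in> {0<..<1} \<Longrightarrow> \<bar>f x\<bar> \<le> M"
  shows "sq_int unit_leb f"
proof -
  interpret finite_measure unit_leb by (rule finite_measure_unit_leb)
  have "integrable unit_leb (\<lambda>x. (f x)\<^sup>2)"
  proof (rule integrable_const_bound[of _ "M\<^sup>2"])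
    have "(f x)\<^sup>2 \<le> M\<^sup>2" if "x \<in> {0<..<1}" for x
      using power_mono[OF assms(2)[OF that], of 2] by simp
    then show "AE x in unit_leb. norm ((f x)\<^sup>2) \<le> M\<^sup>2" by (intro AE_I2) simp
  qed (use assms in simp)
  then show ?thesis using assms by (simp add: sq_int_def)
qed

lemma continuous_sq_int_unit:
  fixes f :: "real \<Rightarrow> real"
  assumes "continuous_on {0..1} f"
  shows "sq_int unit_leb f"
proof -
  have "compact (f ` {0..1})" by (intro compact_continuous_image assms compact_Icc)
  then obtain M where "\<forall>x\<in>{0..1}. norm (f x) \<le> M"
    using compact_imp_bounded[of "f ` {0..1}"] unfolding bounded_iff by auto
  then show ?thesis
    by (intro bounded_sq_int_unit[of f M] continuous_measurable_unit continuous_on_subset[OF assms]) auto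
qed

text \<open>The offset 3 gives a nondegenerate compact interval for every \<open>k\<close>,
  beginning with \<open>[1/3, 2/3]\<close>.\<close>

lemma unit_interior_between:
  assumes "x \<in> {0<..<1::real}"
  obtains k :: nat where "1 / (real k + 3) \<le> x" "x \<le> 1 - 1 / (real k + 3)"
proof -
  obtain k :: nat where k: "real k > max (1 / x) (1 / (1 - x))" using reals_Archimedean2 by blast
  have "1 / (real k + 3) \<le> x" "1 / (real k + 3) \<le> 1 - x"
    using k assms by (auto simp: field_simps)
  then show thesis using that[of k] by simp
qed

lemma unit_eventually_between:
  assumes "x \<in> {0<..<1::real}"
  shows "\<forall>\<^sub>F k in sequentially. x \<in> {1 / (real k + 3)..1 - 1 / (real k + 3)}"
proof -
  obtain k where k: "1 / (real k + 3) \<le> x" "x \<le> 1 - 1 / (real k + 3)"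
    using unit_interior_between[OF assms] .
  show ?thesis
    using eventually_ge_at_top[of k]
  proof eventually_elim
    case (elim n)
    then have "1 / (real n + 3) \<le> 1 / (real k + 3)" by (intro divide_left_mono) auto
    then show ?case using k by auto
  qed
qed

text \<open>The truncations to the exhausting intervals are measurable and converge pointwise, each
  point being reached after finitely many steps.\<close>

lemma locally_integrable_measurable:
  assumes "locally_integrable w"
  shows "w \<in> borel_measurable unit_leb"
proof (rule borel_measurable_LIMSEQ_real)
  let ?I = "\<lambda>k::nat. {1 / (real k + 3)..1 - 1 / (real k + 3)}"
  show "(\<lambda>x. indicat_real (?I k) x * w x) \<in> borel_measurable unit_leb" for k
  proof -
    have "w absolutely_integrable_on ?I k" using assms by (auto simp: locally_integrable_def)
    then have "(\<lambda>x. indicat_real (?I k) x *\<^sub>R w x) \<in> borel_measurable lebesgue"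
      unfolding set_integrable_def by (rule borel_measurable_integrable)
    then show ?thesis by (simp add: measurable_restrict_space1)
  qed
  show "(\<lambda>k. indicat_real (?I k) x * w x) \<longlonglongrightarrow> w x" if "x \<in> space unit_leb" for x
  proof (rule tendsto_eventually)
    show "\<forall>\<^sub>F k in sequentially. indicat_real (?I k) x * w x = w x"
    proof (rule eventually_mono[OF unit_eventually_between])
      show "x \<in> {0<..<1}" using that by simp
    qed simp
  qed
qed

lemma sq_int_locally_integrable:
  assumes "sq_int unit_leb u"
  shows "locally_integrable u"
proof -
  have "u absolutely_integrable_on {0..1}"
    using sq_int_integrable[OF finite_measure_unit_leb assms] by (simp add: unit_integrable_iff)
  then show ?thesis
    unfolding locally_integrable_def
    by (auto intro: absolutely_integrable_on_subinterval)
qed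

lemma locally_integrable_lincomb:
  "locally_integrable u \<Longrightarrow> locally_integrable v \<Longrightarrow> locally_integrable (\<lambda>x. c * u x + d * v x)"
  unfolding locally_integrable_def
  by (auto intro!: set_integral_add absolutely_integrable_on_const)
  
text \<open>The bump function vanishes nowhere on the support, so polynomials can approximate the quotient.\<close>

lemma bounded_test_approx:
  assumes v: "v \<in> borel_measurable unit_leb" and cd: "0 < c" "c < d" "d < 1"
    and M: "\<And>x. \<bar>v x\<bar> \<le> M" and supp: "\<And>x. x \<notin> {c..d} \<Longrightarrow> v x = 0"
  obtains \<phi> c' d' M' where "\<And>n. test_fun (\<phi> n)" "0 < c'" "d' < 1"
    "\<And>n x. x \<in> {0<..<1} \<Longrightarrow> \<bar>\<phi> n x\<bar> \<le> M'" "\<And>n x. x \<notin> {c'..d'} \<Longrightarrow> \<phi> n x = 0"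
    "AE x in unit_leb. (\<lambda>n::nat. \<phi> n x) \<longlonglongrightarrow> v x"
proof -
  define c' d' where "c' = c / 2" and "d' = (1 + d) / 2"
  have cd': "0 < c'" "c' < c" "d < d'" "d' < 1" "c' < d'" using cd by (auto simp: c'_def d'_def)
  define \<beta> where "\<beta> = bump_on c' d'"
  have \<beta>: "test_fun \<beta>" unfolding \<beta>_def by (rule test_fun_bump_on) (use cd' in auto)
  have pos: "\<beta> x > 0" if "x \<in> {c..d}" for x unfolding \<beta>_def using that cd' by (intro bump_on_pos) auto
  have "continuous_on {c..d} \<beta>" by (rule test_fun_continuous_on[OF \<beta>])
  then obtain y where y: "y \<in> {c..d}" "\<And>x. x \<in> {c..d} \<Longrightarrow> \<beta> y \<le> \<beta> x"
    using continuous_attains_inf[of "{c..d}" \<beta>] cd by auto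
  define L where "L = M / \<beta> y"
  have M0: "0 \<le> M" using M[of 0] by linarith
  have L: "\<bar>v x / \<beta> x\<bar> \<le> L" for x
  proof (cases "x \<in> {c..d}")
    case True
    then have "\<bar>v x\<bar> / \<beta> x \<le> M / \<beta> y"
      using M[of x] y pos[of y] pos[of x] M0 by (intro frac_le) auto
    then show ?thesis using pos[OF True] by (simp add: L_def abs_divide)
  next
    case False
    then show ?thesis using supp[OF False] M0 pos[OF y(1)] by (simp add: L_def)
  qed
  have L0: "0 \<le> L" using L[of 0] by linarith
  have "\<beta> \<in> borel_measurable unit_leb" by (intro continuous_measurable_unit test_fun_continuous_on \<beta>)
  then have "(\<lambda>x. v x / \<beta> x) \<in> borel_measurable unit_leb" using v by simp
  then have "(\<lambda>x. v x / \<beta> x) measurable_on {0<..<1}"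
    by (simp add: measurable_on_iff_borel_measurable)
  \<comment> \<open>Off a negligible set, a measurable function is a pointwise limit of continuous
    functions.\<close>
  then obtain N g where N: "negligible N" and gc: "\<And>n. continuous_on UNIV (g n)"
    and g: "\<And>x. x \<notin> N \<Longrightarrow> (\<lambda>n. g n x) \<longlonglongrightarrow> (if x \<in> {0<..<1} then v x / \<beta> x else 0)"
    unfolding measurable_on_def by blast
  \<comment> \<open>Clipping at the bound \<open>L\<close> of the quotient leaves the limit
    unchanged and provides a uniform bound for dominated convergence.\<close>
  define h where "h n x = max (- L) (min L (g n x))" for n :: nat and x
  have hc: "continuous_on {0..1} (h n)" for n
    unfolding h_def by (intro continuous_intros continuous_on_subset[OF gc]) auto
  have hb: "\<bar>h n x\<bar> \<le> L" for n x using L0 by (auto simp: h_def)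
  have hlim: "(\<lambda>n. h n x) \<longlonglongrightarrow> v x / \<beta> x" if "x \<notin> N" "x \<in> {0<..<1}" for x
  proof -
    have "(\<lambda>n. h n x) \<longlonglongrightarrow> max (- L) (min L (v x / \<beta> x))"
      unfolding h_def using g[OF that(1)] that(2) by (intro tendsto_intros) auto
    moreover have "- L \<le> v x / \<beta> x" "v x / \<beta> x \<le> L" using L[of x] unfolding abs_le_iff by linarith+
    ultimately show ?thesis by simp
  qed
  have "\<exists>p. real_polynomial_function p \<and> (\<forall>x\<in>{0..1}. \<bar>h n x - p x\<bar> < 1 / (real n + 1))" for n
  proof -
    have "0 < 1 / (real n + 1)" by simp
    then obtain p where "real_polynomial_function p" "\<And>x. x \<in> {0..1} \<Longrightarrow> \<bar>h n x - p x\<bar> < 1 / (real n + 1)"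
      by (rule Stone_Weierstrass_real_polynomial_function[OF compact_Icc hc[of n]]) blast
    then show ?thesis by blast
  qed
  then obtain p where p: "\<And>n. real_polynomial_function (p n)"
    and ph: "\<And>n x. x \<in> {0..1} \<Longrightarrow> \<bar>h n x - p n x\<bar> < 1 / (real n + 1)" by metis
  \<comment> \<open>\<open>\<beta>\<close> supplies the common support, the polynomial the
    values.\<close>
  define \<phi> where "\<phi> n x = \<beta> x * p n x" for n x
  show thesis
  proof (rule that[of \<phi> c' d' "L + 1"])
    show "test_fun (\<phi> n)" for n
      unfolding \<phi>_def by (intro test_fun_smooth_mult \<beta> smooth_polynomial p)
    show "\<bar>\<phi> n x\<bar> \<le> L + 1" if "x \<in> {0<..<1}" for n x
    proof -
      have "\<bar>p n x\<bar> \<le> L + 1"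
      proof -
        have "1 / (real n + 1) \<le> 1" by simp
        moreover have "\<bar>h n x - p n x\<bar> < 1 / (real n + 1)" using that by (intro ph) auto
        ultimately show ?thesis using hb[of n x] by linarith
      qed
      moreover have "\<bar>\<beta> x\<bar> \<le> 1" unfolding \<beta>_def by (simp add: bump_on_nonneg bump_on_le_1)
      ultimately have "\<bar>\<beta> x\<bar> * \<bar>p n x\<bar> \<le> 1 * (L + 1)" by (intro mult_mono) auto
      then show ?thesis by (simp add: \<phi>_def abs_mult)
    qed
    show "\<phi> n x = 0" if "x \<notin> {c'..d'}" for n x
      using that by (auto simp: \<phi>_def \<beta>_def bump_on_zero)
    have lim: "(\<lambda>n. \<phi> n x) \<longlonglongrightarrow> v x" if "x \<notin> N" "x \<in> {0<..<1}" for x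
    proof -
      have "(\<lambda>n. h n x - p n x) \<longlonglongrightarrow> 0"
      proof (rule Lim_null_comparison)
        show "\<forall>\<^sub>F n in sequentially. norm (h n x - p n x) \<le> 1 / (real n + 1)"
          unfolding real_norm_def by (intro always_eventually allI less_imp_le ph) (use that(2) in auto)
        show "(\<lambda>n. 1 / (real n + 1)) \<longlonglongrightarrow> 0" using LIMSEQ_inverse_real_of_nat by (simp add: inverse_eq_divide add.commute)
      qed
      from tendsto_diff[OF hlim[OF that] this] have "(\<lambda>n. p n x) \<longlonglongrightarrow> v x / \<beta> x" by simp
      then have "(\<lambda>n. \<beta> x * p n x) \<longlonglongrightarrow> \<beta> x * (v x / \<beta> x)" by (intro tendsto_intros)
      moreover have "\<beta> x * (v x / \<beta> x) = v x" using pos[of x] supp[of x] by (cases "x \<in> {c..d}") auto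
      ultimately show ?thesis by (simp add: \<phi>_def)
    qed
    have "N \<in> null_sets lebesgue" using N by (simp add: negligible_iff_null_sets)
    then have "AE x in lebesgue. x \<notin> N" by (rule AE_not_in)
    then have "AE x in lebesgue. x \<in> {0<..<1} \<longrightarrow> (\<lambda>n. \<phi> n x) \<longlonglongrightarrow> v x"
      by (rule eventually_mono) (simp add: lim)
    then show "AE x in unit_leb. (\<lambda>n. \<phi> n x) \<longlonglongrightarrow> v x"
      by (simp add: AE_restrict_space_iff)
  qed (use cd' in auto)
qed

lemma locally_integrable_indicator:
  assumes "locally_integrable w" "0 < c" "d < 1"
  shows "integrable unit_leb (\<lambda>x. indicat_real {c..d} x * w x)"
proof -
  have "w absolutely_integrable_on {c..d}" using assms by (auto simp: locally_integrable_def)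
  then have "integrable lebesgue (\<lambda>x. indicat_real {c..d} x * w x)"
    by (simp add: set_integrable_def)
  moreover have "(\<lambda>x. indicat_real {0<..<1} x *\<^sub>R (indicat_real {c..d} x * w x)) = (\<lambda>x. indicat_real {c..d} x * w x)"
    using assms by (auto simp: fun_eq_iff indicator_def)
  ultimately show ?thesis by (simp add: integrable_restrict_space)
qed

lemma locally_integrable_mult_test:
  assumes "locally_integrable w" "test_fun \<phi>"
  shows "integrable unit_leb (\<lambda>x. w x * \<phi> x)"
proof -
  obtain c d where cd: "0 < c" "c < d" "d < 1" "\<And>x. x \<notin> {c..d} \<Longrightarrow> \<phi> x = 0"
    using test_funE[OF assms(2)] by blast
  have "compact (\<phi> ` {0..1})" by (intro compact_continuous_image test_fun_continuous_on assms compact_Icc)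
  then obtain M where M: "\<forall>x\<in>{0..1}. norm (\<phi> x) \<le> M"
    using compact_imp_bounded[of "\<phi> ` {0..1}"] unfolding bounded_iff by auto
  then have M0: "0 \<le> M" by (metis atLeastAtMost_iff norm_ge_zero order.trans zero_le_one order_refl)
  show ?thesis
  proof (rule Bochner_Integration.integrable_bound)
    show "integrable unit_leb (\<lambda>x. M * (indicat_real {c..d} x * w x))"
      by (intro integrable_mult_right locally_integrable_indicator assms cd)
    show "(\<lambda>x. w x * \<phi> x) \<in> borel_measurable unit_leb"
      by (intro borel_measurable_times locally_integrable_measurable continuous_measurable_unit test_fun_continuous_on assms)
    show "AE x in unit_leb. norm (w x * \<phi> x) \<le> norm (M * (indicat_real {c..d} x * w x))"
    proof (rule AE_I2)
      fix x :: real assume "x \<in> space unit_leb"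
      then have "\<bar>\<phi> x\<bar> \<le> M" using M by auto
      then have "\<bar>w x\<bar> * \<bar>\<phi> x\<bar> \<le> \<bar>w x\<bar> * M" by (rule mult_left_mono) simp
      then show "norm (w x * \<phi> x) \<le> norm (M * (indicat_real {c..d} x * w x))"
        using M0 cd(4)[of x] by (cases "x \<in> {c..d}") (auto simp: abs_mult mult.commute)
    qed
  qed
qed

text \<open>Test functions approximate the sign of \<open>w\<close>, cut off to a compact interval,
  boundedly and almost everywhere. Dominated convergence turns the hypothesis into the vanishing of
  the integral of \<open>\<bar>w\<bar>\<close> over that interval.\<close>

lemma fundamental_lemma:
  assumes w: "locally_integrable w" and 0: "\<And>\<phi>. test_fun \<phi> \<Longrightarrow> (\<integral>x. w x * \<phi> x \<partial>unit_leb) = 0"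
  shows "AE x in unit_leb. w x = 0"
proof -
  have wm [measurable]: "w \<in> borel_measurable unit_leb" by (rule locally_integrable_measurable[OF w])
  have main: "AE x in unit_leb. x \<in> {1 / (real k + 3)..1 - 1 / (real k + 3)} \<longrightarrow> w x = 0" for k :: nat
  proof -
    define c d where "c = 1 / (real k + 3)" and "d = 1 - 1 / (real k + 3)"
    have cd: "0 < c" "c < d" "d < 1" by (auto simp: c_def d_def field_simps)
    define v where "v x = indicat_real {c..d} x * (if 0 < w x then 1 else if w x < 0 then -1 else 0)" for x
    have [measurable]: "indicat_real {c..d} \<in> borel_measurable unit_leb"
      by (intro measurable_restrict_space1 borel_measurable_indicator) simp
    have vm: "v \<in> borel_measurable unit_leb" 
      unfolding v_def
      by measurable
    obtain \<phi> c' d' M' where \<phi>: "\<And>n. test_fun (\<phi> n)" "0 < c'" "d' < 1"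
      "\<And>n x. x \<in> {0<..<1} \<Longrightarrow> \<bar>\<phi> n x\<bar> \<le> M'" "\<And>n x. x \<notin> {c'..d'} \<Longrightarrow> \<phi> n x = 0"
      "AE x in unit_leb. (\<lambda>n::nat. \<phi> n x) \<longlonglongrightarrow> v x"
      by (rule bounded_test_approx[OF vm cd, of 1]) (auto simp: v_def indicator_def)
    have "(\<lambda>n. \<integral>x. w x * \<phi> n x \<partial>unit_leb) \<longlonglongrightarrow> (\<integral>x. w x * v x \<partial>unit_leb)"
    proof (rule integral_dominated_convergence)
      show "integrable unit_leb (\<lambda>x. M' * \<bar>indicat_real {c'..d'} x * w x\<bar>)"
        by (intro integrable_mult_right integrable_abs locally_integrable_indicator w \<phi>)
      show "AE x in unit_leb. (\<lambda>n. w x * \<phi> n x) \<longlonglongrightarrow> w x * v x"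
        using \<phi>(6) by eventually_elim (intro tendsto_intros)
      show "AE x in unit_leb. norm (w x * \<phi> n x) \<le> M' * \<bar>indicat_real {c'..d'} x * w x\<bar>" for n
      proof (rule AE_I2)
        fix x :: real assume "x \<in> space unit_leb"
        then have "\<bar>\<phi> n x\<bar> \<le> M'" using \<phi>(4) by auto
        then have "\<bar>w x\<bar> * \<bar>\<phi> n x\<bar> \<le> \<bar>w x\<bar> * M'" by (rule mult_left_mono) simp
        then show "norm (w x * \<phi> n x) \<le> M' * \<bar>indicat_real {c'..d'} x * w x\<bar>"
          using \<phi>(5)[of x n] by (cases "x \<in> {c'..d'}") (auto simp: abs_mult mult.commute)
      qed
      show "(\<lambda>x. w x * v x) \<in> borel_measurable unit_leb" using vm by simp
      show "(\<lambda>x. w x * \<phi> n x) \<in> borel_measurable unit_leb" for n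
        by (intro borel_measurable_times wm continuous_measurable_unit test_fun_continuous_on \<phi>)
    qed
    then have z: "(\<integral>x. w x * v x \<partial>unit_leb) = 0"
      using 0 \<phi>(1) by (simp add: LIMSEQ_const_iff)
    have wv: "w x * v x = \<bar>indicat_real {c..d} x * w x\<bar>" for x
      by (auto simp: v_def indicator_def)
    have "integrable unit_leb (\<lambda>x. \<bar>indicat_real {c..d} x * w x\<bar>)"
      by (intro integrable_abs locally_integrable_indicator w cd)
    from integral_nonneg_eq_0_iff_AE[OF this] z
    have "AE x in unit_leb. \<bar>indicat_real {c..d} x * w x\<bar> = 0" by (simp add: wv)
    then show ?thesis
      by eventually_elim (auto simp: c_def d_def)
  qed
  then have "AE x in unit_leb. \<forall>k::nat. x \<in> {1 / (real k + 3)..1 - 1 / (real k + 3)} \<longrightarrow> w x = 0"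
    unfolding AE_all_countable by blast
  then show ?thesis
  proof (rule AE_mp, intro AE_I2 impI)
    fix x :: real assume x: "x \<in> space unit_leb"
      "\<forall>k::nat. x \<in> {1 / (real k + 3)..1 - 1 / (real k + 3)} \<longrightarrow> w x = 0"
    obtain k where "1 / (real k + 3) \<le> x" "x \<le> 1 - 1 / (real k + 3)"
      using unit_interior_between[of x] x(1) by auto
    then show "w x = 0" using x(2) by auto
  qed
qed

text \<open>Two approximations are chained: \<open>v\<close> is truncated in space and in size, with
  majorant \<open>v\<^sup>2 / a\<close>, and the truncation is approximated by test functions of
  common support. On that support \<open>1 / a\<close> is integrable, so the singularity of the
  weight at 0 does no harm. The weight 1 gives plain \<open>L2\<close> density.\<close>

lemma weighted_test_dense:
  fixes a :: "real \<Rightarrow> real"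
  assumes a: "continuous_on {0<..<1} a" "\<And>x. x \<in> {0<..<1} \<Longrightarrow> 0 < a x"
    and vm: "v \<in> borel_measurable unit_leb" and v: "sq_int unit_leb (\<lambda>x. v x / sqrt (a x))" and e: "e > 0"
  obtains \<phi> where "test_fun \<phi>" "sq_int unit_leb (\<lambda>x. \<phi> x / sqrt (a x))"
    "l2norm unit_leb (\<lambda>x. \<phi> x / sqrt (a x) - v x / sqrt (a x)) < e"
proof -
  have am [measurable]: "a \<in> borel_measurable unit_leb" by (rule continuous_measurable_unit[OF a(1)])
  note vm [measurable]
  let ?I = "\<lambda>k::nat. {1 / (real k + 3)..1 - 1 / (real k + 3)}"
  define V where "V k x = (if x \<in> ?I k \<and> \<bar>v x\<bar> \<le> real k then v x else 0)" for k x
  have Im: "indicat_real (?I k) \<in> borel_measurable unit_leb" for k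
    by (intro measurable_restrict_space1 borel_measurable_indicator) simp
  have Vm [measurable]: "V k \<in> borel_measurable unit_leb" for k
  proof -
    have "V k = (\<lambda>x. indicat_real (?I k) x * (if \<bar>v x\<bar> \<le> real k then v x else 0))"
      by (auto simp: V_def indicator_def)
    moreover have "(\<lambda>x. indicat_real (?I k) x * (if \<bar>v x\<bar> \<le> real k then v x else 0)) \<in> borel_measurable unit_leb"
      using Im by measurable
    ultimately show ?thesis by simp
  qed
  have sqV: "sq_int unit_leb (\<lambda>x. V k x / sqrt (a x))" for k
    unfolding sq_int_def
  proof
    show "integrable unit_leb (\<lambda>x. (V k x / sqrt (a x))\<^sup>2)"
    proof (rule Bochner_Integration.integrable_bound[OF sq_int_integrable_sq[OF v]])
      show "AE x in unit_leb. norm ((V k x / sqrt (a x))\<^sup>2) \<le> norm ((v x / sqrt (a x))\<^sup>2)"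
        by (intro AE_I2) (simp add: V_def)
    qed measurable
  qed measurable
  have "(\<lambda>k. \<integral>x. (V k x / sqrt (a x) - v x / sqrt (a x))\<^sup>2 \<partial>unit_leb) \<longlonglongrightarrow> (\<integral>x. 0 \<partial>unit_leb)"
  proof (rule integral_dominated_convergence)
    show "integrable unit_leb (\<lambda>x. (v x / sqrt (a x))\<^sup>2)" by (rule sq_int_integrable_sq[OF v])
    show "AE x in unit_leb. norm ((V k x / sqrt (a x) - v x / sqrt (a x))\<^sup>2) \<le> (v x / sqrt (a x))\<^sup>2" for k
      by (intro AE_I2) (auto simp: V_def)
    show "AE x in unit_leb. (\<lambda>k. (V k x / sqrt (a x) - v x / sqrt (a x))\<^sup>2) \<longlonglongrightarrow> 0"
    proof (rule AE_I2)
      fix x :: real assume "x \<in> space unit_leb"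
      then have x: "x \<in> {0<..<1}" by simp
      obtain K :: nat where K: "\<bar>v x\<bar> \<le> real K" using real_arch_simple by blast
      show "(\<lambda>k. (V k x / sqrt (a x) - v x / sqrt (a x))\<^sup>2) \<longlonglongrightarrow> 0"
      proof (rule tendsto_eventually)
        show "\<forall>\<^sub>F k in sequentially. (V k x / sqrt (a x) - v x / sqrt (a x))\<^sup>2 = 0"
          using unit_eventually_between[OF x] eventually_ge_at_top[of K]
          by eventually_elim (use K in \<open>auto simp: V_def\<close>)
      qed
    qed
  qed measurable
  then have "(\<lambda>k. l2norm unit_leb (\<lambda>x. V k x / sqrt (a x) - v x / sqrt (a x))) \<longlonglongrightarrow> 0"
    by (simp add: l2norm_tendsto_iff)
  from order_tendstoD(2)[OF this, of "e/2"] e obtain k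
    where k: "l2norm unit_leb (\<lambda>x. V k x / sqrt (a x) - v x / sqrt (a x)) < e / 2"
    by (auto simp: eventually_sequentially)
  obtain \<phi> c' d' M' where \<phi>: "\<And>n. test_fun (\<phi> n)" "0 < c'" "d' < 1"
    "\<And>n x. x \<in> {0<..<1} \<Longrightarrow> \<bar>\<phi> n x\<bar> \<le> M'" "\<And>n x. x \<notin> {c'..d'} \<Longrightarrow> \<phi> n x = 0"
    "AE x in unit_leb. (\<lambda>n::nat. \<phi> n x) \<longlonglongrightarrow> V k x"
  proof (rule bounded_test_approx[OF Vm, of "1 / (real k + 3)" "1 - 1 / (real k + 3)" k "real k"])
    show "1 / (real k + 3) < 1 - 1 / (real k + 3)" by (simp add: field_simps)
  qed (auto simp: V_def)
  \<comment> \<open>One compact interval containing the supports of \<open>V k\<close> and of all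
    \<open>\<phi> n\<close>.\<close>
  define c'' d'' where "c'' = min c' (1 / (real k + 3))" and "d'' = max d' (1 - 1 / (real k + 3))"
  have cd: "0 < c''" "d'' < 1" using \<phi> by (auto simp: c''_def d''_def)
  have "continuous_on {c''..d''} (\<lambda>x. 1 / a x)"
    using cd by (intro continuous_intros continuous_on_subset[OF a(1)] ballI less_imp_neq[symmetric] a(2)) auto
  then have "(\<lambda>x. 1 / a x) absolutely_integrable_on {c''..d''}"
    by (rule absolutely_integrable_continuous_real)
  then have "integrable lebesgue (\<lambda>x. indicat_real {c''..d''} x * (1 / a x))"
    by (simp add: set_integrable_def)
  moreover have "(\<lambda>x. indicat_real {0<..<1} x *\<^sub>R (indicat_real {c''..d''} x * (1 / a x))) = (\<lambda>x. indicat_real {c''..d''} x * (1 / a x))"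
    using cd by (auto simp: fun_eq_iff indicator_def)
  ultimately have ai: "integrable unit_leb (\<lambda>x. indicat_real {c''..d''} x * (1 / a x))"
    by (simp add: integrable_restrict_space)
  have pm [measurable]: "\<phi> n \<in> borel_measurable unit_leb" for n
    by (intro continuous_measurable_unit test_fun_continuous_on \<phi>)
  have bnd: "(\<phi> n x / sqrt (a x) - V k x / sqrt (a x))\<^sup>2 \<le> (M' + real k)\<^sup>2 * (indicat_real {c''..d''} x * (1 / a x))"
    "(\<phi> n x / sqrt (a x))\<^sup>2 \<le> (M' + real k)\<^sup>2 * (indicat_real {c''..d''} x * (1 / a x))"
    if x: "x \<in> {0<..<1}" for n x
  proof -
    have ax: "a x > 0" using a(2)[OF x] .
    have "\<bar>\<phi> n x\<bar> \<le> M'" using \<phi>(4)[OF x] .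
    moreover have "\<bar>V k x\<bar> \<le> real k" by (auto simp: V_def)
    ultimately have "\<bar>\<phi> n x - V k x\<bar> \<le> \<bar>M' + real k\<bar>" "\<bar>\<phi> n x\<bar> \<le> \<bar>M' + real k\<bar>" by linarith+
    then have m: "(\<phi> n x - V k x)\<^sup>2 \<le> (M' + real k)\<^sup>2" "(\<phi> n x)\<^sup>2 \<le> (M' + real k)\<^sup>2" by (simp_all add: abs_le_square_iff)
    have out: "\<phi> n x = 0 \<and> V k x = 0" if "x \<notin> {c''..d''}"
    proof -
      have "x \<notin> {c'..d'}" "x \<notin> {1 / (real k + 3)..1 - 1 / (real k + 3)}"
        using that by (auto simp: c''_def d''_def)
      then show ?thesis using \<phi>(5)[of x n] unfolding V_def by meson
    qed
    have "(\<phi> n x / sqrt (a x) - V k x / sqrt (a x))\<^sup>2 = (\<phi> n x - V k x)\<^sup>2 / a x"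
      using ax by (simp add: diff_divide_distrib[symmetric] power_divide)
    then show "(\<phi> n x / sqrt (a x) - V k x / sqrt (a x))\<^sup>2 \<le> (M' + real k)\<^sup>2 * (indicat_real {c''..d''} x * (1 / a x))"
      using m out ax by (cases "x \<in> {c''..d''}") (auto intro: divide_right_mono)
    show "(\<phi> n x / sqrt (a x))\<^sup>2 \<le> (M' + real k)\<^sup>2 * (indicat_real {c''..d''} x * (1 / a x))"
      using m out ax by (cases "x \<in> {c''..d''}") (auto intro: divide_right_mono simp: power_divide)
  qed
  have bi: "integrable unit_leb (\<lambda>x. (M' + real k)\<^sup>2 * (indicat_real {c''..d''} x * (1 / a x)))"
    by (intro integrable_mult_right ai)
  have sq\<phi>: "sq_int unit_leb (\<lambda>x. \<phi> n x / sqrt (a x))" for n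
    unfolding sq_int_def
  proof
    show "integrable unit_leb (\<lambda>x. (\<phi> n x / sqrt (a x))\<^sup>2)"
    proof (rule Bochner_Integration.integrable_bound[OF bi])
      show "AE x in unit_leb. norm ((\<phi> n x / sqrt (a x))\<^sup>2)
          \<le> norm ((M' + real k)\<^sup>2 * (indicat_real {c''..d''} x * (1 / a x)))"
        using bnd(2) by (intro AE_I2) (smt (verit) real_norm_def space_lebesgue_on zero_le_power2)
    qed measurable
  qed measurable
  have "(\<lambda>n. \<integral>x. (\<phi> n x / sqrt (a x) - V k x / sqrt (a x))\<^sup>2 \<partial>unit_leb) \<longlonglongrightarrow> (\<integral>x. 0 \<partial>unit_leb)"
  proof (rule integral_dominated_convergence[OF _ _ bi])
    show "AE x in unit_leb. norm ((\<phi> n x / sqrt (a x) - V k x / sqrt (a x))\<^sup>2) \<le> (M' + real k)\<^sup>2 * (indicat_real {c''..d''} x * (1 / a x))" for n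
      using bnd(1) by (auto intro!: AE_I2)
    show "AE x in unit_leb. (\<lambda>n. (\<phi> n x / sqrt (a x) - V k x / sqrt (a x))\<^sup>2) \<longlonglongrightarrow> 0"
      using \<phi>(6)
    proof (rule AE_mp, intro AE_I2 impI)
      fix x :: real assume x: "x \<in> space unit_leb" "(\<lambda>n. \<phi> n x) \<longlonglongrightarrow> V k x"
      have "a x \<noteq> 0" using a(2)[of x] x(1) by auto
      then have "(\<lambda>n. (\<phi> n x / sqrt (a x) - V k x / sqrt (a x))\<^sup>2) \<longlonglongrightarrow> (V k x / sqrt (a x) - V k x / sqrt (a x))\<^sup>2"
        by (intro tendsto_intros x(2)) auto
      then show "(\<lambda>n. (\<phi> n x / sqrt (a x) - V k x / sqrt (a x))\<^sup>2) \<longlonglongrightarrow> 0" by simp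
    qed
  qed measurable
  then have "(\<lambda>n. l2norm unit_leb (\<lambda>x. \<phi> n x / sqrt (a x) - V k x / sqrt (a x))) \<longlonglongrightarrow> 0"
    by (simp add: l2norm_tendsto_iff)
  from order_tendstoD(2)[OF this, of "e/2"] e obtain n
    where n: "l2norm unit_leb (\<lambda>x. \<phi> n x / sqrt (a x) - V k x / sqrt (a x)) < e / 2"
    by (auto simp: eventually_sequentially)
  have "l2norm unit_leb (\<lambda>x. \<phi> n x / sqrt (a x) - v x / sqrt (a x)) < e"
    using l2norm_triangle_diff[OF sq\<phi> sqV v, of n k] n k by linarith
  with \<phi>(1) sq\<phi> show thesis by (rule that)
qed

subsection \<open>Primitives of square integrable functions\<close>

lemma has_integral_real_derivative:
  fixes F f :: "real \<Rightarrow> real"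
  assumes "c \<le> d" "\<And>x. x \<in> {c..d} \<Longrightarrow> (F has_real_derivative f x) (at x within {c..d})"
  shows "(f has_integral F d - F c) {c..d}"
  using assms by (intro fundamental_theorem_of_calculus) (auto simp: has_real_derivative_iff_has_vector_derivative)

text \<open>The base point 0 builds in the clamped conditions there: for \<open>u\<close> in
  \<open>Sobolev0 2\<close> and \<open>g = weak_deriv 2 u\<close>, \<open>prim g\<close> plays the
  role of u_x and \<open>prim (prim g)\<close> that of u.\<close>

definition prim :: "(real \<Rightarrow> real) \<Rightarrow> real \<Rightarrow> real" where
  "prim f x = integral {0..x} f"

lemma sq_int_absolutely_integrable:
  assumes "sq_int unit_leb f" "0 \<le> c" "d \<le> 1"
  shows "f absolutely_integrable_on {c..d}"
proof -
  have "f absolutely_integrable_on {0..1}"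
    using sq_int_integrable[OF finite_measure_unit_leb assms(1)] by (simp add: unit_integrable_iff)
  then show ?thesis by (rule absolutely_integrable_on_subinterval) (use assms in auto)
qed

lemma sq_int_integrable_on:
  "sq_int unit_leb f \<Longrightarrow> 0 \<le> c \<Longrightarrow> d \<le> 1 \<Longrightarrow> f integrable_on {c..d}"
  using sq_int_absolutely_integrable by (simp add: absolutely_integrable_on_def)

lemma integral_unit_one: "(\<integral>x. 1 \<partial>unit_leb) = (1::real)"
proof -
  interpret finite_measure unit_leb by (rule finite_measure_unit_leb)
  have "(\<integral>x. 1 \<partial>unit_leb) = integral {0..1} (\<lambda>x::real. 1::real)"
    by (rule unit_integral_eq) simp
  then show ?thesis by simp
qed

text \<open>Cauchy-Schwarz against the constant 1, whose norm on the unit interval is 1.\<close>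

lemma integral_abs_le_l2norm:
  assumes f: "sq_int unit_leb f" and cd: "0 \<le> c" "d \<le> 1"
  shows "integral {c..d} (\<lambda>x. \<bar>f x\<bar>) \<le> l2norm unit_leb f"
proof -
  have abs: "sq_int unit_leb (\<lambda>x. \<bar>f x\<bar>)" using f by (auto simp: sq_int_def)
  have one: "sq_int unit_leb (\<lambda>x. 1)" by (rule continuous_sq_int_unit) simp
  have "integral {c..d} (\<lambda>x. \<bar>f x\<bar>) \<le> integral {0..1} (\<lambda>x. \<bar>f x\<bar>)"
    by (rule integral_subset_le) (use cd in \<open>auto intro: sq_int_integrable_on[OF abs]\<close>)
  also have "\<dots> = (\<integral>x. \<bar>f x\<bar> * 1 \<partial>unit_leb)"
    using unit_integral_eq[OF sq_int_integrable[OF finite_measure_unit_leb abs]] by simp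
  also have "\<dots> \<le> l2norm unit_leb (\<lambda>x. \<bar>f x\<bar>) * l2norm unit_leb (\<lambda>x. 1)"
    using sq_int_Cauchy_Schwarz[OF abs one] by linarith
  also have "\<dots> = l2norm unit_leb f"
    using integral_unit_one by (simp add: l2norm_def)
  finally show ?thesis .
qed

lemma abs_integral_le_l2norm:
  assumes f: "sq_int unit_leb f" and cd: "0 \<le> c" "d \<le> 1"
  shows "\<bar>integral {c..d} f\<bar> \<le> l2norm unit_leb f"
proof -
  have "f absolutely_integrable_on {c..d}" by (rule sq_int_absolutely_integrable[OF assms])
  then have "norm (integral {c..d} f) \<le> integral {c..d} (\<lambda>x. \<bar>f x\<bar>)"
    by (intro integral_norm_bound_integral) (auto simp: absolutely_integrable_on_def)
  then show ?thesis using integral_abs_le_l2norm[OF assms] by simp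
qed

lemma prim_le_l2norm:
  "sq_int unit_leb f \<Longrightarrow> x \<le> 1 \<Longrightarrow> \<bar>prim f x\<bar> \<le> l2norm unit_leb f"
  unfolding prim_def by (rule abs_integral_le_l2norm) auto

lemma prim_lincomb:
  assumes "sq_int unit_leb f" "sq_int unit_leb g" "x \<le> 1"
  shows "prim (\<lambda>x. c * f x + d * g x) x = c * prim f x + d * prim g x"
proof -
  have "f integrable_on {0..x}" "g integrable_on {0..x}"
    using assms by (auto intro: sq_int_integrable_on)
  then show ?thesis
    unfolding prim_def
    by (subst Henstock_Kurzweil_Integration.integral_add) (auto intro: integrable_on_mult_right)
qed

lemma prim_diff:
  assumes "sq_int unit_leb f" "sq_int unit_leb g" "x \<le> 1"
  shows "prim (\<lambda>x. f x - g x) x = prim f x - prim g x"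
  using prim_lincomb[OF assms, of 1 "-1"] by simp

lemma prim_continuous_on:
  assumes "sq_int unit_leb f"
  shows "continuous_on {0..1} (prim f)"
  unfolding prim_def
  by (rule indefinite_integral_continuous_1) (rule sq_int_integrable_on[OF assms], auto)

lemma sq_int_prim: "sq_int unit_leb f \<Longrightarrow> sq_int unit_leb (prim f)"
  by (rule continuous_sq_int_unit[OF prim_continuous_on])

lemma prim_has_derivative:
  "continuous_on {0..1} f \<Longrightarrow> x \<in> {0..1} \<Longrightarrow> (prim f has_real_derivative f x) (at x within {0..1})"
  unfolding prim_def by (rule integral_has_real_derivative)

lemma unit_AE_negligible:
  assumes "AE x in unit_leb. P x"
  obtains N where "negligible N" "\<And>x. 0 < x \<Longrightarrow> x < 1 \<Longrightarrow> x \<notin> N \<Longrightarrow> P x"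
proof -
  have "AE x in lebesgue. 0 < x \<and> x < 1 \<longrightarrow> P x"
    using assms by (simp add: AE_restrict_space_iff)
  then obtain N where "N \<in> null_sets lebesgue" "\<And>x. x \<in> space lebesgue - N \<Longrightarrow> 0 < x \<and> x < 1 \<longrightarrow> P x"
    by (rule AE_E3) blast
  then show thesis by (intro that[of N]) (auto simp: negligible_iff_null_sets)
qed

lemma integral_cong_unit_AE:
  fixes f g :: "real \<Rightarrow> real"
  assumes "AE x in unit_leb. f x = g x" "0 \<le> c" "d \<le> 1"
  shows "integral {c..d} f = integral {c..d} g"
proof -
  obtain N where N: "negligible N" "\<And>x. 0 < x \<Longrightarrow> x < 1 \<Longrightarrow> x \<notin> N \<Longrightarrow> f x = g x"
    using unit_AE_negligible[OF assms(1)] by blast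
  \<comment> \<open>The almost everywhere hypothesis concerns the open interval, so the two end
    points are added to the exceptional set.\<close>
  have "negligible (insert 0 (insert 1 N))" using N(1) by simp
  then show ?thesis
    by (rule integral_spike) (use N(2) assms in \<open>auto simp: order_le_less\<close>)
qed

lemma prim_cong_AE: "AE x in unit_leb. f x = g x \<Longrightarrow> x \<le> 1 \<Longrightarrow> prim f x = prim g x"
  unfolding prim_def by (rule integral_cong_unit_AE) auto

lemma l2norm_unit_le_bound:
  assumes "f \<in> borel_measurable unit_leb" "\<And>x. x \<in> {0<..<1} \<Longrightarrow> \<bar>f x\<bar> \<le> M" "0 \<le> M"
  shows "l2norm unit_leb f \<le> M"
proof -
  interpret finite_measure unit_leb by (rule finite_measure_unit_leb)
  have "(f x)\<^sup>2 \<le> M\<^sup>2" if "x \<in> {0<..<1}" for x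
    using power_mono[OF assms(2)[OF that], of 2] by simp
  then have "(\<integral>x. (f x)\<^sup>2 \<partial>unit_leb) \<le> (\<integral>x. M\<^sup>2 \<partial>unit_leb)"
    using sq_int_integrable_sq[OF bounded_sq_int_unit[OF assms(1,2)]]
    by (intro integral_mono) auto
  also have "\<dots> = M\<^sup>2 * (\<integral>x. 1 \<partial>unit_leb)" by (subst integral_mult_right_zero[symmetric]) simp
  finally have "(\<integral>x. (f x)\<^sup>2 \<partial>unit_leb) \<le> M\<^sup>2" by (simp only: integral_unit_one)
  then show ?thesis unfolding l2norm_def using assms(3) by (simp add: real_le_lsqrt)
qed

lemma l2norm_eq_0_AE:
  assumes "sq_int M f" "l2norm M f = 0"
  shows "AE x in M. f x = 0"
proof -
  have "AE x in M. (f x)\<^sup>2 = 0"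
    using integral_nonneg_eq_0_iff_AE[OF sq_int_integrable_sq[OF assms(1)]] assms(2)
    by (simp add: l2norm_def)
  then show ?thesis by eventually_elim simp
qed

subsection \<open>Integration by parts for absolutely continuous functions\<close>

text \<open>Both sides are continuous in \<open>f\<close> for the \<open>L\<^sup>2\<close> norm and agree for test functions.\<close>

lemma prim_by_parts:
  assumes f: "sq_int unit_leb f" and e: "0 \<le> e" "e < 1"
    and h: "\<And>x. x \<in> {e..1} \<Longrightarrow> (h has_real_derivative h' x) (at x within {e..1})"
    and h': "continuous_on {e..1} h'"
  shows "integral {e..1} (\<lambda>x. f x * h x)
      = prim f 1 * h 1 - prim f e * h e - integral {e..1} (\<lambda>x. prim f x * h' x)"
    and "(\<lambda>x. f x * h x) absolutely_integrable_on {e..1}"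
proof -
  have hc: "continuous_on {e..1} h" by (rule DERIV_continuous_on[OF h])
  obtain H where H: "\<And>x. x \<in> {e..1} \<Longrightarrow> \<bar>h x\<bar> \<le> H"
    using compact_imp_bounded[OF compact_continuous_image[OF hc compact_Icc]] unfolding bounded_iff real_norm_def by blast
  obtain H' where H': "\<And>x. x \<in> {e..1} \<Longrightarrow> \<bar>h' x\<bar> \<le> H'"
    using compact_imp_bounded[OF compact_continuous_image[OF h' compact_Icc]] unfolding bounded_iff real_norm_def by blast
  have H0: "0 \<le> H" "0 \<le> H'" using H[of 1] H'[of 1] e by auto
  have fh: "(\<lambda>x. r x * h x) absolutely_integrable_on {e..1}" if "sq_int unit_leb r" for r
  proof -
    have "(\<lambda>x. h x * r x) absolutely_integrable_on {e..1}"
      by (rule absolutely_integrable_bounded_measurable_product_real)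
        (use sq_int_absolutely_integrable[OF that e(1)] in \<open>auto intro!: continuous_imp_measurable_on_sets_lebesgue hc
            compact_imp_bounded compact_continuous_image\<close>)
    then show ?thesis by (simp add: mult.commute)
  qed
  then show "(\<lambda>x. f x * h x) absolutely_integrable_on {e..1}" using f by blast
  have fhi: "(\<lambda>x. r x * h x) integrable_on {e..1}" if "sq_int unit_leb r" for r
    using fh[OF that] by (simp add: absolutely_integrable_on_def)
  have pc: "continuous_on {e..1} (prim r)" if "sq_int unit_leb r" for r
    by (rule continuous_on_subset[OF prim_continuous_on[OF that]]) (use e in auto)
  have phi: "(\<lambda>x. prim r x * h' x) integrable_on {e..1}" if "sq_int unit_leb r" for r
    by (intro integrable_continuous_real continuous_on_mult pc that h')
  \<comment> \<open>\<open>D\<close> is the defect of the identity, as a linear functional of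
    \<open>r\<close>.\<close>
  define D where "D r = integral {e..1} (\<lambda>x. r x * h x)
      - (prim r 1 * h 1 - prim r e * h e - integral {e..1} (\<lambda>x. prim r x * h' x))" for r
  have D_diff: "D (\<lambda>x. r x - s x) = D r - D s" if r: "sq_int unit_leb r" and s: "sq_int unit_leb s" for r s
  proof -
    have "integral {e..1} (\<lambda>x. (r x - s x) * h x) = integral {e..1} (\<lambda>x. r x * h x) - integral {e..1} (\<lambda>x. s x * h x)"
      using fhi[OF r] fhi[OF s] by (simp add: left_diff_distrib Henstock_Kurzweil_Integration.integral_diff)
    moreover have "integral {e..1} (\<lambda>x. prim (\<lambda>x. r x - s x) x * h' x)
       = integral {e..1} (\<lambda>x. prim r x * h' x - prim s x * h' x)"
      by (rule Henstock_Kurzweil_Integration.integral_cong) (simp add: prim_diff[OF r s] left_diff_distrib)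
    moreover have "\<dots> = integral {e..1} (\<lambda>x. prim r x * h' x) - integral {e..1} (\<lambda>x. prim s x * h' x)"
      using phi[OF r] phi[OF s] by (simp add: Henstock_Kurzweil_Integration.integral_diff)
    ultimately show ?thesis
      using e by (simp add: D_def prim_diff[OF r s] algebra_simps)
  qed
  have D_test: "D \<phi> = 0" if \<phi>: "test_fun \<phi>" for \<phi>
  proof -
    have c: "continuous_on {0..1} \<phi>" by (rule test_fun_continuous_on[OF \<phi>])
    have sq: "sq_int unit_leb \<phi>" by (rule continuous_sq_int_unit[OF c])
    have "((\<lambda>x. prim \<phi> x * h x) has_real_derivative \<phi> x * h x + h' x * prim \<phi> x) (at x within {e..1})"
      if x: "x \<in> {e..1}" for x
    proof (rule DERIV_mult)
      show "(prim \<phi> has_real_derivative \<phi> x) (at x within {e..1})"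
        by (rule DERIV_subset[OF prim_has_derivative[OF c]]) (use x e in auto)
    qed (rule h[OF x])
    then have "((\<lambda>x. \<phi> x * h x + h' x * prim \<phi> x) has_integral prim \<phi> 1 * h 1 - prim \<phi> e * h e) {e..1}"
      using e by (intro has_integral_real_derivative) auto
    then have "integral {e..1} (\<lambda>x. \<phi> x * h x + prim \<phi> x * h' x) = prim \<phi> 1 * h 1 - prim \<phi> e * h e"
      by (simp add: integral_unique mult.commute)
    then show ?thesis
      using fhi[OF sq] phi[OF sq] by (simp add: D_def Henstock_Kurzweil_Integration.integral_add)
  qed
  have D_bound: "\<bar>D r\<bar> \<le> (3 * H + H') * l2norm unit_leb r" if r: "sq_int unit_leb r" for r
  proof -
    let ?n = "l2norm unit_leb r"
    have ri: "(\<lambda>x. \<bar>r x\<bar>) integrable_on {e..1}"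
      using sq_int_absolutely_integrable[OF r e(1)] by (simp add: absolutely_integrable_on_def)
    have "norm (integral {e..1} (\<lambda>x. r x * h x)) \<le> integral {e..1} (\<lambda>x. H * \<bar>r x\<bar>)"
    proof (rule integral_norm_bound_integral[OF fhi[OF r]])
      show "(\<lambda>x. H * \<bar>r x\<bar>) integrable_on {e..1}" by (intro integrable_on_mult_right ri)
      show "norm (r x * h x) \<le> H * \<bar>r x\<bar>" if "x \<in> {e..1}" for x
        using mult_right_mono[OF H[OF that], of "\<bar>r x\<bar>"] by (simp add: abs_mult mult.commute)
    qed
    also have "\<dots> = H * integral {e..1} (\<lambda>x. \<bar>r x\<bar>)" by simp
    also have "\<dots> \<le> H * ?n" by (intro mult_left_mono integral_abs_le_l2norm r H0) (use e in auto)
    finally have 1: "\<bar>integral {e..1} (\<lambda>x. r x * h x)\<bar> \<le> H * ?n" by simp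
    have 2: "\<bar>prim r 1 * h 1\<bar> \<le> ?n * H" "\<bar>prim r e * h e\<bar> \<le> ?n * H"
      unfolding abs_mult using e by (auto intro!: mult_mono prim_le_l2norm r H)
    have "norm (integral {e..1} (\<lambda>x. prim r x * h' x)) \<le> integral {e..1} (\<lambda>x. ?n * H')"
    proof (rule integral_norm_bound_integral[OF phi[OF r]])
      show "norm (prim r x * h' x) \<le> ?n * H'" if "x \<in> {e..1}" for x
        unfolding real_norm_def abs_mult using that by (intro mult_mono prim_le_l2norm r H') auto
    qed auto
    also have "\<dots> = (1 - e) * (?n * H')" using e by simp
    also have "\<dots> \<le> 1 * (?n * H')" using e H0 by (intro mult_right_mono mult_nonneg_nonneg) auto
    finally have 3: "\<bar>integral {e..1} (\<lambda>x. prim r x * h' x)\<bar> \<le> ?n * H'" by simp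
    have "(3 * H + H') * ?n = H * ?n + ?n * H + ?n * H + ?n * H'" by (simp add: algebra_simps)
    then show ?thesis using 1 2 3 unfolding D_def by linarith
  qed
  have "\<bar>D f\<bar> \<le> 0"
  proof (rule field_le_epsilon)
    fix \<epsilon> :: real assume \<epsilon>: "0 < \<epsilon>"
    \<comment> \<open>The extra 1 keeps the denominator positive when both bounds are 0.\<close>
    have C: "0 < 3 * H + H' + 1" using H0 by simp
    obtain \<phi> where \<phi>: "test_fun \<phi>" "sq_int unit_leb (\<lambda>x. \<phi> x / sqrt ((\<lambda>x. 1) x))"
      "l2norm unit_leb (\<lambda>x. \<phi> x / sqrt ((\<lambda>x. 1) x) - f x / sqrt ((\<lambda>x. 1) x)) < \<epsilon> / (3 * H + H' + 1)"
      by (rule weighted_test_dense[of "\<lambda>x. 1" f "\<epsilon> / (3 * H + H' + 1)"])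
        (use f \<epsilon> C in \<open>auto simp: sq_int_measurable\<close>)
    have sq: "sq_int unit_leb \<phi>" using \<phi>(2) by simp
    have n: "l2norm unit_leb (\<lambda>x. \<phi> x - f x) < \<epsilon> / (3 * H + H' + 1)" using \<phi>(3) by simp
    have "\<bar>D f\<bar> = \<bar>D (\<lambda>x. \<phi> x - f x)\<bar>" using D_diff[OF sq f] D_test[OF \<phi>(1)] by simp
    also have "\<dots> \<le> (3 * H + H') * l2norm unit_leb (\<lambda>x. \<phi> x - f x)" by (rule D_bound[OF sq_int_diff[OF sq f]])
    also have "\<dots> \<le> (3 * H + H' + 1) * (\<epsilon> / (3 * H + H' + 1))"
      using n H0 by (intro mult_mono) auto
    also have "\<dots> = \<epsilon>" using C by simp
    finally show "\<bar>D f\<bar> \<le> 0 + \<epsilon>" by simp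
  qed
  then show "integral {e..1} (\<lambda>x. f x * h x)
      = prim f 1 * h 1 - prim f e * h e - integral {e..1} (\<lambda>x. prim f x * h' x)"
    by (simp add: D_def)
qed

subsection \<open>Weak derivatives\<close>

lemma has_weak_deriv_locally_integrable:
  "has_weak_deriv k u w \<Longrightarrow> locally_integrable u" "has_weak_deriv k u w \<Longrightarrow> locally_integrable w"
  by (simp_all add: has_weak_deriv_def)

lemma has_weak_deriv_test:
  "has_weak_deriv k u w \<Longrightarrow> test_fun \<phi> \<Longrightarrow>
    (\<integral>x. u x * (deriv ^^ k) \<phi> x \<partial>unit_leb) = (-1) ^ k * (\<integral>x. w x * \<phi> x \<partial>unit_leb)"
  by (simp add: has_weak_deriv_def)

lemma integral_lincomb_test:
  assumes "locally_integrable u" "locally_integrable v" "test_fun \<phi>"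
  shows "(\<integral>x. (c * u x + d * v x) * \<phi> x \<partial>unit_leb)
    = c * (\<integral>x. u x * \<phi> x \<partial>unit_leb) + d * (\<integral>x. v x * \<phi> x \<partial>unit_leb)"
proof -
  have "(\<lambda>x. (c * u x + d * v x) * \<phi> x) = (\<lambda>x. c * (u x * \<phi> x) + d * (v x * \<phi> x))"
    by (auto simp: algebra_simps)
  then show ?thesis
    using locally_integrable_mult_test[OF assms(1,3)] locally_integrable_mult_test[OF assms(2,3)] by simp
qed

lemma weak_deriv_unique:
  assumes "has_weak_deriv k u w" "has_weak_deriv k u w'"
  shows "AE x in unit_leb. w x = w' x"
proof -
  have l: "locally_integrable w" "locally_integrable w'"
    using assms has_weak_deriv_locally_integrable by blast+
  have "AE x in unit_leb. 1 * w x + (-1) * w' x = 0"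
  proof (rule fundamental_lemma[OF locally_integrable_lincomb[OF l]])
    fix \<phi> assume \<phi>: "test_fun \<phi>"
    have "(-1) ^ k * (\<integral>x. w x * \<phi> x \<partial>unit_leb) = (-1) ^ k * (\<integral>x. w' x * \<phi> x \<partial>unit_leb)"
      using has_weak_deriv_test[OF assms(1) \<phi>] has_weak_deriv_test[OF assms(2) \<phi>] by simp
    then show "(\<integral>x. (1 * w x + (-1) * w' x) * \<phi> x \<partial>unit_leb) = 0"
      unfolding integral_lincomb_test[OF l \<phi>] by simp
  qed
  then show ?thesis by eventually_elim simp
qed

lemma locally_integrable_cong_AE:
  assumes "locally_integrable u" "AE x in unit_leb. u x = u' x"
  shows "locally_integrable u'"
  unfolding locally_integrable_def
proof (intro allI impI)
  fix c d :: real assume cd: "0 < c \<and> d < 1"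
  obtain N where N: "negligible N" "\<And>x. 0 < x \<Longrightarrow> x < 1 \<Longrightarrow> x \<notin> N \<Longrightarrow> u x = u' x"
    using unit_AE_negligible[OF assms(2)] by blast
  show "u' absolutely_integrable_on {c..d}"
  proof (rule absolutely_integrable_spike[OF _ N(1)])
    show "u absolutely_integrable_on {c..d}" using assms(1) cd by (auto simp: locally_integrable_def)
    show "u' x = u x" if "x \<in> {c..d} - N" for x using N(2)[of x] that cd by auto
  qed
qed

lemma has_weak_deriv_cong_AE:
  assumes "has_weak_deriv k u w" "AE x in unit_leb. u x = u' x"
  shows "has_weak_deriv k u' w"
proof -
  have l: "locally_integrable u" "locally_integrable w" "locally_integrable u'"
    using assms has_weak_deriv_locally_integrable locally_integrable_cong_AE by blast+
  have "(\<integral>x. u' x * (deriv ^^ k) \<phi> x \<partial>unit_leb) = (\<integral>x. u x * (deriv ^^ k) \<phi> x \<partial>unit_leb)"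
    if "test_fun \<phi>" for \<phi>
  proof (rule integral_cong_AE)
    show "AE x in unit_leb. u' x * (deriv ^^ k) \<phi> x = u x * (deriv ^^ k) \<phi> x"
      using assms(2) by eventually_elim simp
  qed (use locally_integrable_mult_test[OF l(1) test_fun_higher_deriv[OF that]]
       locally_integrable_mult_test[OF l(3) test_fun_higher_deriv[OF that]] in \<open>auto intro: borel_measurable_integrable\<close>)
  then show ?thesis using assms(1) l by (simp add: has_weak_deriv_def)
qed

text \<open>Equality of functions and not just almost everywhere: the choice by \<open>SOME\<close>
  depends only on the predicate, which cannot tell \<open>u\<close> from \<open>u'\<close>.\<close>

lemma weak_deriv_cong_AE:
  assumes "AE x in unit_leb. u x = u' x"
  shows "weak_deriv k u = weak_deriv k u'"
proof -
  have "AE x in unit_leb. u' x = u x" using assms by eventually_elim simp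
  then have "has_weak_deriv k u w \<longleftrightarrow> has_weak_deriv k u' w" for w
    using assms has_weak_deriv_cong_AE by blast
  then show ?thesis by (simp add: weak_deriv_def)
qed

lemma has_weak_deriv_weak_deriv: "has_weak_deriv k u w \<Longrightarrow> has_weak_deriv k u (weak_deriv k u)"
  unfolding weak_deriv_def by (rule someI[of "has_weak_deriv k u"])

lemma weak_deriv_AE: "has_weak_deriv k u w \<Longrightarrow> AE x in unit_leb. weak_deriv k u x = w x"
  using weak_deriv_unique has_weak_deriv_weak_deriv by blast

lemma has_weak_deriv_lincomb:
  assumes "has_weak_deriv k u w" "has_weak_deriv k v z"
  shows "has_weak_deriv k (\<lambda>x. c * u x + d * v x) (\<lambda>x. c * w x + d * z x)"
proof -
  have l: "locally_integrable u" "locally_integrable w" "locally_integrable v" "locally_integrable z"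
    using assms has_weak_deriv_locally_integrable by blast+
  then have "(\<integral>x. (c * u x + d * v x) * (deriv ^^ k) \<phi> x \<partial>unit_leb) =
      (- 1) ^ k * (\<integral>x. (c * w x + d * z x) * \<phi> x \<partial>unit_leb)" if "test_fun \<phi>" for \<phi>
    unfolding integral_lincomb_test[OF l(1,3) test_fun_higher_deriv[OF that]] integral_lincomb_test[OF l(2,4) that]
      has_weak_deriv_test[OF assms(1) that] has_weak_deriv_test[OF assms(2) that]
    by (simp add: algebra_simps)
  then show ?thesis using l by (simp add: has_weak_deriv_def locally_integrable_lincomb)
qed

lemma has_weak_deriv_0: "locally_integrable u \<Longrightarrow> has_weak_deriv 0 u u"
  by (simp add: has_weak_deriv_def)

lemma prim_deriv_test:
  assumes "test_fun \<phi>" "0 \<le> x"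
  shows "prim (deriv \<phi>) x = \<phi> x"
proof -
  have "(deriv \<phi> has_integral \<phi> x - \<phi> 0) {0..x}"
    by (rule has_integral_real_derivative) (use assms in \<open>auto intro: DERIV_subset[OF test_fun_has_deriv]\<close>)
  moreover have "\<phi> 0 = 0" by (rule test_funE[OF assms(1)]) simp
  ultimately show ?thesis by (simp add: prim_def integral_unique)
qed

lemma test_fun_at_1: "test_fun \<phi> \<Longrightarrow> \<phi> 1 = 0"
  by (erule test_funE) simp

lemma test_fun_sq_int: "test_fun \<phi> \<Longrightarrow> sq_int unit_leb \<phi>"
  by (intro continuous_sq_int_unit test_fun_continuous_on)

text \<open>The product \<open>\<phi> x * f x\<close> is again a test function, so its derivative
  has integral 0.\<close>

lemma smooth_test_by_parts:
  assumes f: "smooth f" and \<phi>: "test_fun \<phi>"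
  shows "(\<integral>x. f x * deriv \<phi> x \<partial>unit_leb) = - (\<integral>x. deriv f x * \<phi> x \<partial>unit_leb)"
proof -
  have t: "test_fun (\<lambda>x. \<phi> x * f x)" by (rule test_fun_smooth_mult[OF \<phi> f])
  have d: "deriv (\<lambda>x. \<phi> x * f x) = (\<lambda>x. deriv \<phi> x * f x + deriv f x * \<phi> x)"
    by (intro ext DERIV_imp_deriv DERIV_mult test_fun_has_deriv smooth_has_deriv f \<phi>)
  have i: "integrable unit_leb (\<lambda>x. deriv \<phi> x * f x)" "integrable unit_leb (\<lambda>x. deriv f x * \<phi> x)"
    by (intro sq_int_integrable[OF finite_measure_unit_leb] continuous_sq_int_unit continuous_on_mult
        smooth_continuous_on[OF f] smooth_continuous_on[OF smooth_deriv[OF f]]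
        test_fun_continuous_on[OF \<phi>] test_fun_continuous_on[OF test_fun_deriv[OF \<phi>]])+
  have "(\<integral>x. deriv (\<lambda>x. \<phi> x * f x) x \<partial>unit_leb) = prim (deriv (\<lambda>x. \<phi> x * f x)) 1"
    unfolding prim_def by (intro unit_integral_eq sq_int_integrable[OF finite_measure_unit_leb] test_fun_sq_int test_fun_deriv t)
  also have "\<dots> = 0" using prim_deriv_test[OF t, of 1] test_fun_at_1[OF \<phi>] by simp
  finally show ?thesis unfolding d using i by (simp add: mult.commute)
qed

lemma test_fun_has_weak_deriv:
  assumes "test_fun \<phi>" shows "has_weak_deriv k \<phi> ((deriv ^^ k) \<phi>)"
proof -
  have "(\<integral>x. \<phi> x * (deriv ^^ k) \<psi> x \<partial>unit_leb) = (-1) ^ k * (\<integral>x. (deriv ^^ k) \<phi> x * \<psi> x \<partial>unit_leb)"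
    if "test_fun \<psi>" for \<psi> using assms that
  proof (induction k arbitrary: \<phi>)
    case (Suc k)
    have "(\<integral>x. \<phi> x * (deriv ^^ Suc k) \<psi> x \<partial>unit_leb) = - (\<integral>x. deriv \<phi> x * (deriv ^^ k) \<psi> x \<partial>unit_leb)"
      using smooth_test_by_parts[OF test_fun_smooth[OF Suc.prems(1)] test_fun_higher_deriv[OF Suc.prems(2)]] by simp
    also have "\<dots> = - ((-1) ^ k * (\<integral>x. (deriv ^^ k) (deriv \<phi>) x * \<psi> x \<partial>unit_leb))"
      using Suc.IH[OF test_fun_deriv[OF Suc.prems(1)] Suc.prems(2)] by simp
    also have "(deriv ^^ k) (deriv \<phi>) = (deriv ^^ Suc k) \<phi>" by (simp add: funpow_swap1)
    finally show ?case by simp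
  qed simp
  then show ?thesis
    using assms by (simp add: has_weak_deriv_def sq_int_locally_integrable test_fun_sq_int test_fun_higher_deriv)
qed

subsection \<open>Sobolev functions\<close>

text \<open>The chosen derivative inherits square integrability from the witness \<open>w\<close>,
  as two weak derivatives agree almost everywhere.\<close>

lemma Sobolev_weak_deriv:
  assumes "u \<in> Sobolev m" "k \<le> m"
  shows "has_weak_deriv k u (weak_deriv k u)" "sq_int unit_leb (weak_deriv k u)"
proof -
  obtain w where w: "sq_int unit_leb w" "has_weak_deriv k u w"
    using assms by (auto simp: Sobolev_def L2_iff_sq_int)
  show h: "has_weak_deriv k u (weak_deriv k u)" by (rule has_weak_deriv_weak_deriv[OF w(2)])
  have "AE x in unit_leb. w x = weak_deriv k u x" by (rule weak_deriv_unique[OF w(2) h])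
  then show "sq_int unit_leb (weak_deriv k u)"
    by (rule sq_int_cong_AE[OF w(1), rotated])
      (rule locally_integrable_measurable[OF has_weak_deriv_locally_integrable(2)[OF h]])
qed

lemma Sobolev_sq_int: "u \<in> Sobolev m \<Longrightarrow> sq_int unit_leb u"
  by (simp add: Sobolev_def L2_iff_sq_int)

lemma test_fun_Sobolev: "test_fun \<phi> \<Longrightarrow> \<phi> \<in> Sobolev m"
  unfolding Sobolev_def mem_Collect_eq
proof (intro conjI allI impI)
  fix k assume t: "test_fun \<phi>"
  then show "\<exists>w\<in>L2 {0<..<1}. has_weak_deriv k \<phi> w"
    by (intro bexI[of _ "(deriv ^^ k) \<phi>"] test_fun_has_weak_deriv)
      (simp_all add: L2_iff_sq_int test_fun_sq_int test_fun_higher_deriv)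
qed (simp add: L2_iff_sq_int test_fun_sq_int)

lemma Sobolev_lincomb:
  assumes "u \<in> Sobolev m" "v \<in> Sobolev m"
  shows "(\<lambda>x. c * u x + d * v x) \<in> Sobolev m"
proof -
  have "\<exists>w. sq_int unit_leb w \<and> has_weak_deriv k (\<lambda>x. c * u x + d * v x) w" if "k \<le> m" for k
    using has_weak_deriv_lincomb[OF Sobolev_weak_deriv(1)[OF assms(1) that] Sobolev_weak_deriv(1)[OF assms(2) that]]
      sq_int_lincomb[OF Sobolev_weak_deriv(2)[OF assms(1) that] Sobolev_weak_deriv(2)[OF assms(2) that]]
    by blast
  then show ?thesis
    using sq_int_lincomb[OF Sobolev_sq_int[OF assms(1)] Sobolev_sq_int[OF assms(2)], of c d]
    unfolding Sobolev_def by (auto simp: L2_iff_sq_int Bex_def)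
qed

lemma weak_deriv_lincomb_AE:
  assumes "u \<in> Sobolev m" "v \<in> Sobolev m" "k \<le> m"
  shows "AE x in unit_leb. weak_deriv k (\<lambda>x. c * u x + d * v x) x = c * weak_deriv k u x + d * weak_deriv k v x"
  by (intro weak_deriv_AE has_weak_deriv_lincomb Sobolev_weak_deriv(1)[OF assms(1,3)] Sobolev_weak_deriv(1)[OF assms(2,3)])

lemma Sobolev0_Sobolev: "u \<in> Sobolev0 m \<Longrightarrow> u \<in> Sobolev m"
  by (simp add: Sobolev0_def)

lemma Sobolev0_iff:
  "u \<in> Sobolev0 m \<longleftrightarrow> u \<in> Sobolev m \<and> (\<exists>\<phi>. (\<forall>n::nat. test_fun (\<phi> n)) \<and>
     (\<forall>k\<le>m. (\<lambda>n. l2norm unit_leb (\<lambda>x. (deriv ^^ k) (\<phi> n) x - weak_deriv k u x)) \<longlonglongrightarrow> 0))"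
  by (simp add: Sobolev0_def l2norm_tendsto_iff)

lemma test_fun_Sobolev0:
  assumes "test_fun \<phi>" shows "\<phi> \<in> Sobolev0 m"
proof -
  have "l2norm unit_leb (\<lambda>x. (deriv ^^ k) \<phi> x - weak_deriv k \<phi> x) = l2norm unit_leb (\<lambda>x. 0)" if "k \<le> m" for k
  proof (rule l2norm_cong_AE)
    have "AE x in unit_leb. weak_deriv k \<phi> x = (deriv ^^ k) \<phi> x"
      by (rule weak_deriv_AE[OF test_fun_has_weak_deriv[OF assms]])
    then show "AE x in unit_leb. (deriv ^^ k) \<phi> x - weak_deriv k \<phi> x = 0" by eventually_elim simp
    show "(\<lambda>x. (deriv ^^ k) \<phi> x - weak_deriv k \<phi> x) \<in> borel_measurable unit_leb"
      by (intro borel_measurable_diff sq_int_measurable[OF test_fun_sq_int] test_fun_higher_deriv assms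
          sq_int_measurable[OF Sobolev_weak_deriv(2)[OF test_fun_Sobolev that]])
  qed simp
  then show ?thesis
    unfolding Sobolev0_iff using assms test_fun_Sobolev
    by (auto intro!: exI[of _ "\<lambda>n. \<phi>"] simp: l2norm_def)
qed

lemma Sobolev0_lincomb:
  assumes "u \<in> Sobolev0 m" "v \<in> Sobolev0 m"
  shows "(\<lambda>x. c * u x + d * v x) \<in> Sobolev0 m"
proof -
  obtain \<phi> where \<phi>: "\<And>n::nat. test_fun (\<phi> n)"
     "\<And>k. k \<le> m \<Longrightarrow> (\<lambda>n. l2norm unit_leb (\<lambda>x. (deriv ^^ k) (\<phi> n) x - weak_deriv k u x)) \<longlonglongrightarrow> 0"
    using assms(1) unfolding Sobolev0_iff by blast
  obtain \<psi> where \<psi>: "\<And>n::nat. test_fun (\<psi> n)"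
     "\<And>k. k \<le> m \<Longrightarrow> (\<lambda>n. l2norm unit_leb (\<lambda>x. (deriv ^^ k) (\<psi> n) x - weak_deriv k v x)) \<longlonglongrightarrow> 0"
    using assms(2) unfolding Sobolev0_iff by blast
  have uv: "u \<in> Sobolev m" "v \<in> Sobolev m" using assms Sobolev0_Sobolev by blast+
  define \<theta> where "\<theta> n x = c * \<phi> n x + d * \<psi> n x" for n x
  have \<theta>: "test_fun (\<theta> n)" for n unfolding \<theta>_def by (rule test_fun_lincomb[OF \<phi>(1) \<psi>(1)])
  have "(\<lambda>n. l2norm unit_leb (\<lambda>x. (deriv ^^ k) (\<theta> n) x - weak_deriv k (\<lambda>x. c * u x + d * v x) x)) \<longlonglongrightarrow> 0"
    if k: "k \<le> m" for k
  proof (rule Lim_null_comparison)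
    let ?p = "\<lambda>n x. (deriv ^^ k) (\<phi> n) x - weak_deriv k u x"
    let ?q = "\<lambda>n x. (deriv ^^ k) (\<psi> n) x - weak_deriv k v x"
    have sq: "sq_int unit_leb (?p n)" "sq_int unit_leb (?q n)" for n
      by (intro sq_int_diff test_fun_sq_int test_fun_higher_deriv \<phi>(1) \<psi>(1)
          Sobolev_weak_deriv(2)[OF uv(1) k] Sobolev_weak_deriv(2)[OF uv(2) k])+
    have "l2norm unit_leb (\<lambda>x. (deriv ^^ k) (\<theta> n) x - weak_deriv k (\<lambda>x. c * u x + d * v x) x)
        \<le> \<bar>c\<bar> * l2norm unit_leb (?p n) + \<bar>d\<bar> * l2norm unit_leb (?q n)" for n
    proof -
      have "l2norm unit_leb (\<lambda>x. (deriv ^^ k) (\<theta> n) x - weak_deriv k (\<lambda>x. c * u x + d * v x) x)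
         = l2norm unit_leb (\<lambda>x. c * ?p n x + d * ?q n x)"
      proof (rule l2norm_cong_AE)
        show "AE x in unit_leb. (deriv ^^ k) (\<theta> n) x - weak_deriv k (\<lambda>x. c * u x + d * v x) x = c * ?p n x + d * ?q n x"
          using weak_deriv_lincomb_AE[OF uv k, of c d]
        proof eventually_elim
          case (elim x)
          have "(deriv ^^ k) (\<theta> n) x = c * (deriv ^^ k) (\<phi> n) x + d * (deriv ^^ k) (\<psi> n) x"
            unfolding \<theta>_def deriv_test_lincomb[OF \<phi>(1) \<psi>(1)] by simp
          then show ?case using elim by (simp add: algebra_simps)
        qed
        show "(\<lambda>x. (deriv ^^ k) (\<theta> n) x - weak_deriv k (\<lambda>x. c * u x + d * v x) x) \<in> borel_measurable unit_leb"
          by (intro borel_measurable_diff sq_int_measurable[OF test_fun_sq_int] test_fun_higher_deriv \<theta>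
             sq_int_measurable[OF Sobolev_weak_deriv(2)[OF Sobolev_lincomb[OF uv] k]])
        show "(\<lambda>x. c * ?p n x + d * ?q n x) \<in> borel_measurable unit_leb"
          by (rule sq_int_measurable[OF sq_int_lincomb[OF sq]])
      qed
      also have "\<dots> \<le> l2norm unit_leb (\<lambda>x. c * ?p n x) + l2norm unit_leb (\<lambda>x. d * ?q n x)"
        by (rule l2norm_triangle[OF sq_int_cmult[OF sq(1)] sq_int_cmult[OF sq(2)]])
      finally show ?thesis by (simp add: l2norm_scale)
    qed
    then show "\<forall>\<^sub>F n in sequentially. norm (l2norm unit_leb (\<lambda>x. (deriv ^^ k) (\<theta> n) x - weak_deriv k (\<lambda>x. c * u x + d * v x) x))
        \<le> \<bar>c\<bar> * l2norm unit_leb (?p n) + \<bar>d\<bar> * l2norm unit_leb (?q n)"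
      by (intro always_eventually) simp
    show "(\<lambda>n. \<bar>c\<bar> * l2norm unit_leb (?p n) + \<bar>d\<bar> * l2norm unit_leb (?q n)) \<longlonglongrightarrow> 0"
      using tendsto_add[OF tendsto_mult_right_zero[OF \<phi>(2)[OF k], of "\<bar>c\<bar>"] tendsto_mult_right_zero[OF \<psi>(2)[OF k], of "\<bar>d\<bar>"]]
      by simp
  qed
  then show ?thesis
    unfolding Sobolev0_iff using Sobolev_lincomb[OF uv] \<theta> by blast
qed

text \<open>A test function is the double primitive of its second derivative and vanishes at 1
  together with its first derivative. As \<open>prim\<close> is bounded from \<open>L2\<close> to
  the uniform norm, this survives the limit and supplies the boundary values for all integrations by
  parts.\<close>

lemma Sobolev0_representation:
  assumes u: "u \<in> Sobolev0 2"
  defines "g \<equiv> weak_deriv 2 u"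
  shows "AE x in unit_leb. u x = prim (prim g) x" "prim g 1 = 0" "prim (prim g) 1 = 0"
proof -
  have uS: "u \<in> Sobolev 2" by (rule Sobolev0_Sobolev[OF u])
  have sq: "sq_int unit_leb g" unfolding g_def by (rule Sobolev_weak_deriv(2)[OF uS]) simp
  have squ: "sq_int unit_leb u" by (rule Sobolev_sq_int[OF uS])
  obtain \<phi> where \<phi>: "\<And>n::nat. test_fun (\<phi> n)"
     "\<And>k. k \<le> 2 \<Longrightarrow> (\<lambda>n. l2norm unit_leb (\<lambda>x. (deriv ^^ k) (\<phi> n) x - weak_deriv k u x)) \<longlonglongrightarrow> 0"
    using u unfolding Sobolev0_iff by blast
  define \<delta> where "\<delta> n = l2norm unit_leb (\<lambda>x. deriv (deriv (\<phi> n)) x - g x)" for n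
  have \<delta>: "\<delta> \<longlonglongrightarrow> 0"
    using \<phi>(2)[of 2] by (simp add: \<delta>_def[abs_def] g_def numeral_2_eq_2)
  have t1: "test_fun (deriv (\<phi> n))" "test_fun (deriv (deriv (\<phi> n)))" for n
    by (simp_all add: test_fun_deriv \<phi>(1))
  \<comment> \<open>Uniform convergence of the first derivatives up to the end points, where the
    boundary conditions are read off.\<close>
  have b1: "\<bar>deriv (\<phi> n) x - prim g x\<bar> \<le> \<delta> n" if "0 \<le> x" "x \<le> 1" for n x
    using prim_le_l2norm[OF sq_int_diff[OF test_fun_sq_int[OF t1(2)] sq] that(2), of n]
      prim_diff[OF test_fun_sq_int[OF t1(2)] sq that(2), of n] prim_deriv_test[OF t1(1) that(1), of n]
    by (simp add: \<delta>_def)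
  have sqd: "sq_int unit_leb (\<lambda>x. deriv (\<phi> n) x - prim g x)" for n
    by (rule sq_int_diff[OF test_fun_sq_int[OF t1(1)] sq_int_prim[OF sq]])
  have \<delta>0: "0 \<le> \<delta> n" for n by (simp add: \<delta>_def)
  have l1: "l2norm unit_leb (\<lambda>x. deriv (\<phi> n) x - prim g x) \<le> \<delta> n" for n
    by (rule l2norm_unit_le_bound[OF sq_int_measurable[OF sqd]]) (use b1 \<delta>0 in auto)
  have b0: "\<bar>\<phi> n x - prim (prim g) x\<bar> \<le> \<delta> n" if "0 \<le> x" "x \<le> 1" for n x
    using prim_le_l2norm[OF sqd that(2), of n] l1[of n]
      prim_diff[OF test_fun_sq_int[OF t1(1)] sq_int_prim[OF sq] that(2), of n] prim_deriv_test[OF \<phi>(1) that(1), of n]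
    by simp
  have sqpp: "sq_int unit_leb (prim (prim g))" by (intro sq_int_prim sq)
  have l0: "l2norm unit_leb (\<lambda>x. \<phi> n x - prim (prim g) x) \<le> \<delta> n" for n
    by (rule l2norm_unit_le_bound[OF sq_int_measurable[OF sq_int_diff[OF test_fun_sq_int[OF \<phi>(1)] sqpp]]])
      (use b0 \<delta>0 in auto)
  \<comment> \<open>The weak derivative of order 0 is itself a chosen representative, hence only
    almost everywhere equal to \<open>u\<close>.\<close>
  have w0: "AE x in unit_leb. weak_deriv 0 u x = u x"
    by (rule weak_deriv_AE[OF has_weak_deriv_0[OF sq_int_locally_integrable[OF squ]]])
  have "l2norm unit_leb (\<lambda>x. \<phi> n x - weak_deriv 0 u x) = l2norm unit_leb (\<lambda>x. \<phi> n x - u x)" for n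
  proof (rule l2norm_cong_AE)
    show "AE x in unit_leb. \<phi> n x - weak_deriv 0 u x = \<phi> n x - u x" using w0 by eventually_elim simp
    show "(\<lambda>x. \<phi> n x - weak_deriv 0 u x) \<in> borel_measurable unit_leb"
      by (rule sq_int_measurable[OF sq_int_diff[OF test_fun_sq_int[OF \<phi>(1)] Sobolev_weak_deriv(2)[OF uS]]]) simp
    show "(\<lambda>x. \<phi> n x - u x) \<in> borel_measurable unit_leb"
      by (rule sq_int_measurable[OF sq_int_diff[OF test_fun_sq_int[OF \<phi>(1)] squ]])
  qed
  then have \<phi>u: "(\<lambda>n. l2norm unit_leb (\<lambda>x. \<phi> n x - u x)) \<longlonglongrightarrow> 0" using \<phi>(2)[of 0] by simp
  have "l2norm unit_leb (\<lambda>x. u x - prim (prim g) x) \<le> l2norm unit_leb (\<lambda>x. \<phi> n x - u x) + \<delta> n" for n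
    using l2norm_triangle_diff[OF squ test_fun_sq_int[OF \<phi>(1)] sqpp, of n] l0[of n]
    by (simp add: l2norm_minus_commute[of _ u])
  moreover have lim: "(\<lambda>n. l2norm unit_leb (\<lambda>x. \<phi> n x - u x) + \<delta> n) \<longlonglongrightarrow> 0"
    using tendsto_add[OF \<phi>u \<delta>] by simp
  ultimately have "l2norm unit_leb (\<lambda>x. u x - prim (prim g) x) \<le> 0"
    by (intro LIMSEQ_le_const[OF lim]) auto
  then have "l2norm unit_leb (\<lambda>x. u x - prim (prim g) x) = 0"
    using l2norm_nonneg[of unit_leb "\<lambda>x. u x - prim (prim g) x"] by linarith
  from l2norm_eq_0_AE[OF sq_int_diff[OF squ sqpp] this]
  show "AE x in unit_leb. u x = prim (prim g) x" by eventually_elim simp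
  have "\<bar>prim g 1\<bar> \<le> \<delta> n" "\<bar>prim (prim g) 1\<bar> \<le> \<delta> n" for n
    using b1[of 1 n] b0[of 1 n] test_fun_at_1[OF t1(1), of n] test_fun_at_1[OF \<phi>(1), of n] by auto
  then have "\<bar>prim g 1\<bar> \<le> 0" "\<bar>prim (prim g) 1\<bar> \<le> 0"
    by (intro LIMSEQ_le_const[OF \<delta>] exI allI impI; blast)+
  then show "prim g 1 = 0" "prim (prim g) 1 = 0" by auto
qed

subsection \<open>The lemma of du Bois-Reymond\<close>

lemma locally_integrable_continuous: "continuous_on {0<..<1} f \<Longrightarrow> locally_integrable f"
  unfolding locally_integrable_def
  by (auto intro!: absolutely_integrable_continuous_real intro: continuous_on_subset)

lemma unit_integral_test:
  "test_fun \<psi> \<Longrightarrow> (\<integral>x. \<psi> x \<partial>unit_leb) = integral {0..1} \<psi>"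
  by (intro unit_integral_eq sq_int_integrable[OF finite_measure_unit_leb] test_fun_sq_int)

lemma ex_normalized_test_fun: obtains \<eta> where "test_fun \<eta>" "integral {0..1} \<eta> = 1"
proof -
  let ?b = "bump_on (1/4) (3/4)"
  have b: "test_fun ?b" by (rule test_fun_bump_on) auto
  have "?b (1/2) > 0" by (rule bump_on_pos) auto
  then have "integral {0..1} ?b \<noteq> 0"
    by (subst integral_eq_0_iff) (auto intro!: test_fun_continuous_on b bump_on_nonneg bexI[of _ "1/2"])
  then show thesis
    by (intro that[of "\<lambda>x. (1 / integral {0..1} ?b) * ?b x"] test_fun_scale b) simp
qed

text \<open>Subtracting the right multiple of \<open>\<eta>\<close> removes the mean, and what
  remains has a test function as primitive.\<close>

lemma test_fun_decompose:
  assumes \<eta>: "test_fun \<eta>" "integral {0..1} \<eta> = 1" and \<psi>: "test_fun \<psi>"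
  obtains \<phi> where "test_fun \<phi>" "deriv \<phi> = (\<lambda>x. 1 * \<psi> x + (- integral {0..1} \<psi>) * \<eta> x)"
proof -
  have i: "\<psi> integrable_on {0..1}" "\<eta> integrable_on {0..1}"
    by (intro integrable_continuous_real test_fun_continuous_on \<psi> \<eta>)+
  have "integral {0..1} (\<lambda>x. 1 * \<psi> x + (- integral {0..1} \<psi>) * \<eta> x)
      = 1 * integral {0..1} \<psi> + (- integral {0..1} \<psi>) * integral {0..1} \<eta>"
    by (subst Henstock_Kurzweil_Integration.integral_add[OF integrable_on_mult_right[OF i(1)] integrable_on_mult_right[OF i(2)]])
      (simp only: Henstock_Kurzweil_Integration.integral_mult_right)
  then have "integral {0..1} (\<lambda>x. 1 * \<psi> x + (- integral {0..1} \<psi>) * \<eta> x) = 0" using \<eta> by simp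
  from test_fun_primitive[OF test_fun_lincomb[OF \<psi> \<eta>(1)] this] that show thesis by blast
qed

lemma integral_test_lincomb:
  assumes "locally_integrable h" "test_fun \<phi>" "test_fun \<psi>"
  shows "(\<integral>x. h x * (c * \<phi> x + d * \<psi> x) \<partial>unit_leb)
    = c * (\<integral>x. h x * \<phi> x \<partial>unit_leb) + d * (\<integral>x. h x * \<psi> x \<partial>unit_leb)"
proof -
  have "(\<lambda>x. h x * (c * \<phi> x + d * \<psi> x)) = (\<lambda>x. c * (h x * \<phi> x) + d * (h x * \<psi> x))"
    by (auto simp: algebra_simps)
  then show ?thesis
    using locally_integrable_mult_test[OF assms(1,2)] locally_integrable_mult_test[OF assms(1,3)] by simp
qed

text \<open>Every test function is a derivative plus a multiple of \<open>\<eta>\<close>, so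
  \<open>h\<close> acts on test functions like the constant given by its pairing with
  \<open>\<eta>\<close>.\<close>

lemma du_Bois_Reymond:
  assumes h: "locally_integrable h" and 0: "\<And>\<phi>. test_fun \<phi> \<Longrightarrow> (\<integral>x. h x * deriv \<phi> x \<partial>unit_leb) = 0"
  obtains c where "AE x in unit_leb. h x = c"
proof -
  obtain \<eta> where \<eta>: "test_fun \<eta>" "integral {0..1} \<eta> = 1" by (rule ex_normalized_test_fun)
  define c where "c = (\<integral>x. h x * \<eta> x \<partial>unit_leb)"
  have one: "locally_integrable (\<lambda>x. 1)" by (rule locally_integrable_continuous) simp
  have "AE x in unit_leb. 1 * h x + (- c) * 1 = 0"
  proof (rule fundamental_lemma[OF locally_integrable_lincomb[OF h one]])
    fix \<psi> assume \<psi>: "test_fun \<psi>"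
    obtain \<phi> where \<phi>: "test_fun \<phi>" "deriv \<phi> = (\<lambda>x. 1 * \<psi> x + (- integral {0..1} \<psi>) * \<eta> x)"
      by (rule test_fun_decompose[OF \<eta> \<psi>])
    have "0 = (\<integral>x. h x * \<psi> x \<partial>unit_leb) - integral {0..1} \<psi> * c"
      using 0[OF \<phi>(1)] integral_test_lincomb[OF h \<psi> \<eta>(1), of 1 "- integral {0..1} \<psi>"] unfolding \<phi>(2) c_def by simp
    then show "(\<integral>x. (1 * h x + (- c) * 1) * \<psi> x \<partial>unit_leb) = 0"
      using integral_lincomb_test[OF h one \<psi>, of 1 "-c"] unit_integral_test[OF \<psi>] by (simp add: mult.commute)
  qed
  then have "AE x in unit_leb. h x = c" by eventually_elim simp
  then show thesis by (rule that)
qed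

text \<open>By the decomposition, \<open>h\<close> pairs with \<open>deriv \<psi>\<close> to
  \<open>c\<close> times the integral of \<open>\<psi>\<close>. The identity function pairs to minus
  that integral, so \<open>h x + c * x\<close> annihilates all derivatives and the first order case
  applies.\<close>

lemma du_Bois_Reymond_2:
  assumes h: "locally_integrable h" and 0: "\<And>\<phi>. test_fun \<phi> \<Longrightarrow> (\<integral>x. h x * (deriv ^^ 2) \<phi> x \<partial>unit_leb) = 0"
  obtains b c where "AE x in unit_leb. h x = b + c * x"
proof -
  obtain \<eta> where \<eta>: "test_fun \<eta>" "integral {0..1} \<eta> = 1" by (rule ex_normalized_test_fun)
  define c where "c = (\<integral>x. h x * deriv \<eta> x \<partial>unit_leb)"
  have id: "locally_integrable (\<lambda>x. x)" by (rule locally_integrable_continuous) simp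
  have sid: "smooth (\<lambda>x. x)" by (rule smooth_gen_smooth[OF smooth_gen.ident])
  have "(\<integral>x. (1 * h x + c * x) * deriv \<psi> x \<partial>unit_leb) = 0" if \<psi>: "test_fun \<psi>" for \<psi>
  proof -
    obtain \<phi> where \<phi>: "test_fun \<phi>" "deriv \<phi> = (\<lambda>x. 1 * \<psi> x + (- integral {0..1} \<psi>) * \<eta> x)"
      by (rule test_fun_decompose[OF \<eta> \<psi>])
    have d: "deriv (deriv \<phi>) = (\<lambda>x. 1 * deriv \<psi> x + (- integral {0..1} \<psi>) * deriv \<eta> x)"
      unfolding \<phi>(2) using deriv_test_lincomb[OF \<psi> \<eta>(1), of 1 1 "- integral {0..1} \<psi>"] by simp
    have "0 = (\<integral>x. h x * deriv \<psi> x \<partial>unit_leb) - integral {0..1} \<psi> * c"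
      using 0[OF \<phi>(1)] integral_test_lincomb[OF h test_fun_deriv[OF \<psi>] test_fun_deriv[OF \<eta>(1)], of 1 "- integral {0..1} \<psi>"]
      by (simp add: numeral_2_eq_2 d c_def)
    moreover have "(\<integral>x. x * deriv \<psi> x \<partial>unit_leb) = - integral {0..1} \<psi>"
      using smooth_test_by_parts[OF sid \<psi>] unit_integral_test[OF \<psi>] by simp
    ultimately show ?thesis
      using integral_lincomb_test[OF h id test_fun_deriv[OF \<psi>], of 1 c] by simp
  qed
  then obtain b where "AE x in unit_leb. 1 * h x + c * x = b"
    using du_Bois_Reymond[OF locally_integrable_lincomb[OF h id]] by blast
  then have "AE x in unit_leb. h x = b + (- c) * x" by eventually_elim simp
  then show thesis by (rule that)
qed

subsection \<open>The multiplier identity\<close>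

lemma sq_int_bound:
  assumes "f \<in> borel_measurable unit_leb" "sq_int unit_leb g" "\<And>x. x \<in> {0<..<1} \<Longrightarrow> \<bar>f x\<bar> \<le> \<bar>g x\<bar>"
  shows "sq_int unit_leb f"
proof -
  have "integrable unit_leb (\<lambda>x. (f x)\<^sup>2)"
  proof (rule Bochner_Integration.integrable_bound[OF sq_int_integrable_sq[OF assms(2)]])
    show "AE x in unit_leb. norm ((f x)\<^sup>2) \<le> norm ((g x)\<^sup>2)"
      using assms(3) by (intro AE_I2) (simp add: abs_le_square_iff)
  qed (use assms(1) in simp)
  then show ?thesis using assms(1) by (simp add: sq_int_def)
qed

lemma integral_vanishing_left:
  fixes f :: "real \<Rightarrow> real"
  assumes "f integrable_on {0..b}" "0 \<le> e" "e \<le> b" "\<And>x. x < e \<Longrightarrow> f x = 0"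
  shows "integral {0..b} f = integral {e..b} f"
proof -
  have "integral {0..e} f = integral {0..e} (\<lambda>x. 0)"
    by (rule integral_spike[of "{e}"]) (use assms(4) in auto)
  then show ?thesis
    using Henstock_Kurzweil_Integration.integral_combine[OF assms(2,3,1)] by simp
qed

text \<open>Near 0 only \<open>s * w s\<close> will be square integrable. Cutting at
  \<open>e\<close> produces an \<open>L2\<close> function to which the calculus of
  \<open>prim\<close> applies.\<close>

definition tail :: "real \<Rightarrow> (real \<Rightarrow> real) \<Rightarrow> real \<Rightarrow> real" where
  "tail e w s = indicat_real {e..} s * w s"

lemma tail_measurable:
  "w \<in> borel_measurable unit_leb \<Longrightarrow> tail e w \<in> borel_measurable unit_leb"
  unfolding tail_def[abs_def]
  by (rule borel_measurable_times[OF measurable_restrict_space1[OF borel_measurable_indicator]]) auto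

lemma sq_int_tail:
  assumes "w \<in> borel_measurable unit_leb" "sq_int unit_leb (\<lambda>s. s * w s)" "0 < e"
  shows "sq_int unit_leb (tail e w)"
proof (rule sq_int_bound[OF tail_measurable[OF assms(1)] sq_int_cmult[OF assms(2), of "1/e"]])
  fix x :: real assume x: "x \<in> {0<..<1}"
  show "\<bar>tail e w x\<bar> \<le> \<bar>1 / e * (x * w x)\<bar>"
  proof (cases "e \<le> x")
    case True
    have "1 * \<bar>w x\<bar> \<le> x / e * \<bar>w x\<bar>"
      using True assms(3) by (intro mult_right_mono) auto
    then show ?thesis using True x assms(3) by (simp add: tail_def abs_mult)
  qed (simp add: tail_def)
qed

lemma prim_tail:
  assumes "sq_int unit_leb (tail e w)" "0 < e" "e \<le> x" "x \<le> 1"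
  shows "prim (tail e w) x = integral {e..x} w"
proof -
  have "prim (tail e w) x = integral {e..x} (tail e w)"
    unfolding prim_def
    by (rule integral_vanishing_left) (use assms in \<open>auto intro: sq_int_integrable_on simp: tail_def\<close>)
  also have "\<dots> = integral {e..x} w"
    by (rule Henstock_Kurzweil_Integration.integral_cong) (simp add: tail_def)
  finally show ?thesis .
qed

lemma integrable_on_tail:
  assumes "sq_int unit_leb (tail e w)" "0 < e"
  shows "w integrable_on {e..1}"
proof -
  have "tail e w integrable_on {e..1}" using assms by (intro sq_int_integrable_on) auto
  then show ?thesis by (rule integrable_eq) (simp add: tail_def)
qed

lemma integral_inverse_square:
  fixes e :: real
  assumes "0 < e" "e \<le> 1"
  shows "integral {e..1} (\<lambda>s. 1 / s\<^sup>2) = 1 / e - 1"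
proof -
  have "((\<lambda>s. 1 / s\<^sup>2) has_integral (- (1 / 1)) - (- (1 / e))) {e..1}"
    by (rule has_integral_real_derivative[of e 1 "\<lambda>s. - (1 / s)"])
      (use assms in \<open>auto intro!: derivative_eq_intros simp: power2_eq_square field_simps\<close>)
  then show ?thesis by (simp add: integral_unique)
qed

lemma integral_inverse_sqrt:
  fixes e :: real
  assumes "0 < e" "e \<le> 1"
  shows "((\<lambda>s. 1 / sqrt s) has_integral 2 - 2 * sqrt e) {e..1}"
proof -
  have "((\<lambda>s. 1 / sqrt s) has_integral 2 * sqrt 1 - 2 * sqrt e) {e..1}"
    by (rule has_integral_real_derivative[of e 1 "\<lambda>s. 2 * sqrt s"])
      (use assms in \<open>auto intro!: derivative_eq_intros simp: field_simps\<close>)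
  then show ?thesis by simp
qed

text \<open>On \<open>[e, 1]\<close> the function \<open>w\<close> is \<open>1 / s\<close> times
  \<open>s * w s\<close>, and \<open>1 / s\<^sup>2\<close> has integral \<open>1 / e - 1\<close>
  there; Cauchy-Schwarz does the rest. For a fourth derivative \<open>w\<close> this is the growth
  rate of the third derivative at 0.\<close>

lemma tail_integral_bound:
  assumes wm: "w \<in> borel_measurable unit_leb" and s: "sq_int unit_leb (\<lambda>s. s * w s)" and e: "0 < e" "e \<le> 1"
  shows "\<bar>integral {e..1} w\<bar> \<le> l2norm unit_leb (\<lambda>s. s * w s) / sqrt e"
proof -
  have t: "sq_int unit_leb (tail e w)" by (rule sq_int_tail[OF wm s e(1)])
  define k where "k s = tail e (\<lambda>s. 1 / s) s" for s
  have inv: "(\<lambda>s::real. 1 / s) \<in> borel_measurable unit_leb" 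
    by (intro continuous_measurable_unit continuous_intros) auto
  have inv2: "(\<lambda>s::real. 1 / s\<^sup>2) \<in> borel_measurable unit_leb" 
    by (intro continuous_measurable_unit continuous_intros) auto
  have k: "sq_int unit_leb k"
    unfolding k_def[abs_def]
  proof (rule sq_int_tail[OF inv _ e(1)])
    show "sq_int unit_leb (\<lambda>s::real. s * (1 / s))"
      by (rule sq_int_bound[OF borel_measurable_times[OF continuous_measurable_unit[OF continuous_on_id] inv]
            continuous_sq_int_unit[of "\<lambda>x. 1"]]) auto
  qed
  have bnd: "sq_int unit_leb (tail e (\<lambda>s. 1 / s\<^sup>2))"
  proof (rule bounded_sq_int_unit[OF tail_measurable[OF inv2]])
    fix x :: real assume "x \<in> {0<..<1}"
    have "1 / x\<^sup>2 \<le> 1 / e\<^sup>2" if "e \<le> x"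
      using that e by (intro divide_left_mono power_mono) auto
    then show "\<bar>tail e (\<lambda>s. 1 / s\<^sup>2) x\<bar> \<le> 1 / e\<^sup>2" by (simp add: tail_def indicator_def)
  qed
  have "(l2norm unit_leb k)\<^sup>2 = (\<integral>s. tail e (\<lambda>s. 1 / s\<^sup>2) s \<partial>unit_leb)"
    unfolding l2norm_power2
    by (rule Bochner_Integration.integral_cong) (auto simp: k_def tail_def indicator_def power_divide)
  also have "\<dots> = prim (tail e (\<lambda>s. 1 / s\<^sup>2)) 1"
    unfolding prim_def by (rule unit_integral_eq[OF sq_int_integrable[OF finite_measure_unit_leb bnd]])
  also have "\<dots> = 1 / e - 1"
    using prim_tail[OF bnd e order_refl] integral_inverse_square[OF e] by simp
  finally have "(l2norm unit_leb k)\<^sup>2 \<le> 1 / e" by simp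
  then have "sqrt ((l2norm unit_leb k)\<^sup>2) \<le> sqrt (1 / e)" by (rule real_sqrt_le_mono)
  then have kn: "l2norm unit_leb k \<le> 1 / sqrt e" by (simp add: real_sqrt_divide)
  have "integral {e..1} w = prim (tail e w) 1" using prim_tail[OF t e order_refl] by simp
  also have "\<dots> = (\<integral>s. tail e w s \<partial>unit_leb)"
    unfolding prim_def by (rule unit_integral_eq[symmetric, OF sq_int_integrable[OF finite_measure_unit_leb t]])
  also have "\<dots> = (\<integral>s. k s * (s * w s) \<partial>unit_leb)"
    by (rule Bochner_Integration.integral_cong) (auto simp: k_def tail_def)
  finally have "\<bar>integral {e..1} w\<bar> \<le> l2norm unit_leb k * l2norm unit_leb (\<lambda>s. s * w s)"
    using sq_int_Cauchy_Schwarz[OF k s] by simp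
  also have "\<dots> \<le> 1 / sqrt e * l2norm unit_leb (\<lambda>s. s * w s)"
    by (intro mult_right_mono kn) simp
  finally show ?thesis by simp
qed

text \<open>A double primitive of the fourth derivative, taken from the right end point, has the same
  second weak derivative as \<open>g\<close>; the difference is affine by the lemma of du Bois-Reymond.\<close>

lemma second_weak_derivative_structure:
  assumes g: "sq_int unit_leb g" and wl: "locally_integrable w" and s: "sq_int unit_leb (\<lambda>s. s * w s)"
    and eq: "\<And>\<phi>. test_fun \<phi> \<Longrightarrow> (\<integral>x. g x * (deriv ^^ 2) \<phi> x \<partial>unit_leb) = (\<integral>x. w x * \<phi> x \<partial>unit_leb)"
  obtains G J M where "AE x in unit_leb. g x = G x"
    "\<And>e x. 0 < e \<Longrightarrow> x \<in> {e..1} \<Longrightarrow> (G has_real_derivative J x) (at x within {e..1})"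
    "\<And>e. 0 < e \<Longrightarrow> continuous_on {e..1} J"
    "\<And>e x. 0 < e \<Longrightarrow> x \<in> {e..1} \<Longrightarrow> J x = J e + prim (tail e w) x"
    "\<And>x. x \<in> {0<..1} \<Longrightarrow> \<bar>G x\<bar> \<le> M" "\<And>x. x \<in> {0<..1} \<Longrightarrow> sqrt x * \<bar>J x\<bar> \<le> M" "0 \<le> M"
proof -
  have wm: "w \<in> borel_measurable unit_leb" by (rule locally_integrable_measurable[OF wl])
  have t: "sq_int unit_leb (tail e w)" if "0 < e" for e by (rule sq_int_tail[OF wm s that])
  define S where "S = l2norm unit_leb (\<lambda>s. s * w s)"
  have S: "0 \<le> S" by (simp add: S_def)
  \<comment> \<open>The integrals start from 1, since \<open>w\<close> need not be integrable up to
    0.\<close>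
  define J where "J x = - integral {x..1} w" for x
  define W where "W x = - integral {x..1} J" for x
  have J_prim: "J x = J e + prim (tail e w) x" if "0 < e" "x \<in> {e..1}" for e x
    using prim_tail[OF t[OF that(1)] that(1), of x] that
      Henstock_Kurzweil_Integration.integral_combine[OF _ _ integrable_on_tail[OF t[OF that(1)] that(1)], of x]
    by (simp add: J_def)
  have pc: "continuous_on {e..1} (prim (tail e w))" if "0 < e" for e
    by (rule continuous_on_subset[OF prim_continuous_on[OF t[OF that]]]) (use that in auto)
  have Jc: "continuous_on {e..1} J" if "0 < e" for e
  proof -
    have "continuous_on {e..1} (\<lambda>x. J e + prim (tail e w) x)"
      by (intro continuous_intros pc that)
    then show ?thesis by (rule continuous_on_eq) (rule J_prim[OF that, symmetric])
  qed
  have WJ: "(W has_real_derivative J x) (at x within {e..1})" if "0 < e" "x \<in> {e..1}" for e x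
    using DERIV_minus[OF integral_has_real_derivative'[OF Jc[OF that(1)] that(2)]] by (simp add: W_def[abs_def])
  have Jb: "\<bar>J x\<bar> \<le> S / sqrt x" if "x \<in> {0<..1}" for x
    using tail_integral_bound[OF wm s, of x] that by (simp add: J_def S_def)
  \<comment> \<open>The inverse square root bound on \<open>J\<close> is integrable, which keeps
    \<open>W\<close> bounded up to 0.\<close>
  have Wb: "\<bar>W x\<bar> \<le> 2 * S" if x: "x \<in> {0<..1}" for x
  proof -
    have i: "((\<lambda>s. S * (1 / sqrt s)) has_integral S * (2 - 2 * sqrt x)) {x..1}"
      by (intro has_integral_mult_right integral_inverse_sqrt) (use x in auto)
    have "norm (integral {x..1} J) \<le> integral {x..1} (\<lambda>s. S * (1 / sqrt s))"
    proof (rule integral_norm_bound_integral)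
      show "J integrable_on {x..1}" using x by (intro integrable_continuous_real Jc) auto
      show "(\<lambda>s. S * (1 / sqrt s)) integrable_on {x..1}" using i by blast
      show "norm (J y) \<le> S * (1 / sqrt y)" if "y \<in> {x..1}" for y using Jb[of y] that x by simp
    qed
    also have "\<dots> = S * (2 - 2 * sqrt x)" using i by (rule integral_unique)
    also have "\<dots> \<le> S * 2" using x S by (intro mult_left_mono) auto
    finally show ?thesis by (simp add: W_def)
  qed
  have Wc: "continuous_on {0<..<1} W"
  proof (rule continuous_at_imp_continuous_on, intro ballI)
    fix x :: real assume x: "x \<in> {0<..<1}"
    have "(W has_real_derivative J x) (at x within {x/2..1})" using x by (intro WJ) auto
    moreover have "at x within {x/2..1} = at x"
      by (rule at_within_interior) (use x in simp)
    ultimately have "(W has_real_derivative J x) (at x)" by simp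
    then show "isCont W x" by (rule DERIV_isCont)
  qed
  have Wl: "locally_integrable W" by (rule locally_integrable_continuous[OF Wc])
  have gl: "locally_integrable g" by (rule sq_int_locally_integrable[OF g])
  have W_eq: "(\<integral>x. W x * (deriv ^^ 2) \<phi> x \<partial>unit_leb) = (\<integral>x. w x * \<phi> x \<partial>unit_leb)" if \<phi>: "test_fun \<phi>" for \<phi>
  proof -
    obtain c d where cd: "0 < c" "c < d" "d < 1" "\<And>x. x \<notin> {c..d} \<Longrightarrow> \<phi> x = 0"
      using test_funE[OF \<phi>] by blast
    obtain c1 d1 where cd1: "0 < c1" "c1 < d1" "d1 < 1" "\<And>x. x \<notin> {c1..d1} \<Longrightarrow> deriv \<phi> x = 0"
      using test_funE[OF test_fun_deriv[OF \<phi>]] by blast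
    obtain c2 d2 where cd2: "0 < c2" "c2 < d2" "d2 < 1" "\<And>x. x \<notin> {c2..d2} \<Longrightarrow> deriv (deriv \<phi>) x = 0"
      using test_funE[OF test_fun_deriv[OF test_fun_deriv[OF \<phi>]]] by blast
    \<comment> \<open>\<open>e\<close> lies to the left of the supports of \<open>\<phi>\<close> and
      its first two derivatives, so all boundary terms at \<open>e\<close> vanish and the integrals
      reduce to \<open>[e, 1]\<close>.\<close>
    define e where "e = min c (min c1 c2) / 2"
    have e: "0 < e" "e < c" "e < c1" "e < c2" "e < 1" using cd cd1 cd2 by (auto simp: e_def)
    have z: "\<phi> e = 0" "\<phi> 1 = 0" "deriv \<phi> e = 0" "deriv \<phi> 1 = 0" using cd cd1 e by auto
    have d1: "(\<phi> has_real_derivative deriv \<phi> x) (at x within A)"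
      "(deriv \<phi> has_real_derivative deriv (deriv \<phi>) x) (at x within A)" for x A
      by (auto intro: DERIV_subset[OF test_fun_has_deriv] test_fun_deriv \<phi>)
    have c1: "continuous_on A \<phi>" "continuous_on A (deriv \<phi>)" "continuous_on A (deriv (deriv \<phi>))" for A
      by (auto intro: test_fun_continuous_on test_fun_deriv \<phi>)
    have ip: "(\<lambda>x. prim (tail e w) x * deriv \<phi> x) integrable_on {e..1}"
      by (intro integrable_continuous_real continuous_on_mult pc e c1)
    have iJ: "(\<lambda>x. J x * deriv \<phi> x) integrable_on {e..1}" "(\<lambda>x. W x * deriv (deriv \<phi>) x) integrable_on {e..1}"
      by (intro integrable_continuous_real continuous_on_mult Jc e c1 DERIV_continuous_on[OF WJ[OF e(1)]])+ auto
    have 1: "integral {e..1} (\<lambda>x. tail e w x * \<phi> x) = - integral {e..1} (\<lambda>x. prim (tail e w) x * deriv \<phi> x)"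
      using prim_by_parts(1)[OF t[OF e(1)], of e \<phi> "deriv \<phi>"] e z d1 c1 by simp
    have "((\<lambda>x. J x * deriv \<phi> x + deriv (deriv \<phi>) x * W x) has_integral W 1 * deriv \<phi> 1 - W e * deriv \<phi> e) {e..1}"
      by (intro has_integral_real_derivative[of e 1 "\<lambda>x. W x * deriv \<phi> x"] DERIV_mult WJ e d1) (use e in auto)
    then have "integral {e..1} (\<lambda>x. J x * deriv \<phi> x + W x * deriv (deriv \<phi>) x) = 0"
      using z by (simp add: integral_unique mult.commute)
    then have 2: "integral {e..1} (\<lambda>x. J x * deriv \<phi> x) + integral {e..1} (\<lambda>x. W x * deriv (deriv \<phi>) x) = 0"
      using Henstock_Kurzweil_Integration.integral_add[OF iJ] by simp
    \<comment> \<open>The constant part \<open>J e\<close> of \<open>J\<close> pairs with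
      \<open>deriv \<phi>\<close> to 0, which leaves the primitive of the tail.\<close>
    have "(deriv \<phi> has_integral \<phi> 1 - \<phi> e) {e..1}"
      by (rule has_integral_real_derivative[OF _ d1(1)]) (use e in auto)
    then have h0: "((\<lambda>x. J e * deriv \<phi> x) has_integral 0) {e..1}" using z has_integral_mult_right[of "deriv \<phi>" 0 "{e..1}" "J e"] by simp
    have "integral {e..1} (\<lambda>x. J x * deriv \<phi> x) = integral {e..1} (\<lambda>x. J e * deriv \<phi> x + prim (tail e w) x * deriv \<phi> x)"
    proof (rule Henstock_Kurzweil_Integration.integral_cong)
      fix x assume "x \<in> {e..1}"
      then show "J x * deriv \<phi> x = J e * deriv \<phi> x + prim (tail e w) x * deriv \<phi> x"
        by (subst J_prim[OF e(1)]) (simp_all add: distrib_right)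
    qed
    also have "\<dots> = integral {e..1} (\<lambda>x. prim (tail e w) x * deriv \<phi> x)"
      using Henstock_Kurzweil_Integration.integral_add[OF has_integral_integrable[OF h0] ip] integral_unique[OF h0] by simp
    finally have 3: "integral {e..1} (\<lambda>x. J x * deriv \<phi> x) = integral {e..1} (\<lambda>x. prim (tail e w) x * deriv \<phi> x)" .
    have 4: "integral {e..1} (\<lambda>x. tail e w x * \<phi> x) = integral {e..1} (\<lambda>x. w x * \<phi> x)"
      by (rule Henstock_Kurzweil_Integration.integral_cong) (simp add: tail_def)
    have iw: "integrable unit_leb (\<lambda>x. w x * \<phi> x)" by (rule locally_integrable_mult_test[OF wl \<phi>])
    have iW: "integrable unit_leb (\<lambda>x. W x * deriv (deriv \<phi>) x)"
      by (intro locally_integrable_mult_test Wl test_fun_deriv \<phi>)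
    have 5: "(\<integral>x. w x * \<phi> x \<partial>unit_leb) = integral {e..1} (\<lambda>x. w x * \<phi> x)"
      unfolding unit_integral_eq[OF iw]
    proof (rule integral_vanishing_left)
      show "(\<lambda>x. w x * \<phi> x) integrable_on {0..1}"
        using iw unfolding unit_integrable_iff by (simp add: absolutely_integrable_on_def)
    qed (use e cd in auto)
    have 6: "(\<integral>x. W x * deriv (deriv \<phi>) x \<partial>unit_leb) = integral {e..1} (\<lambda>x. W x * deriv (deriv \<phi>) x)"
      unfolding unit_integral_eq[OF iW]
    proof (rule integral_vanishing_left)
      show "(\<lambda>x. W x * deriv (deriv \<phi>) x) integrable_on {0..1}"
        using iW unfolding unit_integrable_iff by (simp add: absolutely_integrable_on_def)
    qed (use e cd2 in auto)
    show ?thesis using 1 2 3 4 5 6 by (simp add: numeral_2_eq_2)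
  qed
  have "(\<integral>x. (1 * g x + (-1) * W x) * (deriv ^^ 2) \<phi> x \<partial>unit_leb) = 0" if "test_fun \<phi>" for \<phi>
    unfolding integral_lincomb_test[OF gl Wl test_fun_higher_deriv[OF that]]
    using eq[OF that] W_eq[OF that] by simp
  then obtain b c where bc: "AE x in unit_leb. 1 * g x + (-1) * W x = b + c * x"
    using du_Bois_Reymond_2[OF locally_integrable_lincomb[OF gl Wl]] by blast
  \<comment> \<open>One constant serves both bounds: \<open>\<bar>W x\<bar>\<close> is at most
    \<open>2 * S\<close> and \<open>sqrt x * \<bar>J x\<bar>\<close> at most \<open>S\<close>, and
    the affine correction adds at most \<open>\<bar>b\<bar> + \<bar>c\<bar>\<close>.\<close>
  show thesis
  proof (rule that[of "\<lambda>x. W x + (b + c * x)" "\<lambda>x. J x + c" "2 * S + \<bar>b\<bar> + \<bar>c\<bar>"])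
    show "AE x in unit_leb. g x = W x + (b + c * x)" using bc by eventually_elim simp
    show "((\<lambda>x. W x + (b + c * x)) has_real_derivative J x + c) (at x within {e..1})"
      if "0 < e" "x \<in> {e..1}" for e x
      by (intro DERIV_add WJ that) (auto intro!: derivative_eq_intros)
    show "continuous_on {e..1} (\<lambda>x. J x + c)" if "0 < e" for e
      by (intro continuous_intros Jc that)
    show "J x + c = J e + c + prim (tail e w) x" if "0 < e" "x \<in> {e..1}" for e x
      using J_prim[OF that] by simp
    fix x :: real assume x: "x \<in> {0<..1}"
    have cx: "\<bar>c * x\<bar> \<le> \<bar>c\<bar>" using x mult_left_le[of "\<bar>x\<bar>" "\<bar>c\<bar>"] by (simp add: abs_mult)
    show "\<bar>W x + (b + c * x)\<bar> \<le> 2 * S + \<bar>b\<bar> + \<bar>c\<bar>" using Wb[OF x] cx by linarith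
    have "sqrt x * \<bar>J x + c\<bar> \<le> sqrt x * (S / sqrt x + \<bar>c\<bar>)"
      using Jb[OF x] x by (intro mult_left_mono) auto
    also have "\<dots> = S + sqrt x * \<bar>c\<bar>" using x by (simp add: distrib_left)
    also have "\<dots> \<le> S + 1 * \<bar>c\<bar>" using x by (intro add_left_mono mult_right_mono) auto
    finally show "sqrt x * \<bar>J x + c\<bar> \<le> 2 * S + \<bar>b\<bar> + \<bar>c\<bar>" using S by simp
  qed (use S in simp)
qed

lemma tail_integral_tendsto:
  fixes f :: "real \<Rightarrow> real"
  assumes "f integrable_on {0..1}"
  shows "((\<lambda>e. integral {e..1} f) \<longlongrightarrow> integral {0..1} f) (at_right 0)"
proof -
  have "((\<lambda>e. integral {e..1} f) \<longlongrightarrow> integral {0..1} f) (at 0 within {0..1})"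
    using indefinite_integral_continuous_1'[OF assms] unfolding continuous_on_def by force
  then show ?thesis by (simp add: at_within_Icc_at_right)
qed

text \<open>A bounded representative suffices because \<open>prim\<close> does not see null sets.
  This linear decay at 0 is what absorbs boundary terms.\<close>

lemma AE_prim_AE_bound:
  assumes G: "AE x in unit_leb. g x = G x" and M: "\<And>x. x \<in> {0<..1} \<Longrightarrow> \<bar>G x\<bar> \<le> M"
    and g: "sq_int unit_leb g" and x: "x \<in> {0..1}"
  shows "\<bar>prim g x\<bar> \<le> M * x"
proof -
  obtain N where N: "negligible N" "\<And>x. 0 < x \<Longrightarrow> x < 1 \<Longrightarrow> x \<notin> N \<Longrightarrow> g x = G x"
    using unit_AE_negligible[OF G] by blast
  define h where "h y = (if y \<in> insert 0 (insert 1 N) then 0 else g y)" for y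
  have M0: "0 \<le> M" using M[of 1] by simp
  have neg: "negligible (insert 0 (insert 1 N))" using N(1) by simp
  have "prim g x = integral {0..x} h"
    unfolding prim_def by (rule integral_spike[OF neg]) (simp add: h_def)
  moreover have "h integrable_on {0..x}"
    by (rule integrable_spike[OF sq_int_integrable_on[OF g] neg]) (use x in \<open>auto simp: h_def\<close>)
  then have "norm (integral {0..x} h) \<le> integral {0..x} (\<lambda>y. M)"
    by (rule integral_norm_bound_integral) (use x M0 in \<open>auto simp: h_def intro!: M[simplified] simp: N(2)\<close>)
  ultimately show ?thesis using x by (simp add: mult.commute)
qed

text \<open>With \<open>U = prim g\<close> in the role of u_x, \<open>G\<close> of u_xx and
  \<open>J\<close> of u_xxx, the integrations by parts on \<open>[e, 1]\<close> rest on the exact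
  derivative of \<open>G x * U x + x * (G x)\<^sup>2 / 2\<close>. Since \<open>U\<close> vanishes at
  1, only half the squared trace remains there.\<close>

lemma multiplier_identity:
  assumes g: "sq_int unit_leb g" "prim g 1 = 0" and wl: "locally_integrable w" and s: "sq_int unit_leb (\<lambda>s. s * w s)"
    and eq: "\<And>\<phi>. test_fun \<phi> \<Longrightarrow> (\<integral>x. g x * (deriv ^^ 2) \<phi> x \<partial>unit_leb) = (\<integral>x. w x * \<phi> x \<partial>unit_leb)"
  obtains G where "AE x in unit_leb. g x = G x" "(G \<longlongrightarrow> G 1) (at_left 1)"
    "integrable unit_leb (\<lambda>x. w x * (x * prim g x))"
    "- (\<integral>x. w x * (x * prim g x) \<partial>unit_leb) = (G 1)\<^sup>2 / 2 - 3 / 2 * (\<integral>x. (g x)\<^sup>2 \<partial>unit_leb)"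
proof -
  obtain G J M where G: "AE x in unit_leb. g x = G x"
    and GJ: "\<And>e x. 0 < e \<Longrightarrow> x \<in> {e..1} \<Longrightarrow> (G has_real_derivative J x) (at x within {e..1})"
    and Jc: "\<And>e. 0 < e \<Longrightarrow> continuous_on {e..1} J"
    and Jp: "\<And>e x. 0 < e \<Longrightarrow> x \<in> {e..1} \<Longrightarrow> J x = J e + prim (tail e w) x"
    and Gb: "\<And>x. x \<in> {0<..1} \<Longrightarrow> \<bar>G x\<bar> \<le> M" and Jb: "\<And>x. x \<in> {0<..1} \<Longrightarrow> sqrt x * \<bar>J x\<bar> \<le> M" and M0: "0 \<le> M"
    using second_weak_derivative_structure[OF g(1) wl s eq] by blast
  define U where "U = prim g"
  have wm: "w \<in> borel_measurable unit_leb" by (rule locally_integrable_measurable[OF wl])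
  have t: "sq_int unit_leb (tail e w)" if "0 < e" for e by (rule sq_int_tail[OF wm s that])
  have Ub: "\<bar>U x\<bar> \<le> M * x" if "x \<in> {0..1}" for x
    unfolding U_def by (rule AE_prim_AE_bound[OF G Gb g(1) that])
  have Gc: "continuous_on {e..1} G" if "0 < e" for e by (rule DERIV_continuous_on[OF GJ[OF that]])
  have U_diff: "U x = U e + integral {e..x} G" if "0 < e" "x \<in> {e..1}" for e x
  proof -
    have "U x = U e + integral {e..x} g"
      unfolding U_def prim_def
      by (rule Henstock_Kurzweil_Integration.integral_combine[symmetric])
        (use that in \<open>auto intro: sq_int_integrable_on[OF g(1)]\<close>)
    also have "integral {e..x} g = integral {e..x} G"
      by (rule integral_cong_unit_AE[OF G]) (use that in auto)
    finally show ?thesis .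
  qed
  \<comment> \<open>\<open>U\<close> is a primitive of the \<open>L2\<close> function
    \<open>g\<close>; the continuous representative \<open>G\<close> makes it differentiable away
    from 0.\<close>
  have UG: "(U has_real_derivative G x) (at x within {e..1})" if e: "0 < e" and x: "x \<in> {e..1}" for e x
  proof -
    have "((\<lambda>x. U e + integral {e..x} G) has_real_derivative 0 + G x) (at x within {e..1})"
      by (intro DERIV_add DERIV_const integral_has_real_derivative Gc e x)
    then have "((\<lambda>x. U e + integral {e..x} G) has_derivative (*) (G x)) (at x within {e..1})"
      by (simp add: has_field_derivative_def)
    from has_derivative_transform[OF x U_diff[OF e] this]
    show ?thesis by (simp add: has_field_derivative_def)
  qed
  have U1: "U 1 = 0" using g(2) by (simp add: U_def)
  have main: "- integral {e..1} (\<lambda>x. w x * (x * U x)) + 3 / 2 * integral {e..1} (\<lambda>x. (g x)\<^sup>2)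
      = (G 1)\<^sup>2 / 2 - G e * U e - e * (G e)\<^sup>2 / 2 + J e * (e * U e)" if e: "0 < e" "e < 1" for e
  proof -
    have Uc: "continuous_on {e..1} U" by (rule DERIV_continuous_on[OF UG[OF e(1)]])
    have pc: "continuous_on {e..1} (prim (tail e w))"
      by (rule continuous_on_subset[OF prim_continuous_on[OF t[OF e(1)]]]) (use e in auto)
    have h: "((\<lambda>x. x * U x) has_real_derivative U x + x * G x) (at x within {e..1})" if "x \<in> {e..1}" for x
      by (auto intro!: derivative_eq_intros UG[OF e(1) that])
    have hc: "continuous_on {e..1} (\<lambda>x. U x + x * G x)" by (intro continuous_intros Uc Gc e)
    have pe: "prim (tail e w) e = 0" using prim_tail[OF t[OF e(1)] e(1), of e] e by simp
    have "integral {e..1} (\<lambda>x. w x * (x * U x)) = integral {e..1} (\<lambda>x. tail e w x * (x * U x))"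
      by (rule Henstock_Kurzweil_Integration.integral_cong) (simp add: tail_def)
    also have "\<dots> = - integral {e..1} (\<lambda>x. prim (tail e w) x * (U x + x * G x))"
      using prim_by_parts(1)[OF t[OF e(1)] less_imp_le[OF e(1)] e(2) h hc] by (simp add: pe U1)
    finally have 1: "integral {e..1} (\<lambda>x. w x * (x * U x)) = - integral {e..1} (\<lambda>x. prim (tail e w) x * (U x + x * G x))" .
    have "((\<lambda>x. U x + x * G x) has_integral 1 * U 1 - e * U e) {e..1}"
      by (rule has_integral_real_derivative[OF _ h]) (use e in auto)
    then have hi: "((\<lambda>x. J e * (U x + x * G x)) has_integral - (J e * (e * U e))) {e..1}"
      using has_integral_mult_right[of "\<lambda>x. U x + x * G x" "- (e * U e)" "{e..1}" "J e"] by (simp add: U1)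
    have ip: "(\<lambda>x. prim (tail e w) x * (U x + x * G x)) integrable_on {e..1}"
      by (intro integrable_continuous_real continuous_on_mult pc hc)
    have "integral {e..1} (\<lambda>x. J x * (U x + x * G x))
        = integral {e..1} (\<lambda>x. J e * (U x + x * G x) + prim (tail e w) x * (U x + x * G x))"
    proof (rule Henstock_Kurzweil_Integration.integral_cong)
      fix x assume "x \<in> {e..1}"
      then show "J x * (U x + x * G x) = J e * (U x + x * G x) + prim (tail e w) x * (U x + x * G x)"
        by (subst Jp[OF e(1)]) (simp_all only: distrib_right)
    qed
    also have "\<dots> = - (J e * (e * U e)) + integral {e..1} (\<lambda>x. prim (tail e w) x * (U x + x * G x))"
      using Henstock_Kurzweil_Integration.integral_add[OF has_integral_integrable[OF hi] ip] integral_unique[OF hi] by simp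
    finally have 2: "integral {e..1} (\<lambda>x. J x * (U x + x * G x))
       = - (J e * (e * U e)) + integral {e..1} (\<lambda>x. prim (tail e w) x * (U x + x * G x))" .
    have iG: "(\<lambda>x. 3 / 2 * (G x)\<^sup>2) integrable_on {e..1}" "(\<lambda>x. J x * (U x + x * G x)) integrable_on {e..1}"
      by (intro integrable_continuous_real continuous_intros Gc Jc Uc e)+
    \<comment> \<open>The summands differentiate to \<open>J * U + G\<^sup>2\<close> and
      \<open>G\<^sup>2 / 2 + x * G * J\<close>, whence the factor \<open>3 / 2\<close>.\<close>
    have "((\<lambda>x. G x * U x + x * (G x)\<^sup>2 / 2) has_real_derivative J x * (U x + x * G x) + 3 / 2 * (G x)\<^sup>2) (at x within {e..1})"
      if "x \<in> {e..1}" for x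
    proof -
      note [derivative_intros] = GJ[OF e(1) that] UG[OF e(1) that]
      show ?thesis
        by (auto intro!: derivative_eq_intros simp: power2_eq_square field_simps)
    qed
    then have "((\<lambda>x. J x * (U x + x * G x) + 3 / 2 * (G x)\<^sup>2) has_integral
        (G 1 * U 1 + 1 * (G 1)\<^sup>2 / 2) - (G e * U e + e * (G e)\<^sup>2 / 2)) {e..1}"
      by (intro has_integral_real_derivative[of e 1 "\<lambda>x. G x * U x + x * (G x)\<^sup>2 / 2"]) (use e in auto)
    then have 3: "integral {e..1} (\<lambda>x. J x * (U x + x * G x)) + integral {e..1} (\<lambda>x. 3 / 2 * (G x)\<^sup>2)
        = (G 1)\<^sup>2 / 2 - (G e * U e + e * (G e)\<^sup>2 / 2)"
      using Henstock_Kurzweil_Integration.integral_add[OF iG(2,1)] by (simp add: integral_unique U1)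
    have 4: "integral {e..1} (\<lambda>x. 3 / 2 * (G x)\<^sup>2) = 3 / 2 * integral {e..1} (\<lambda>x. (g x)\<^sup>2)"
    proof -
      have "integral {e..1} (\<lambda>x. (g x)\<^sup>2) = integral {e..1} (\<lambda>x. (G x)\<^sup>2)"
        by (rule integral_cong_unit_AE) (use G e in \<open>auto elim: eventually_mono\<close>)
      then show ?thesis by simp
    qed
    show ?thesis using 1 2 3 4 by linarith
  qed
  have Usq: "sq_int unit_leb U" unfolding U_def by (rule sq_int_prim[OF g(1)])
  have "(\<lambda>x. w x * (x * U x)) = (\<lambda>x. (x * w x) * U x)" by auto
  then have iw: "integrable unit_leb (\<lambda>x. w x * (x * U x))"
    using sq_int_mult_integrable[OF s Usq] by simp
  then have iw': "(\<lambda>x. w x * (x * U x)) integrable_on {0..1}"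
    unfolding unit_integrable_iff by (simp add: absolutely_integrable_on_def)
  have ig: "integrable unit_leb (\<lambda>x. (g x)\<^sup>2)" by (rule sq_int_integrable_sq[OF g(1)])
  then have ig': "(\<lambda>x. (g x)\<^sup>2) integrable_on {0..1}"
    unfolding unit_integrable_iff by (simp add: absolutely_integrable_on_def)
  have ev: "\<forall>\<^sub>F e in at_right 0. e \<in> {0<..<1::real}" by (rule eventually_at_right_real) simp
  \<comment> \<open>Majorants of the boundary terms: \<open>G e\<close> and
    \<open>sqrt e * J e\<close> are bounded by \<open>M\<close>, and \<open>U e\<close> by
    \<open>M * e\<close>, so the terms decay at least like \<open>e\<close>, \<open>e\<close> and
    \<open>sqrt e\<close>.\<close>
  have id0: "((\<lambda>e::real. M * M * e) \<longlongrightarrow> 0) (at_right 0)" "((\<lambda>e::real. M * M * sqrt e) \<longlongrightarrow> 0) (at_right 0)"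
    "((\<lambda>e::real. e * M\<^sup>2) \<longlongrightarrow> 0) (at_right 0)"
    by (rule tendsto_eq_intros refl | simp)+
  have l1: "((\<lambda>e. G e * U e) \<longlongrightarrow> 0) (at_right 0)"
  proof (rule Lim_null_comparison[OF _ id0(1)], use ev in eventually_elim)
    case (elim e)
    have "\<bar>G e\<bar> * \<bar>U e\<bar> \<le> M * (M * e)" using elim M0 by (intro mult_mono Gb Ub) auto
    then show ?case by (simp add: abs_mult mult.assoc)
  qed
  have l2: "((\<lambda>e. e * (G e)\<^sup>2) \<longlongrightarrow> 0) (at_right 0)"
  proof (rule Lim_null_comparison[OF _ id0(3)], use ev in eventually_elim)
    case (elim e)
    have "\<bar>G e\<bar>\<^sup>2 \<le> M\<^sup>2" using elim by (intro power_mono Gb) auto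
    then show ?case using elim by (simp add: abs_mult)
  qed
  have l3: "((\<lambda>e. J e * (e * U e)) \<longlongrightarrow> 0) (at_right 0)"
  proof (rule Lim_null_comparison[OF _ id0(2)], use ev in eventually_elim)
    case (elim e)
    have "\<bar>J e * (e * U e)\<bar> = (sqrt e * \<bar>J e\<bar>) * (sqrt e * \<bar>U e\<bar>)"
    proof -
      have "e = sqrt e * sqrt e" using elim by simp
      then show ?thesis using elim by (simp add: abs_mult)
    qed
    also have "\<dots> \<le> M * (sqrt e * (M * 1))"
    proof (intro mult_mono Jb)
      have "\<bar>U e\<bar> \<le> M * e" using elim by (intro Ub) auto
      also have "\<dots> \<le> M * 1" using elim M0 by (intro mult_left_mono) auto
      finally show "\<bar>U e\<bar> \<le> M * 1" .
    qed (use elim M0 in auto)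
    finally show ?case by (simp add: mult_ac)
  qed
  have "((\<lambda>e. (G 1)\<^sup>2 / 2 - G e * U e - e * (G e)\<^sup>2 / 2 + J e * (e * U e)) \<longlongrightarrow> (G 1)\<^sup>2 / 2 - 0 - 0 / 2 + 0) (at_right 0)"
    by (intro tendsto_intros l1 l2 l3) simp
  then have L: "((\<lambda>e. (G 1)\<^sup>2 / 2 - G e * U e - e * (G e)\<^sup>2 / 2 + J e * (e * U e)) \<longlongrightarrow> (G 1)\<^sup>2 / 2) (at_right 0)"
    by simp
  have R: "((\<lambda>e. - integral {e..1} (\<lambda>x. w x * (x * U x)) + 3 / 2 * integral {e..1} (\<lambda>x. (g x)\<^sup>2)) \<longlongrightarrow> (G 1)\<^sup>2 / 2) (at_right 0)"
    by (rule Lim_transform_eventually[OF L], rule eventually_mono[OF ev], rule main[symmetric]) auto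
  have "((\<lambda>e. - integral {e..1} (\<lambda>x. w x * (x * U x)) + 3 / 2 * integral {e..1} (\<lambda>x. (g x)\<^sup>2)) \<longlongrightarrow>
     - integral {0..1} (\<lambda>x. w x * (x * U x)) + 3 / 2 * integral {0..1} (\<lambda>x. (g x)\<^sup>2)) (at_right 0)"
    by (intro tendsto_intros tail_integral_tendsto iw' ig')
  from tendsto_unique[OF _ this R]
  have fin: "- integral {0..1} (\<lambda>x. w x * (x * U x)) + 3 / 2 * integral {0..1} (\<lambda>x. (g x)\<^sup>2) = (G 1)\<^sup>2 / 2"
    by simp
  show thesis
  proof (rule that[OF G])
    have "continuous_on {1/2..1} G" by (rule Gc) simp
    then have "(G \<longlongrightarrow> G 1) (at 1 within {1/2..1})" unfolding continuous_on_def by force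
    then show "(G \<longlongrightarrow> G 1) (at_left 1)" by (simp add: at_within_Icc_at_left)
    show "integrable unit_leb (\<lambda>x. w x * (x * prim g x))" using iw by (simp add: U_def)
    show "- (\<integral>x. w x * (x * prim g x) \<partial>unit_leb) = (G 1)\<^sup>2 / 2 - 3 / 2 * (\<integral>x. (g x)\<^sup>2 \<partial>unit_leb)"
      using fin unit_integral_eq[OF iw] unit_integral_eq[OF ig] by (simp add: U_def)
  qed
qed

subsection \<open>Degenerate coefficients and the Rellich inequality\<close>

lemma has_weak_deriv_cong_AE_right:
  assumes "has_weak_deriv k u w" "AE x in unit_leb. w x = w' x"
  shows "has_weak_deriv k u w'"
proof -
  have l: "locally_integrable w" "locally_integrable w'"
    using assms has_weak_deriv_locally_integrable locally_integrable_cong_AE by blast+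
  have "(\<integral>x. w x * \<phi> x \<partial>unit_leb) = (\<integral>x. w' x * \<phi> x \<partial>unit_leb)" if "test_fun \<phi>" for \<phi>
  proof (rule integral_cong_AE)
    show "AE x in unit_leb. w x * \<phi> x = w' x * \<phi> x"
      using assms(2) by eventually_elim simp
  qed (use locally_integrable_mult_test[OF l(1) that] locally_integrable_mult_test[OF l(2) that]
      in \<open>auto intro: borel_measurable_integrable\<close>)
  then show ?thesis using assms(1) l by (simp add: has_weak_deriv_def)
qed

text \<open>Different limits would force \<open>f\<close> and \<open>g\<close> to differ on a whole
  interval next to 1, which is not negligible. This justifies the definite description in
  \<open>trace_xx\<close>.\<close>

lemma left_limit_unique_AE:
  assumes ae: "AE x in unit_leb. f x = g x" and f: "(f \<longlongrightarrow> c) (at_left 1)" and g: "(g \<longlongrightarrow> d) (at_left 1)"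
  shows "c = (d::real)"
proof (rule ccontr)
  assume "c \<noteq> d"
  obtain N where N: "negligible N" "\<And>x. 0 < x \<Longrightarrow> x < 1 \<Longrightarrow> x \<notin> N \<Longrightarrow> f x = g x"
    using unit_AE_negligible[OF ae] by blast
  have "((\<lambda>x. f x - g x) \<longlongrightarrow> c - d) (at_left 1)" by (intro tendsto_diff f g)
  then have "\<forall>\<^sub>F x in at_left 1. f x - g x \<noteq> 0"
    using \<open>c \<noteq> d\<close> by (intro tendsto_imp_eventually_ne) auto
  then obtain b where b: "b < 1" "\<And>y. b < y \<Longrightarrow> y < 1 \<Longrightarrow> f y - g y \<noteq> 0"
    unfolding eventually_at_left_field by blast
  have "{max b 0<..<1} \<subseteq> N" using N(2) b(2) by fastforce
  then have "negligible {max b 0<..<1}" using N(1) negligible_subset by blast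
  moreover have "{max b 0<..<1} \<noteq> {}" using b(1) by simp
  ultimately show False using open_not_negligible[OF open_greaterThanLessThan] by blast
qed

lemma trace_xx_eq:
  assumes "has_weak_deriv 2 u w" "(w \<longlongrightarrow> c) (at_left 1)"
  shows "trace_xx u = c"
  unfolding trace_xx_def
proof (rule the_equality)
  show "\<exists>w. has_weak_deriv 2 u w \<and> (w \<longlongrightarrow> c) (at_left 1)" using assms by blast
  fix d assume "\<exists>w. has_weak_deriv 2 u w \<and> (w \<longlongrightarrow> d) (at_left 1)"
  then obtain w' where "has_weak_deriv 2 u w'" "(w' \<longlongrightarrow> d) (at_left 1)" by blast
  then show "d = c" using left_limit_unique_AE[OF weak_deriv_unique[OF _ assms(1)] _ assms(2)] by blast
qed

lemma trace_xx_cong_AE: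
  assumes "AE x in unit_leb. u x = u' x"
  shows "trace_xx u = trace_xx u'"
proof -
  have "AE x in unit_leb. u' x = u x" using assms by eventually_elim simp
  then have "has_weak_deriv 2 u w \<longleftrightarrow> has_weak_deriv 2 u' w" for w
    using assms has_weak_deriv_cong_AE by blast
  then show ?thesis by (simp add: trace_xx_def)
qed

text \<open>The weak and the strong case both satisfy the bound with constant 2 and are treated
  together through it. At 1 the derivative is one-sided.\<close>

locale degenerate_coefficient =
  fixes a a' :: "real \<Rightarrow> real"
  assumes a_deriv: "\<And>x. x \<in> {0<..1} \<Longrightarrow> (a has_real_derivative a' x) (at x within {0..1})"
    and a_pos: "\<And>x. x \<in> {0<..1} \<Longrightarrow> 0 < a x"
    and a_degenerate: "\<And>x. x \<in> {0<..1} \<Longrightarrow> x * \<bar>a' x\<bar> \<le> 2 * a x"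
begin

lemma a_1_pos: "0 < a 1"
  by (rule a_pos) simp

lemma a_continuous: "continuous_on {0<..1} a"
proof (rule DERIV_continuous_on)
  show "(a has_real_derivative a' x) (at x within {0<..1})" if "x \<in> {0<..1}" for x
    by (rule DERIV_subset[OF a_deriv[OF that]]) auto
qed

lemma a_measurable: "a \<in> borel_measurable unit_leb"
  by (rule continuous_measurable_unit[OF continuous_on_subset[OF a_continuous]]) auto

text \<open>The degeneracy bound says that \<open>a x / x\<^sup>2\<close> is nonincreasing.\<close>

lemma a_ge_quadratic:
  assumes "x \<in> {0<..1}"
  shows "a 1 * x\<^sup>2 \<le> a x"
proof -
  have "(\<lambda>y. a y / y\<^sup>2) 1 \<le> (\<lambda>y. a y / y\<^sup>2) x"
  proof (rule DERIV_nonpos_imp_decreasing_open[of x 1 "\<lambda>y. a y / y\<^sup>2"])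
    show "continuous_on {x..1} (\<lambda>y. a y / y\<^sup>2)"
      using assms by (intro continuous_intros continuous_on_subset[OF a_continuous]) auto
    fix y assume y: "x < y" "y < 1"
    then have y0: "0 < y" using assms by auto
    have "at y within {0..1} = at y" by (rule at_within_interior) (use y y0 in simp)
    then have d: "(a has_real_derivative a' y) (at y)" using a_deriv[of y] y y0 by simp
    have "((\<lambda>y. a y / y\<^sup>2) has_real_derivative (a' y * y\<^sup>2 - a y * (2 * y)) / (y\<^sup>2 * y\<^sup>2)) (at y)"
      using y0 by (auto intro!: derivative_eq_intros d)
    moreover have "(a' y * y\<^sup>2 - a y * (2 * y)) / (y\<^sup>2 * y\<^sup>2) \<le> 0"
    proof (rule divide_nonpos_nonneg)
      have "y * a' y \<le> y * \<bar>a' y\<bar>" using y0 by (intro mult_left_mono) auto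
      also have "\<dots> \<le> 2 * a y" using a_degenerate[of y] y y0 by simp
      finally have "y * (y * a' y) \<le> y * (2 * a y)" using y0 by (intro mult_left_mono) auto
      then show "a' y * y\<^sup>2 - a y * (2 * y) \<le> 0" by (simp add: power2_eq_square mult_ac)
    qed simp
    ultimately show "\<exists>D. ((\<lambda>y. a y / y\<^sup>2) has_real_derivative D) (at y) \<and> D \<le> 0" by blast
  qed (use assms in auto)
  then show ?thesis using assms by (simp add: field_simps)
qed

lemma ratio_bound:
  assumes "x \<in> {0<..1}"
  shows "x / sqrt (a x) \<le> 1 / sqrt (a 1)"
proof -
  have "sqrt (a 1 * x\<^sup>2) \<le> sqrt (a x)" by (rule real_sqrt_le_mono[OF a_ge_quadratic[OF assms]])
  then have "sqrt (a 1) * x \<le> sqrt (a x)" using assms by (simp add: real_sqrt_mult)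
  then show ?thesis using a_pos[OF assms] a_1_pos by (simp add: field_simps)
qed

text \<open>Division by \<open>sqrt a\<close> maps the weighted space isometrically into plain
  \<open>L2\<close>, so that \<open>sq_int\<close> and \<open>l2norm\<close> cover it.\<close>

abbreviation wt :: "(real \<Rightarrow> real) \<Rightarrow> real \<Rightarrow> real" where
  "wt v \<equiv> (\<lambda>x. v x / sqrt (a x))"

lemma wt_power2: "x \<in> {0<..<1} \<Longrightarrow> (wt v x)\<^sup>2 = (v x)\<^sup>2 / a x"
  using a_pos[of x] by (simp add: power_divide)

lemma wt_measurable:
  assumes [measurable]: "v \<in> borel_measurable unit_leb"
  shows "wt v \<in> borel_measurable unit_leb"
proof -
  note a_measurable [measurable]
  show ?thesis by measurable
qed

lemma L2_weighted_iff: "v \<in> L2_weighted a \<longleftrightarrow> sq_int unit_leb v \<and> sq_int unit_leb (wt v)"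
proof -
  have "integrable unit_leb (\<lambda>x. (v x)\<^sup>2 / a x) \<longleftrightarrow> integrable unit_leb (\<lambda>x. (wt v x)\<^sup>2)"
    by (rule Bochner_Integration.integrable_cong) (auto simp: wt_power2)
  then show ?thesis
    using wt_measurable by (auto simp: L2_weighted_def L2_iff_sq_int sq_int_def)
qed

lemma L2_weightedD: "v \<in> L2_weighted a \<Longrightarrow> sq_int unit_leb v" "v \<in> L2_weighted a \<Longrightarrow> sq_int unit_leb (wt v)"
  by (simp_all add: L2_weighted_iff)

lemma l2norm_wt: "(\<integral>x. (v x)\<^sup>2 / a x \<partial>unit_leb) = (l2norm unit_leb (wt v))\<^sup>2"
  unfolding l2norm_power2 by (rule Bochner_Integration.integral_cong) (auto simp: wt_power2)

lemma norm_H0_power2: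
  "(norm_H0 a p)\<^sup>2 = (l2norm unit_leb (weak_deriv 2 (fst p)))\<^sup>2 + (l2norm unit_leb (wt (snd p)))\<^sup>2"
  by (simp add: norm_H0_def l2norm_wt flip: l2norm_power2)

text \<open>The multiplier x u_x with half of the weight \<open>1 / a\<close> attached; the other
  half goes to the velocity. Its two factors \<open>x / sqrt (a x)\<close> and
  \<open>prim g x\<close> are both bounded.\<close>

definition mult_prim :: "(real \<Rightarrow> real) \<Rightarrow> real \<Rightarrow> real" where
  "mult_prim g = wt (\<lambda>x. x * prim g x)"

lemma mult_prim_bound:
  assumes "sq_int unit_leb g" "x \<in> {0<..<1}"
  shows "\<bar>mult_prim g x\<bar> \<le> l2norm unit_leb g / sqrt (a 1)"
proof -
  have "\<bar>mult_prim g x\<bar> = x / sqrt (a x) * \<bar>prim g x\<bar>"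
    using assms a_pos[of x] by (simp add: mult_prim_def abs_mult)
  also have "\<dots> \<le> 1 / sqrt (a 1) * l2norm unit_leb g"
    using assms a_1_pos by (intro mult_mono ratio_bound prim_le_l2norm) auto
  finally show ?thesis by simp
qed

lemma mult_prim_measurable: "sq_int unit_leb g \<Longrightarrow> mult_prim g \<in> borel_measurable unit_leb"
  unfolding mult_prim_def
  by (intro wt_measurable continuous_measurable_unit continuous_on_mult continuous_on_id
      continuous_on_subset[OF prim_continuous_on]) auto

lemma sq_int_mult_prim: "sq_int unit_leb g \<Longrightarrow> sq_int unit_leb (mult_prim g)"
  by (rule bounded_sq_int_unit[OF mult_prim_measurable mult_prim_bound])

lemma l2norm_mult_prim: "sq_int unit_leb g \<Longrightarrow> l2norm unit_leb (mult_prim g) \<le> l2norm unit_leb g / sqrt (a 1)"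
  using a_1_pos by (intro l2norm_unit_le_bound mult_prim_measurable mult_prim_bound) auto

lemma mult_prim_lincomb:
  assumes "sq_int unit_leb f" "sq_int unit_leb g" "x \<in> {0<..<1}"
  shows "mult_prim (\<lambda>x. c * f x + d * g x) x = c * mult_prim f x + d * mult_prim g x"
  using prim_lincomb[OF assms(1,2), of x c d] assms(3)
  by (simp add: mult_prim_def add_divide_distrib algebra_simps)

lemma mult_prim_cong_AE: "AE x in unit_leb. f x = g x \<Longrightarrow> x \<le> 1 \<Longrightarrow> mult_prim f x = mult_prim g x"
  using prim_cong_AE[of f g x] by (simp add: mult_prim_def)

text \<open>For \<open>v = prim (prim g)\<close> the derivative of \<open>x * v\<^sup>2 / a\<close>
  is \<open>(v\<^sup>2 + 2 * x * v * v') / a - x * v\<^sup>2 * a' / a\<^sup>2\<close>. The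
  degeneracy bound estimates the last term by \<open>2 * v\<^sup>2 / a\<close>, whence the factor 3,
  and the boundary value at 1 vanishes.\<close>

lemma velocity_multiplier:
  assumes g: "sq_int unit_leb g" and v1: "prim (prim g) 1 = 0"
    and sv: "sq_int unit_leb (wt (prim (prim g)))"
  shows "- 3 * (l2norm unit_leb (wt (prim (prim g))))\<^sup>2 \<le> 2 * (\<integral>x. wt (prim (prim g)) x * mult_prim g x \<partial>unit_leb)"
proof -
  define P v C where "P = prim g" and "v = prim P" and "C = l2norm unit_leb g"
  have v1': "v 1 = 0" using v1 by (simp add: v_def P_def)
  have P: "sq_int unit_leb P" unfolding P_def by (rule sq_int_prim[OF g])
  have Pc: "continuous_on {0..1} P" unfolding P_def by (rule prim_continuous_on[OF g])
  have Pb: "\<bar>P x\<bar> \<le> C" if "x \<in> {0<..1}" for x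
    unfolding P_def C_def using that by (intro prim_le_l2norm g) auto
  have vb: "\<bar>v x\<bar> \<le> C * x" if "x \<in> {0..1}" for x
    unfolding v_def by (rule AE_prim_AE_bound[OF _ Pb P that]) auto
  have C0: "0 \<le> C" by (simp add: C_def)
  have a1: "0 < a 1" by (rule a_1_pos)
  define F' where "F' x = ((v x)\<^sup>2 + 2 * x * v x * P x) / a x - x * (v x)\<^sup>2 * a' x / (a x)\<^sup>2" for x
  \<comment> \<open>A majorant of \<open>F'\<close> that is known to be integrable up to 0.\<close>
  define q where "q x = 3 * (wt v x)\<^sup>2 + 2 * (wt v x * mult_prim g x)" for x
  have q_eq: "q x = 3 * ((v x)\<^sup>2 / a x) + 2 * (v x * (x * P x) / a x)" if "x \<in> {0<..1}" for x
    using a_pos[OF that] by (simp add: q_def mult_prim_def P_def power_divide)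
  have i1: "integrable unit_leb (\<lambda>x. (wt v x)\<^sup>2)" "integrable unit_leb (\<lambda>x. wt v x * mult_prim g x)"
    using sv sq_int_mult_integrable[OF sv sq_int_mult_prim[OF g]]
    by (auto simp: v_def P_def intro: sq_int_integrable_sq)
  have iq: "integrable unit_leb q"
    unfolding q_def[abs_def] by (intro Bochner_Integration.integrable_add integrable_mult_right i1)
  then have iq': "q integrable_on {0..1}"
    unfolding unit_integrable_iff by (simp add: absolutely_integrable_on_def)
  have F'q: "F' x \<le> q x" if x: "x \<in> {0<..1}" for x
  proof -
    have ax: "0 < a x" by (rule a_pos[OF x])
    have "- (x * a' x) \<le> x * \<bar>a' x\<bar>" using x by (simp add: abs_if)
    then have "- (x * a' x) \<le> 2 * a x" using a_degenerate[OF x] by linarith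
    then have "(v x)\<^sup>2 / (a x)\<^sup>2 * (- (x * a' x)) \<le> (v x)\<^sup>2 / (a x)\<^sup>2 * (2 * a x)"
      by (rule mult_left_mono) simp
    also have "\<dots> = 2 * ((v x)\<^sup>2 / a x)" using ax by (simp add: power2_eq_square field_simps)
    finally have "- (x * (v x)\<^sup>2 * a' x / (a x)\<^sup>2) \<le> 2 * ((v x)\<^sup>2 / a x)" by (simp add: mult_ac)
    moreover have "((v x)\<^sup>2 + 2 * x * v x * P x) / a x = (v x)\<^sup>2 / a x + 2 * (v x * (x * P x) / a x)"
      by (simp add: add_divide_distrib mult_ac)
    moreover have "B - A \<le> 3 * X + 2 * Y" if "- A \<le> 2 * X" "B = X + 2 * Y" for A B X Y :: real
      using that by linarith
    ultimately show ?thesis unfolding F'_def q_eq[OF x] by blast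
  qed
  have low: "- (e * C\<^sup>2 / a 1) \<le> integral {e..1} q" if e: "0 < e" "e < 1" for e
  proof -
    have "((\<lambda>x. x * (v x)\<^sup>2 / a x) has_real_derivative F' x) (at x within {e..1})" if x: "x \<in> {e..1}" for x
    proof -
      have dv: "(v has_real_derivative P x) (at x within {e..1})"
        unfolding v_def by (rule DERIV_subset[OF prim_has_derivative[OF Pc]]) (use x e in auto)
      have da: "(a has_real_derivative a' x) (at x within {e..1})"
        by (rule DERIV_subset[OF a_deriv]) (use x e in auto)
      have ax: "a x \<noteq> 0" using a_pos[of x] x e by auto
      have "((\<lambda>x. x * (v x)\<^sup>2) has_real_derivative (v x)\<^sup>2 + 2 * x * v x * P x) (at x within {e..1})"
        by (auto intro!: derivative_eq_intros dv)
      from DERIV_divide[OF this da ax]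
      have "((\<lambda>x. x * (v x)\<^sup>2 / a x) has_real_derivative
          (((v x)\<^sup>2 + 2 * x * v x * P x) * a x - x * (v x)\<^sup>2 * a' x) / (a x * a x)) (at x within {e..1})" .
      moreover have "(((v x)\<^sup>2 + 2 * x * v x * P x) * a x - x * (v x)\<^sup>2 * a' x) / (a x * a x) = F' x"
        using ax by (simp add: F'_def diff_divide_distrib power2_eq_square)
      ultimately show ?thesis by simp
    qed
    then have hi: "(F' has_integral 1 * (v 1)\<^sup>2 / a 1 - e * (v e)\<^sup>2 / a e) {e..1}"
      by (intro has_integral_real_derivative[of e 1 "\<lambda>x. x * (v x)\<^sup>2 / a x"]) (use e in auto)
    have "integral {e..1} F' \<le> integral {e..1} q"
      by (rule integral_le) (use hi iq' e F'q in \<open>auto intro: integrable_subinterval_real[of q 0 1]\<close>)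
    then have "- (e * (v e)\<^sup>2 / a e) \<le> integral {e..1} q" using integral_unique[OF hi] v1' by simp
    \<comment> \<open>\<open>\<bar>v e\<bar>\<close> is at most \<open>C * e\<close> and
      \<open>a e\<close> at least \<open>a 1 * e\<^sup>2\<close>, so the boundary term at
      \<open>e\<close> decays like \<open>e\<close>.\<close>
    moreover have "e * (v e)\<^sup>2 / a e \<le> e * C\<^sup>2 / a 1"
    proof -
      have "\<bar>v e\<bar>\<^sup>2 \<le> (C * e)\<^sup>2" using e by (intro power_mono vb) auto
      then have "(v e)\<^sup>2 \<le> C\<^sup>2 * e\<^sup>2" by (simp add: power_mult_distrib)
      then have "(v e)\<^sup>2 * a 1 \<le> C\<^sup>2 * e\<^sup>2 * a 1" using a1 by (intro mult_right_mono) auto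
      also have "\<dots> = C\<^sup>2 * (a 1 * e\<^sup>2)" by simp
      also have "\<dots> \<le> C\<^sup>2 * a e" using e by (intro mult_left_mono a_ge_quadratic) auto
      finally have "(v e)\<^sup>2 / a e \<le> C\<^sup>2 / a 1" using a1 a_pos[of e] e by (simp add: field_simps)
      then have "e * ((v e)\<^sup>2 / a e) \<le> e * (C\<^sup>2 / a 1)" using e by (intro mult_left_mono) auto
      then show ?thesis by simp
    qed
    ultimately show ?thesis by linarith
  qed
  have "((\<lambda>e. - (e * C\<^sup>2 / a 1)) \<longlongrightarrow> - (0 * C\<^sup>2 / a 1)) (at_right 0)"
    using a1 by (intro tendsto_intros) auto
  then have L: "((\<lambda>e. - (e * C\<^sup>2 / a 1)) \<longlongrightarrow> 0) (at_right 0)" by simp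
  have "0 \<le> integral {0..1} q"
  proof (rule tendsto_le[OF trivial_limit_at_right_real tail_integral_tendsto[OF iq'] L])
    show "\<forall>\<^sub>F e in at_right 0. - (e * C\<^sup>2 / a 1) \<le> integral {e..1} q"
      by (rule eventually_mono[OF eventually_at_right_real[of 0 1]]) (use low in auto)
  qed
  then have "0 \<le> integral\<^sup>L unit_leb q" using unit_integral_eq[OF iq] by simp
  also have "\<dots> = 3 * (l2norm unit_leb (wt v))\<^sup>2 + 2 * (\<integral>x. wt v x * mult_prim g x \<partial>unit_leb)"
    unfolding q_def[abs_def] l2norm_power2
    by (subst Bochner_Integration.integral_add)
      (intro integrable_mult_right i1 | simp only: integral_mult_right_zero)+
  finally show ?thesis by (simp add: v_def P_def)
qed

text \<open>The form B of the overview. Written through \<open>weak_deriv 2\<close>, it is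
  independent of the representative of the position and bounded by the norm of
  \<open>H0 a\<close>.\<close>

definition multiplier_form :: "state \<Rightarrow> state \<Rightarrow> real" where
  "multiplier_form p q = (\<integral>x. wt (snd p) x * mult_prim (weak_deriv 2 (fst q)) x \<partial>unit_leb)"

lemma H2_weightedD:
  assumes "u \<in> H2_weighted a"
  shows "u \<in> L2_weighted a" "u \<in> Sobolev0 2" "u \<in> Sobolev 2" "sq_int unit_leb (weak_deriv 2 u)"
    "has_weak_deriv 2 u (weak_deriv 2 u)"
  using assms Sobolev0_Sobolev[of u 2] Sobolev_weak_deriv[of u 2 2] by (auto simp: H2_weighted_def)

text \<open>The fourth derivative is in \<open>L2\<close> with the factor \<open>sqrt (a x)\<close>,
  and \<open>x\<close> is at most \<open>sqrt (a x) / sqrt (a 1)\<close>. The second and fourth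
  derivatives are related by testing the former with \<open>(deriv ^^ 2) \<phi>\<close>.\<close>

lemma dom_A_structure:
  assumes u: "u \<in> dom_A a"
  shows "u \<in> H2_weighted a" "has_weak_deriv 4 u (weak_deriv 4 u)" "A_op a u \<in> L2_weighted a"
    "sq_int unit_leb (\<lambda>s. s * weak_deriv 4 u s)"
    "\<And>\<phi>. test_fun \<phi> \<Longrightarrow> (\<integral>x. weak_deriv 2 u x * (deriv ^^ 2) \<phi> x \<partial>unit_leb) = (\<integral>x. weak_deriv 4 u x * \<phi> x \<partial>unit_leb)"
proof -
  show H: "u \<in> H2_weighted a" and w: "has_weak_deriv 4 u (weak_deriv 4 u)" and A: "A_op a u \<in> L2_weighted a"
    using u by (auto simp: dom_A_def intro: has_weak_deriv_weak_deriv)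
  have wm: "weak_deriv 4 u \<in> borel_measurable unit_leb"
    by (rule locally_integrable_measurable[OF has_weak_deriv_locally_integrable(2)[OF w]])
  show "sq_int unit_leb (\<lambda>s. s * weak_deriv 4 u s)"
  proof (rule sq_int_bound[OF _ sq_int_cmult[OF L2_weightedD(2)[OF A], of "1 / sqrt (a 1)"]])
    show "(\<lambda>s. s * weak_deriv 4 u s) \<in> borel_measurable unit_leb"
      by (rule borel_measurable_times[OF continuous_measurable_unit[OF continuous_on_id] wm])
    fix x :: real assume x: "x \<in> {0<..<1}"
    have ax: "0 < a x" using a_pos x by auto
    have "wt (A_op a u) x = sqrt (a x) * weak_deriv 4 u x"
    proof -
      have "wt (A_op a u) x = a x / sqrt (a x) * weak_deriv 4 u x" by (simp add: A_op_def)
      then show ?thesis using real_div_sqrt[of "a x"] ax by simp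
    qed
    moreover have "x \<le> 1 / sqrt (a 1) * sqrt (a x)"
      using ratio_bound[of x] x ax a_1_pos by (simp add: field_simps)
    then have "x * \<bar>weak_deriv 4 u x\<bar> \<le> 1 / sqrt (a 1) * sqrt (a x) * \<bar>weak_deriv 4 u x\<bar>"
      by (rule mult_right_mono) simp
    ultimately show "\<bar>x * weak_deriv 4 u x\<bar> \<le> \<bar>1 / sqrt (a 1) * wt (A_op a u) x\<bar>"
      using x ax a_1_pos by (simp add: abs_mult)
  qed
  fix \<phi> assume \<phi>: "test_fun \<phi>"
  have "(\<integral>x. u x * (deriv ^^ 2) ((deriv ^^ 2) \<phi>) x \<partial>unit_leb) = (\<integral>x. weak_deriv 2 u x * (deriv ^^ 2) \<phi> x \<partial>unit_leb)"
    using has_weak_deriv_test[OF H2_weightedD(5)[OF H] test_fun_higher_deriv[OF \<phi>, of 2]] by simp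
  moreover have "(deriv ^^ 2) ((deriv ^^ 2) \<phi>) = (deriv ^^ 4) \<phi>"
    by (simp add: eval_nat_numeral)
  ultimately show "(\<integral>x. weak_deriv 2 u x * (deriv ^^ 2) \<phi> x \<partial>unit_leb) = (\<integral>x. weak_deriv 4 u x * \<phi> x \<partial>unit_leb)"
    using has_weak_deriv_test[OF w \<phi>] by simp
qed

text \<open>The first form is evaluated exactly and produces the trace, the second is bounded below;
  the two terms with factor 3 add up to the squared norm. The second claim records that the trace is
  a genuine limit and not an unspecified value of the definite description.\<close>

lemma rellich_inequality:
  assumes p: "p \<in> dom_wave_op a"
  shows "(trace_xx (fst p))\<^sup>2 \<le> 2 * (multiplier_form (wave_op a p) p + multiplier_form p (wave_op a p)) + 3 * (norm_H0 a p)\<^sup>2"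
    and "\<exists>w. has_weak_deriv 2 (fst p) w \<and> (w \<longlongrightarrow> trace_xx (fst p)) (at_left 1)"
proof -
  define u v where "u = fst p" and "v = snd p"
  have u: "u \<in> dom_A a" and v: "v \<in> H2_weighted a" using p by (auto simp: dom_wave_op_def u_def v_def)
  note uH = dom_A_structure(1)[OF u]
  define g w gv where "g = weak_deriv 2 u" and "w = weak_deriv 4 u" and "gv = weak_deriv 2 v"
  have g: "sq_int unit_leb g" unfolding g_def by (rule H2_weightedD(4)[OF uH])
  have gv: "sq_int unit_leb gv" unfolding gv_def by (rule H2_weightedD(4)[OF v])
  obtain G where G: "AE x in unit_leb. g x = G x" "(G \<longlongrightarrow> G 1) (at_left 1)"
    "integrable unit_leb (\<lambda>x. w x * (x * prim g x))"
    "- (\<integral>x. w x * (x * prim g x) \<partial>unit_leb) = (G 1)\<^sup>2 / 2 - 3 / 2 * (\<integral>x. (g x)\<^sup>2 \<partial>unit_leb)"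
  proof (rule multiplier_identity[OF g])
    show "prim g 1 = 0" unfolding g_def by (rule Sobolev0_representation(2)[OF H2_weightedD(2)[OF uH]])
    show "locally_integrable w" unfolding w_def
      by (rule has_weak_deriv_locally_integrable(2)[OF dom_A_structure(2)[OF u]])
    show "sq_int unit_leb (\<lambda>s. s * w s)" unfolding w_def by (rule dom_A_structure(4)[OF u])
    show "(\<integral>x. g x * (deriv ^^ 2) \<phi> x \<partial>unit_leb) = (\<integral>x. w x * \<phi> x \<partial>unit_leb)" if "test_fun \<phi>" for \<phi>
      unfolding g_def w_def by (rule dom_A_structure(5)[OF u that])
  qed blast
  have wG: "has_weak_deriv 2 u G"
    by (rule has_weak_deriv_cong_AE_right[OF H2_weightedD(5)[OF uH] G(1)[unfolded g_def]])
  have tr: "trace_xx u = G 1" by (rule trace_xx_eq[OF wG G(2)])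
  show "\<exists>w. has_weak_deriv 2 (fst p) w \<and> (w \<longlongrightarrow> trace_xx (fst p)) (at_left 1)"
    using wG G(2) tr unfolding u_def by auto
  have 1: "multiplier_form (wave_op a p) p = - (\<integral>x. w x * (x * prim g x) \<partial>unit_leb)"
  proof -
    have "multiplier_form (wave_op a p) p = (\<integral>x. - (w x * (x * prim g x)) \<partial>unit_leb)"
      unfolding multiplier_form_def
    proof (rule Bochner_Integration.integral_cong)
      fix x assume "x \<in> space unit_leb"
      then have "0 < a x" using a_pos by simp
      then show "wt (snd (wave_op a p)) x * mult_prim (weak_deriv 2 (fst p)) x = - (w x * (x * prim g x))"
        by (simp add: wave_op_def A_op_def mult_prim_def u_def g_def w_def field_simps)
    qed simp
    then show ?thesis by simp
  qed
  note vS = H2_weightedD(2)[OF v]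
  \<comment> \<open>The velocity is replaced by its continuous representative, for which the value
    at 1 has a meaning; form and norm do not notice.\<close>
  have vr: "AE x in unit_leb. v x = prim (prim gv) x" "prim (prim gv) 1 = 0"
    unfolding gv_def by (rule Sobolev0_representation(1)[OF vS], rule Sobolev0_representation(3)[OF vS])
  have ppm: "prim (prim gv) \<in> borel_measurable unit_leb"
    by (rule sq_int_measurable[OF sq_int_prim[OF sq_int_prim[OF gv]]])
  have wtv: "AE x in unit_leb. wt v x = wt (prim (prim gv)) x" using vr(1) by eventually_elim simp
  have sv: "sq_int unit_leb (wt v)" by (rule L2_weightedD(2)[OF H2_weightedD(1)[OF v]])
  have sv': "sq_int unit_leb (wt (prim (prim gv)))"
    by (rule sq_int_cong_AE[OF sv wt_measurable[OF ppm] wtv])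
  have n2: "l2norm unit_leb (wt (prim (prim gv))) = l2norm unit_leb (wt v)"
    by (rule l2norm_cong_AE[symmetric, OF sq_int_measurable[OF sv] sq_int_measurable[OF sv'] wtv])
  have "multiplier_form p (wave_op a p) = (\<integral>x. wt v x * mult_prim gv x \<partial>unit_leb)"
    by (simp add: multiplier_form_def wave_op_def v_def gv_def)
  also have "\<dots> = (\<integral>x. wt (prim (prim gv)) x * mult_prim gv x \<partial>unit_leb)"
  proof (rule integral_cong_AE)
    show "AE x in unit_leb. wt v x * mult_prim gv x = wt (prim (prim gv)) x * mult_prim gv x"
      by (rule eventually_mono[OF wtv]) (simp only:)
  qed (intro borel_measurable_times sq_int_measurable[OF sv] sq_int_measurable[OF sv'] mult_prim_measurable gv)+
  finally have 2: "- 3 * (l2norm unit_leb (wt v))\<^sup>2 \<le> 2 * multiplier_form p (wave_op a p)"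
    using velocity_multiplier[OF gv vr(2) sv'] n2 by simp
  have 3: "(norm_H0 a p)\<^sup>2 = (\<integral>x. (g x)\<^sup>2 \<partial>unit_leb) + (l2norm unit_leb (wt v))\<^sup>2"
    unfolding norm_H0_power2 by (simp add: l2norm_power2 g_def u_def v_def)
  show "(trace_xx (fst p))\<^sup>2 \<le> 2 * (multiplier_form (wave_op a p) p + multiplier_form p (wave_op a p)) + 3 * (norm_H0 a p)\<^sup>2"
    using 1 2 3 G(4) tr unfolding u_def by (simp add: algebra_simps)
qed

end

subsection \<open>The state space and the semigroup\<close>

lemma integral_lincomb:
  fixes f g :: "'a \<Rightarrow> real"
  assumes "integrable M f" "integrable M g"
  shows "(\<integral>x. c * f x + d * g x \<partial>M) = c * (\<integral>x. f x \<partial>M) + d * (\<integral>x. g x \<partial>M)"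
  using assms by simp

context degenerate_coefficient
begin

section \<open>Norm, distance and almost everywhere equality of states\<close>

lemma H0_iff: "p \<in> H0 a \<longleftrightarrow> fst p \<in> H2_weighted a \<and> snd p \<in> L2_weighted a"
  by (cases p) (simp add: H0_def)

lemma L2_weighted_lincomb:
  assumes "u \<in> L2_weighted a" "v \<in> L2_weighted a"
  shows "(\<lambda>x. c * u x + d * v x) \<in> L2_weighted a"
proof -
  have "wt (\<lambda>x. c * u x + d * v x) = (\<lambda>x. c * wt u x + d * wt v x)"
    by (auto simp: add_divide_distrib)
  then show ?thesis
    using sq_int_lincomb[OF L2_weightedD(1)[OF assms(1)] L2_weightedD(1)[OF assms(2)], of c d]
      sq_int_lincomb[OF L2_weightedD(2)[OF assms(1)] L2_weightedD(2)[OF assms(2)], of c d]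
    by (simp add: L2_weighted_iff)
qed

lemma L2_weighted_cong_AE:
  assumes "u \<in> L2_weighted a" "v \<in> borel_measurable unit_leb" "AE x in unit_leb. u x = v x"
  shows "v \<in> L2_weighted a"
proof -
  have "AE x in unit_leb. wt u x = wt v x" using assms(3) by eventually_elim simp
  then show ?thesis
    using assms sq_int_cong_AE wt_measurable unfolding L2_weighted_iff by blast
qed

lemma H2_weighted_lincomb:
  "u \<in> H2_weighted a \<Longrightarrow> v \<in> H2_weighted a \<Longrightarrow> (\<lambda>x. c * u x + d * v x) \<in> H2_weighted a"
  unfolding H2_weighted_def using L2_weighted_lincomb Sobolev0_lincomb by blast

lemma lincomb_simps [simp]:
  "fst (lincomb c p d q) = (\<lambda>x. c * fst p x + d * fst q x)"
  "snd (lincomb c p d q) = (\<lambda>x. c * snd p x + d * snd q x)"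
  by (simp_all add: lincomb_def)

lemma H0_lincomb: "p \<in> H0 a \<Longrightarrow> q \<in> H0 a \<Longrightarrow> lincomb c p d q \<in> H0 a"
  by (simp add: H0_iff H2_weighted_lincomb L2_weighted_lincomb)

lemma H0_sq_int:
  assumes "p \<in> H0 a"
  shows "sq_int unit_leb (weak_deriv 2 (fst p))" "sq_int unit_leb (wt (snd p))" "sq_int unit_leb (snd p)" "fst p \<in> Sobolev 2"
  using assms H2_weightedD L2_weightedD by (auto simp: H0_iff)

lemma weak_deriv_lincomb_state:
  assumes "p \<in> H0 a" "q \<in> H0 a"
  shows "AE x in unit_leb. weak_deriv 2 (fst (lincomb c p d q)) x = c * weak_deriv 2 (fst p) x + d * weak_deriv 2 (fst q) x"
  unfolding lincomb_simps by (rule weak_deriv_lincomb_AE[OF H0_sq_int(4)[OF assms(1)] H0_sq_int(4)[OF assms(2)]]) simp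

lemma norm_H0_alt: "norm_H0 a p = sqrt ((l2norm unit_leb (weak_deriv 2 (fst p)))\<^sup>2 + (l2norm unit_leb (wt (snd p)))\<^sup>2)"
  unfolding norm_H0_def l2norm_wt by (simp add: l2norm_power2)

lemma norm_H0_nonneg: "0 \<le> norm_H0 a p"
  by (simp add: norm_H0_alt)

lemma l2norm_le_norm_H0:
  "l2norm unit_leb (weak_deriv 2 (fst p)) \<le> norm_H0 a p" "l2norm unit_leb (wt (snd p)) \<le> norm_H0 a p"
  by (simp_all add: norm_H0_alt real_le_rsqrt)

text \<open>Minkowski in each component, combined by the triangle inequality in the plane.\<close>

lemma norm_H0_lincomb:
  assumes "p \<in> H0 a" "q \<in> H0 a"
  shows "norm_H0 a (lincomb c p d q) \<le> \<bar>c\<bar> * norm_H0 a p + \<bar>d\<bar> * norm_H0 a q"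
proof -
  let ?A = "\<lambda>p. l2norm unit_leb (weak_deriv 2 (fst p))" and ?B = "\<lambda>p. l2norm unit_leb (wt (snd p))"
  note sp = H0_sq_int[OF assms(1)] and sq = H0_sq_int[OF assms(2)]
  have tri: "l2norm unit_leb (\<lambda>x. c * f x + d * g x) \<le> \<bar>c\<bar> * l2norm unit_leb f + \<bar>d\<bar> * l2norm unit_leb g"
    if "sq_int unit_leb f" "sq_int unit_leb g" for f g
    using l2norm_triangle[OF sq_int_cmult[OF that(1), of c] sq_int_cmult[OF that(2), of d]] by (simp add: l2norm_scale)
  have "?A (lincomb c p d q) = l2norm unit_leb (\<lambda>x. c * weak_deriv 2 (fst p) x + d * weak_deriv 2 (fst q) x)"
    by (rule l2norm_cong_AE[OF sq_int_measurable[OF H0_sq_int(1)[OF H0_lincomb[OF assms]]]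
        sq_int_measurable[OF sq_int_lincomb[OF sp(1) sq(1)]] weak_deriv_lincomb_state[OF assms]])
  then have A: "?A (lincomb c p d q) \<le> \<bar>c\<bar> * ?A p + \<bar>d\<bar> * ?A q"
    using tri[OF sp(1) sq(1)] by simp
  have "wt (snd (lincomb c p d q)) = (\<lambda>x. c * wt (snd p) x + d * wt (snd q) x)"
    by (auto simp: add_divide_distrib)
  then have B: "?B (lincomb c p d q) \<le> \<bar>c\<bar> * ?B p + \<bar>d\<bar> * ?B q"
    using tri[OF sp(2) sq(2)] by simp
  have "norm_H0 a (lincomb c p d q) \<le> sqrt ((\<bar>c\<bar> * ?A p + \<bar>d\<bar> * ?A q)\<^sup>2 + (\<bar>c\<bar> * ?B p + \<bar>d\<bar> * ?B q)\<^sup>2)"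
    unfolding norm_H0_alt using A B by (intro real_sqrt_le_mono add_mono power_mono) auto
  also have "\<dots> \<le> sqrt ((\<bar>c\<bar> * ?A p)\<^sup>2 + (\<bar>c\<bar> * ?B p)\<^sup>2) + sqrt ((\<bar>d\<bar> * ?A q)\<^sup>2 + (\<bar>d\<bar> * ?B q)\<^sup>2)"
    by (rule real_sqrt_sum_squares_triangle_ineq)
  also have "\<dots> = \<bar>c\<bar> * norm_H0 a p + \<bar>d\<bar> * norm_H0 a q"
    unfolding norm_H0_alt by (simp add: power_mult_distrib real_sqrt_mult flip: distrib_left)
  finally show ?thesis .
qed

lemma state_eqD:
  assumes "state_eq p q"
  shows "AE x in unit_leb. fst p x = fst q x" "AE x in unit_leb. snd p x = snd q x"
  using assms unfolding state_eq_def by (auto elim: eventually_mono)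

lemma state_eq_refl: "state_eq p p"
  by (simp add: state_eq_def)

lemma state_eq_sym: "state_eq p q \<Longrightarrow> state_eq q p"
  unfolding state_eq_def by (auto elim: eventually_mono)

lemma state_eq_trans:
  assumes "state_eq p q" "state_eq q r" shows "state_eq p r"
  using assms unfolding state_eq_def by eventually_elim simp

lemma state_eq_lincomb:
  assumes "state_eq p p'" "state_eq q q'"
  shows "state_eq (lincomb c p d q) (lincomb c p' d q')"
  using assms unfolding state_eq_def by eventually_elim simp

lemma wt_cong_AE:
  assumes "state_eq p q" shows "AE x in unit_leb. wt (snd p) x = wt (snd q) x"
  using state_eqD(2)[OF assms] by eventually_elim simp

lemma norm_H0_cong:
  assumes "state_eq p q" "p \<in> H0 a" "q \<in> H0 a"
  shows "norm_H0 a p = norm_H0 a q"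
proof -
  have "weak_deriv 2 (fst p) = weak_deriv 2 (fst q)" by (rule weak_deriv_cong_AE[OF state_eqD(1)[OF assms(1)]])
  moreover have "l2norm unit_leb (wt (snd p)) = l2norm unit_leb (wt (snd q))"
    by (rule l2norm_cong_AE[OF sq_int_measurable sq_int_measurable wt_cong_AE])
      (use assms H0_sq_int in auto)
  ultimately show ?thesis by (simp add: norm_H0_alt)
qed

lemma dist_H0_cong:
  assumes "state_eq p p'" "state_eq q q'" "p \<in> H0 a" "q \<in> H0 a" "p' \<in> H0 a" "q' \<in> H0 a"
  shows "dist_H0 a p q = dist_H0 a p' q'"
  unfolding dist_H0_def by (intro norm_H0_cong state_eq_lincomb H0_lincomb assms)

lemma dist_H0_nonneg: "0 \<le> dist_H0 a p q"
  by (simp add: dist_H0_def norm_H0_nonneg)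

lemma dist_H0_triangle:
  assumes "p \<in> H0 a" "q \<in> H0 a" "r \<in> H0 a"
  shows "dist_H0 a p r \<le> dist_H0 a p q + dist_H0 a q r"
proof -
  have "lincomb 1 p (-1) r = lincomb 1 (lincomb 1 p (-1) q) 1 (lincomb 1 q (-1) r)"
    by (auto simp: lincomb_def)
  then show ?thesis
    using norm_H0_lincomb[OF H0_lincomb[OF assms(1,2), of 1 "-1"] H0_lincomb[OF assms(2,3), of 1 "-1"], of 1 1]
    by (simp add: dist_H0_def)
qed

lemma dist_H0_commute:
  assumes "p \<in> H0 a" "q \<in> H0 a"
  shows "dist_H0 a p q = dist_H0 a q p"
proof -
  have le: "dist_H0 a p q \<le> dist_H0 a q p" if "p \<in> H0 a" "q \<in> H0 a" for p q
  proof -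
    have "lincomb 1 p (-1) q = lincomb (-1) (lincomb 1 q (-1) p) 0 p" by (auto simp: lincomb_def)
    then show ?thesis
      using norm_H0_lincomb[OF H0_lincomb[OF that(2,1), of 1 "-1"] that(1), of "-1" 0]
      by (simp add: dist_H0_def)
  qed
  show ?thesis using le[OF assms] le[OF assms(2,1)] by simp
qed

lemma norm_H0_le_dist:
  assumes "p \<in> H0 a" "q \<in> H0 a"
  shows "norm_H0 a p \<le> norm_H0 a q + dist_H0 a p q"
proof -
  have "p = lincomb 1 q 1 (lincomb 1 p (-1) q)" by (cases p) (auto simp: lincomb_def)
  then have "norm_H0 a p = norm_H0 a (lincomb 1 q 1 (lincomb 1 p (-1) q))" by simp
  also have "\<dots> \<le> \<bar>1\<bar> * norm_H0 a q + \<bar>1\<bar> * norm_H0 a (lincomb 1 p (-1) q)"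
    by (rule norm_H0_lincomb[OF assms(2) H0_lincomb[OF assms]])
  finally show ?thesis by (simp add: dist_H0_def)
qed

section \<open>Bilinearity and continuity of the multiplier form\<close>

lemma multiplier_form_lincomb_left:
  assumes "p \<in> H0 a" "q \<in> H0 a" "r \<in> H0 a"
  shows "multiplier_form (lincomb c p d q) r = c * multiplier_form p r + d * multiplier_form q r"
proof -
  note m = sq_int_mult_prim[OF H0_sq_int(1)[OF assms(3)]]
  have "(\<lambda>x. wt (snd (lincomb c p d q)) x * mult_prim (weak_deriv 2 (fst r)) x)
     = (\<lambda>x. c * (wt (snd p) x * mult_prim (weak_deriv 2 (fst r)) x) + d * (wt (snd q) x * mult_prim (weak_deriv 2 (fst r)) x))"
    by (auto simp: add_divide_distrib algebra_simps)
  then show ?thesis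
    unfolding multiplier_form_def
    by (simp only: integral_lincomb[OF sq_int_mult_integrable[OF H0_sq_int(2)[OF assms(1)] m]
          sq_int_mult_integrable[OF H0_sq_int(2)[OF assms(2)] m]])
qed

lemma multiplier_form_lincomb_right:
  assumes "p \<in> H0 a" "q \<in> H0 a" "r \<in> H0 a"
  shows "multiplier_form r (lincomb c p d q) = c * multiplier_form r p + d * multiplier_form r q"
proof -
  note v = H0_sq_int(2)[OF assms(3)]
  let ?m = "\<lambda>p. mult_prim (weak_deriv 2 (fst p))"
  have "multiplier_form r (lincomb c p d q) = (\<integral>x. c * (wt (snd r) x * ?m p x) + d * (wt (snd r) x * ?m q x) \<partial>unit_leb)"
    unfolding multiplier_form_def
  proof (rule Bochner_Integration.integral_cong)
    fix x assume "x \<in> space unit_leb"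
    then have x: "x \<in> {0<..<1}" by simp
    \<comment> \<open>\<open>weak_deriv\<close> is linear only almost everywhere; since
      \<open>mult_prim\<close> does not see null sets, the equality holds at every
      \<open>x\<close>.\<close>
    have "?m (lincomb c p d q) x = mult_prim (\<lambda>x. c * weak_deriv 2 (fst p) x + d * weak_deriv 2 (fst q) x) x"
      by (rule mult_prim_cong_AE[OF weak_deriv_lincomb_state[OF assms(1,2)]]) (use x in simp)
    also have "\<dots> = c * ?m p x + d * ?m q x"
      by (rule mult_prim_lincomb[OF H0_sq_int(1)[OF assms(1)] H0_sq_int(1)[OF assms(2)] x])
    finally show "wt (snd r) x * ?m (lincomb c p d q) x = c * (wt (snd r) x * ?m p x) + d * (wt (snd r) x * ?m q x)"
      by (simp add: algebra_simps)
  qed simp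
  then show ?thesis
    by (simp only: multiplier_form_def integral_lincomb[OF
          sq_int_mult_integrable[OF v sq_int_mult_prim[OF H0_sq_int(1)[OF assms(1)]]]
          sq_int_mult_integrable[OF v sq_int_mult_prim[OF H0_sq_int(1)[OF assms(2)]]]])
qed

lemma multiplier_form_cong:
  assumes "state_eq p p'" "state_eq q q'" "p \<in> H0 a" "q \<in> H0 a" "p' \<in> H0 a"
  shows "multiplier_form p q = multiplier_form p' q'"
proof -
  have q: "weak_deriv 2 (fst q) = weak_deriv 2 (fst q')" by (rule weak_deriv_cong_AE[OF state_eqD(1)[OF assms(2)]])
  note m = sq_int_measurable[OF sq_int_mult_prim[OF H0_sq_int(1)[OF assms(4)]]]
  show ?thesis
    unfolding multiplier_form_def q[symmetric]
  proof (rule integral_cong_AE)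
    show "AE x in unit_leb. wt (snd p) x * mult_prim (weak_deriv 2 (fst q)) x = wt (snd p') x * mult_prim (weak_deriv 2 (fst q)) x"
      by (rule eventually_mono[OF wt_cong_AE[OF assms(1)]]) (simp only:)
  qed (intro borel_measurable_times m sq_int_measurable[OF H0_sq_int(2)] assms)+
qed

lemma multiplier_form_bound2:
  assumes "p \<in> H0 a" "q \<in> H0 a"
  shows "\<bar>multiplier_form p q\<bar> \<le> l2norm unit_leb (wt (snd p)) * (l2norm unit_leb (weak_deriv 2 (fst q)) / sqrt (a 1))"
proof -
  have "\<bar>multiplier_form p q\<bar> \<le> l2norm unit_leb (wt (snd p)) * l2norm unit_leb (mult_prim (weak_deriv 2 (fst q)))"
    unfolding multiplier_form_def
    by (rule sq_int_Cauchy_Schwarz[OF H0_sq_int(2)[OF assms(1)] sq_int_mult_prim[OF H0_sq_int(1)[OF assms(2)]]])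
  also have "\<dots> \<le> l2norm unit_leb (wt (snd p)) * (l2norm unit_leb (weak_deriv 2 (fst q)) / sqrt (a 1))"
    by (intro mult_left_mono l2norm_mult_prim H0_sq_int(1) assms) simp
  finally show ?thesis .
qed

lemma multiplier_form_bound:
  assumes "p \<in> H0 a" "q \<in> H0 a"
  shows "\<bar>multiplier_form p q\<bar> \<le> (1 / sqrt (a 1)) * (norm_H0 a p * norm_H0 a q)"
proof -
  have "l2norm unit_leb (wt (snd p)) * (l2norm unit_leb (weak_deriv 2 (fst q)) / sqrt (a 1))
     \<le> norm_H0 a p * (norm_H0 a q / sqrt (a 1))"
    using a_1_pos by (intro mult_mono divide_right_mono l2norm_le_norm_H0 norm_H0_nonneg) auto
  then show ?thesis using multiplier_form_bound2[OF assms] by simp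
qed

text \<open>Young's inequality with the factor \<open>1 / sqrt (a 1)\<close> kept on the position
  part; the coefficients are then \<open>1 / a 1\<close> and 1, which is the origin of the maximum
  in the final constant.\<close>

lemma multiplier_form_diag_bound:
  assumes "p \<in> H0 a"
  shows "2 * \<bar>multiplier_form p p\<bar> \<le> max (1 / a 1) 1 * (norm_H0 a p)\<^sup>2"
proof -
  let ?G = "l2norm unit_leb (weak_deriv 2 (fst p))" and ?V = "l2norm unit_leb (wt (snd p))"
  let ?m = "max (1 / a 1) 1"
  have "2 * \<bar>multiplier_form p p\<bar> \<le> 2 * ?V * (?G / sqrt (a 1))"
    using multiplier_form_bound2[OF assms assms] by simp
  also have "\<dots> \<le> ?V\<^sup>2 + (?G / sqrt (a 1))\<^sup>2"
    by (rule sum_squares_bound)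
  also have "\<dots> = 1 * ?V\<^sup>2 + 1 / a 1 * ?G\<^sup>2" using a_1_pos by (simp add: power_divide)
  also have "\<dots> \<le> ?m * ?V\<^sup>2 + ?m * ?G\<^sup>2"
    by (intro add_mono mult_right_mono) auto
  also have "\<dots> = ?m * (norm_H0 a p)\<^sup>2" unfolding norm_H0_power2 by (simp add: distrib_left)
  finally show ?thesis .
qed

text \<open>Joint continuity of a bounded bilinear form; the norm of the moving factor
  \<open>Y s\<close> is estimated by that of its limit plus a distance.\<close>

lemma multiplier_form_tendsto:
  assumes X: "\<forall>\<^sub>F s in F. X s \<in> H0 a" "x \<in> H0 a" "((\<lambda>s. dist_H0 a (X s) x) \<longlongrightarrow> 0) F"
    and Y: "\<forall>\<^sub>F s in F. Y s \<in> H0 a" "y \<in> H0 a" "((\<lambda>s. dist_H0 a (Y s) y) \<longlongrightarrow> 0) F"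
  shows "((\<lambda>s. multiplier_form (X s) (Y s)) \<longlongrightarrow> multiplier_form x y) F"
proof -
  let ?C = "1 / sqrt (a 1)"
  have C: "0 \<le> ?C" using a_1_pos by simp
  have "((\<lambda>s. ?C * (dist_H0 a (X s) x * (norm_H0 a y + dist_H0 a (Y s) y)) + ?C * (norm_H0 a x * dist_H0 a (Y s) y))
      \<longlongrightarrow> ?C * (0 * (norm_H0 a y + 0)) + ?C * (norm_H0 a x * 0)) F"
    by (intro tendsto_intros X(3) Y(3))
  then have lim: "((\<lambda>s. ?C * (dist_H0 a (X s) x * (norm_H0 a y + dist_H0 a (Y s) y)) + ?C * (norm_H0 a x * dist_H0 a (Y s) y)) \<longlongrightarrow> 0) F"
    by simp
  have "((\<lambda>s. multiplier_form (X s) (Y s) - multiplier_form x y) \<longlongrightarrow> 0) F"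
  proof (rule Lim_null_comparison[OF _ lim], rule eventually_elim2[OF X(1) Y(1)])
    fix s assume Xs: "X s \<in> H0 a" and Ys: "Y s \<in> H0 a"
    have "multiplier_form (X s) (Y s) - multiplier_form x y
       = multiplier_form (lincomb 1 (X s) (-1) x) (Y s) + multiplier_form x (lincomb 1 (Y s) (-1) y)"
      using multiplier_form_lincomb_left[OF Xs X(2) Ys, of 1 "-1"] multiplier_form_lincomb_right[OF Ys Y(2) X(2), of 1 "-1"]
      by simp
    also have "\<bar>\<dots>\<bar> \<le> ?C * (dist_H0 a (X s) x * norm_H0 a (Y s)) + ?C * (norm_H0 a x * dist_H0 a (Y s) y)"
      unfolding dist_H0_def
      by (intro order.trans[OF abs_triangle_ineq] add_mono multiplier_form_bound H0_lincomb Xs Ys X(2) Y(2))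
    also have "\<dots> \<le> ?C * (dist_H0 a (X s) x * (norm_H0 a y + dist_H0 a (Y s) y)) + ?C * (norm_H0 a x * dist_H0 a (Y s) y)"
      by (intro add_right_mono mult_left_mono C norm_H0_le_dist dist_H0_nonneg Xs Ys X(2) Y(2))
    finally show "norm (multiplier_form (X s) (Y s) - multiplier_form x y)
      \<le> ?C * (dist_H0 a (X s) x * (norm_H0 a y + dist_H0 a (Y s) y)) + ?C * (norm_H0 a x * dist_H0 a (Y s) y)" by simp
  qed
  then show ?thesis by (simp add: LIM_zero_iff)
qed

section \<open>Linearity of the generator and of the trace\<close>

lemma dom_H0: "p \<in> dom_wave_op a \<Longrightarrow> p \<in> H0 a"
  using dom_A_structure(1)[of "fst p"] H2_weightedD(1)[of "snd p"] by (auto simp: dom_wave_op_def H0_iff)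

lemma wave_op_H0:
  assumes "p \<in> dom_wave_op a" shows "wave_op a p \<in> H0 a"
proof -
  have A: "A_op a (fst p) \<in> L2_weighted a" and v: "snd p \<in> H2_weighted a"
    using assms dom_A_structure(3)[of "fst p"] by (auto simp: dom_wave_op_def)
  have "(\<lambda>x. - A_op a (fst p) x) \<in> L2_weighted a" using L2_weighted_lincomb[OF A A, of "-1" 0] by simp
  then show ?thesis using v by (simp add: H0_iff wave_op_def)
qed

lemma A_op_lincomb_AE:
  assumes "u \<in> dom_A a" "v \<in> dom_A a"
  shows "AE x in unit_leb. c * A_op a u x + d * A_op a v x = A_op a (\<lambda>x. c * u x + d * v x) x"
  using weak_deriv_AE[OF has_weak_deriv_lincomb[OF dom_A_structure(2)[OF assms(1)] dom_A_structure(2)[OF assms(2)]], of c d]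
  by eventually_elim (simp add: A_op_def algebra_simps)

lemma dom_A_lincomb:
  assumes "u \<in> dom_A a" "v \<in> dom_A a"
  shows "(\<lambda>x. c * u x + d * v x) \<in> dom_A a"
proof -
  note w = has_weak_deriv_lincomb[OF dom_A_structure(2)[OF assms(1)] dom_A_structure(2)[OF assms(2)], of c d]
  have "A_op a (\<lambda>x. c * u x + d * v x) \<in> borel_measurable unit_leb"
    unfolding A_op_def
    by (intro borel_measurable_times a_measurable
        locally_integrable_measurable[OF has_weak_deriv_locally_integrable(2)[OF has_weak_deriv_weak_deriv[OF w]]])
  then have "A_op a (\<lambda>x. c * u x + d * v x) \<in> L2_weighted a"
    by (rule L2_weighted_cong_AE[OF L2_weighted_lincomb[OF dom_A_structure(3)[OF assms(1)] dom_A_structure(3)[OF assms(2)]] _ A_op_lincomb_AE[OF assms]])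
  then show ?thesis
    using w H2_weighted_lincomb[OF dom_A_structure(1)[OF assms(1)] dom_A_structure(1)[OF assms(2)]]
    unfolding dom_A_def by blast
qed

lemma dom_wave_op_lincomb:
  "p \<in> dom_wave_op a \<Longrightarrow> q \<in> dom_wave_op a \<Longrightarrow> lincomb c p d q \<in> dom_wave_op a"
  unfolding dom_wave_op_def lincomb_def by (auto intro: dom_A_lincomb H2_weighted_lincomb)

lemma wave_op_lincomb:
  assumes "p \<in> dom_wave_op a" "q \<in> dom_wave_op a"
  shows "state_eq (wave_op a (lincomb c p d q)) (lincomb c (wave_op a p) d (wave_op a q))"
proof -
  have "fst p \<in> dom_A a" "fst q \<in> dom_A a" using assms by (auto simp: dom_wave_op_def)
  from A_op_lincomb_AE[OF this, of c d] show ?thesis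
    unfolding state_eq_def
    by (rule eventually_mono) (simp add: wave_op_def)
qed

text \<open>Both traces are left limits of representatives of the second derivative, and limits
  add.\<close>

lemma trace_lincomb:
  assumes "p \<in> dom_wave_op a" "q \<in> dom_wave_op a"
  shows "trace_xx (fst (lincomb c p d q)) = c * trace_xx (fst p) + d * trace_xx (fst q)"
proof -
  obtain w where w: "has_weak_deriv 2 (fst p) w" "(w \<longlongrightarrow> trace_xx (fst p)) (at_left 1)"
    using rellich_inequality(2)[OF assms(1)] by blast
  obtain z where z: "has_weak_deriv 2 (fst q) z" "(z \<longlongrightarrow> trace_xx (fst q)) (at_left 1)"
    using rellich_inequality(2)[OF assms(2)] by blast
  show ?thesis
    unfolding lincomb_simps
    by (rule trace_xx_eq[OF has_weak_deriv_lincomb[OF w(1) z(1)]]) (intro tendsto_intros w z)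
qed

section \<open>Density of the domain of the generator\<close>

lemma sq_int_continuous_test:
  assumes k: "continuous_on {0<..<1} k" and \<phi>: "test_fun \<phi>"
  shows "sq_int unit_leb (\<lambda>x. k x * \<phi> x)"
proof -
  obtain c d where cd: "0 < c" "c < d" "d < 1" "\<And>x. x \<notin> {c..d} \<Longrightarrow> \<phi> x = 0"
    using test_funE[OF \<phi>] by blast
  have "continuous_on {c..d} (\<lambda>x. k x * \<phi> x)"
    by (intro continuous_on_mult continuous_on_subset[OF k] test_fun_continuous_on \<phi>) (use cd in auto)
  then have "bounded ((\<lambda>x. k x * \<phi> x) ` {c..d})"
    by (intro compact_imp_bounded compact_continuous_image compact_Icc)
  then obtain M where M: "\<forall>x\<in>{c..d}. \<bar>k x * \<phi> x\<bar> \<le> M"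
    unfolding bounded_iff real_norm_def by blast
  have M0: "0 \<le> M" using M cd by (meson abs_ge_zero atLeastAtMost_iff less_imp_le order.trans order_refl)
  show ?thesis
  proof (rule bounded_sq_int_unit)
    show "(\<lambda>x. k x * \<phi> x) \<in> borel_measurable unit_leb"
      by (intro continuous_measurable_unit continuous_on_mult k test_fun_continuous_on \<phi>)
    show "\<bar>k x * \<phi> x\<bar> \<le> M" for x
      using M M0 cd(4)[of x] by (cases "x \<in> {c..d}") auto
  qed
qed

lemma test_fun_weighted:
  assumes "continuous_on {0<..<1} k" "test_fun \<phi>"
  shows "(\<lambda>x. k x * \<phi> x) \<in> L2_weighted a"
proof -
  have "continuous_on {0<..<1} (\<lambda>x. k x / sqrt (a x))"
    using a_pos by (intro continuous_intros assms continuous_on_subset[OF a_continuous]) force+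
  from sq_int_continuous_test[OF this assms(2)] sq_int_continuous_test[OF assms]
  show ?thesis unfolding L2_weighted_iff by (simp add: mult.commute)
qed

lemma test_fun_H2_weighted: "test_fun \<phi> \<Longrightarrow> \<phi> \<in> H2_weighted a"
  using test_fun_weighted[of "\<lambda>x. 1" \<phi>] test_fun_Sobolev0[of \<phi> 2] by (simp add: H2_weighted_def)

lemma test_fun_dom_A:
  assumes "test_fun \<phi>" shows "\<phi> \<in> dom_A a"
proof -
  have w: "has_weak_deriv 4 \<phi> ((deriv ^^ 4) \<phi>)" by (rule test_fun_has_weak_deriv[OF assms])
  have ac: "continuous_on {0<..<1} a" by (rule continuous_on_subset[OF a_continuous]) auto
  have "A_op a \<phi> \<in> L2_weighted a"
  proof (rule L2_weighted_cong_AE[OF test_fun_weighted[OF ac test_fun_higher_deriv[OF assms, of 4]]])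
    show "A_op a \<phi> \<in> borel_measurable unit_leb"
      unfolding A_op_def
      by (intro borel_measurable_times a_measurable
        locally_integrable_measurable[OF has_weak_deriv_locally_integrable(2)[OF has_weak_deriv_weak_deriv[OF w]]])
    show "AE x in unit_leb. a x * (deriv ^^ 4) \<phi> x = A_op a \<phi> x"
      using weak_deriv_AE[OF w] by eventually_elim (simp add: A_op_def)
  qed
  then show ?thesis unfolding dom_A_def using w test_fun_H2_weighted[OF assms] by blast
qed

text \<open>Pairs of test functions suffice. The norm reads the position through its second weak
  derivative, approximated by the definition of \<open>Sobolev0\<close>;
  \<open>weighted_test_dense\<close> handles the velocity.\<close>

lemma dom_wave_op_dense:
  assumes p: "p \<in> H0 a" and e: "0 < e"
  obtains q where "q \<in> dom_wave_op a" "dist_H0 a q p < e"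
proof -
  have u: "fst p \<in> Sobolev0 2" using p H2_weightedD(2) by (simp add: H0_iff)
  obtain \<phi> where \<phi>: "\<And>n::nat. test_fun (\<phi> n)"
     "\<And>k. k \<le> 2 \<Longrightarrow> (\<lambda>n. l2norm unit_leb (\<lambda>x. (deriv ^^ k) (\<phi> n) x - weak_deriv k (fst p) x)) \<longlonglongrightarrow> 0"
    using u unfolding Sobolev0_iff by blast
  have "\<forall>\<^sub>F n in sequentially. l2norm unit_leb (\<lambda>x. (deriv ^^ 2) (\<phi> n) x - weak_deriv 2 (fst p) x) < e / 2"
    by (rule order_tendstoD(2)[OF \<phi>(2)]) (use e in auto)
  then obtain n where n: "l2norm unit_leb (\<lambda>x. (deriv ^^ 2) (\<phi> n) x - weak_deriv 2 (fst p) x) < e / 2"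
    by (meson eventually_sequentially order_refl)
  obtain \<psi> where \<psi>: "test_fun \<psi>" "sq_int unit_leb (\<lambda>x. \<psi> x / sqrt (a x))"
    "l2norm unit_leb (\<lambda>x. \<psi> x / sqrt (a x) - snd p x / sqrt (a x)) < e / 2"
  proof (rule weighted_test_dense[of a "snd p" "e / 2"])
    show "continuous_on {0<..<1} a" by (rule continuous_on_subset[OF a_continuous]) auto
  qed (use a_pos H0_sq_int[OF p] e in \<open>auto intro: sq_int_measurable\<close>)
  define q where "q = (\<phi> n, \<psi>)"
  have q: "q \<in> dom_wave_op a"
    using test_fun_dom_A[OF \<phi>(1)] test_fun_H2_weighted[OF \<psi>(1)] by (simp add: q_def dom_wave_op_def)
  have qH: "q \<in> H0 a" by (rule dom_H0[OF q])
  let ?r = "lincomb 1 q (-1) p"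
  have rH: "?r \<in> H0 a" by (rule H0_lincomb[OF qH p])
  have 1: "l2norm unit_leb (weak_deriv 2 (fst ?r)) < e / 2"
  proof -
    have "AE x in unit_leb. weak_deriv 2 (fst ?r) x = (deriv ^^ 2) (\<phi> n) x - weak_deriv 2 (fst p) x"
      using weak_deriv_lincomb_state[OF qH p, of 1 "-1"] weak_deriv_AE[OF test_fun_has_weak_deriv[OF \<phi>(1), of 2 n]]
      by eventually_elim (simp add: q_def)
    then have "l2norm unit_leb (weak_deriv 2 (fst ?r)) = l2norm unit_leb (\<lambda>x. (deriv ^^ 2) (\<phi> n) x - weak_deriv 2 (fst p) x)"
      by (rule l2norm_cong_AE[OF sq_int_measurable[OF H0_sq_int(1)[OF rH]]
          sq_int_measurable[OF sq_int_diff[OF test_fun_sq_int[OF test_fun_higher_deriv[OF \<phi>(1)]] H0_sq_int(1)[OF p]]]])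
    then show ?thesis using n by simp
  qed
  have 2: "l2norm unit_leb (wt (snd ?r)) < e / 2"
    using \<psi>(3) by (simp add: q_def diff_divide_distrib)
  have "norm_H0 a ?r \<le> l2norm unit_leb (weak_deriv 2 (fst ?r)) + l2norm unit_leb (wt (snd ?r))"
    unfolding norm_H0_alt by (rule sqrt_sum_squares_le_sum) auto
  then have "dist_H0 a q p < e" unfolding dist_H0_def using 1 2 by linarith
  with q show thesis by (rule that)
qed

end

locale degenerate_semigroup = degenerate_coefficient +
  fixes S :: "real \<Rightarrow> state \<Rightarrow> state"
  assumes semigroup: "contraction_semigroup a S" and generator: "generated_by_wave_op a S"
begin

section \<open>Contractivity and time continuity of orbits\<close>

lemma S_H0: "0 \<le> t \<Longrightarrow> p \<in> H0 a \<Longrightarrow> S t p \<in> H0 a"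
  using semigroup by (simp add: contraction_semigroup_def)

lemma S_lincomb: "0 \<le> t \<Longrightarrow> p \<in> H0 a \<Longrightarrow> q \<in> H0 a \<Longrightarrow> state_eq (S t (lincomb c p d q)) (lincomb c (S t p) d (S t q))"
  using semigroup by (simp add: contraction_semigroup_def)

lemma S_norm: "0 \<le> t \<Longrightarrow> p \<in> H0 a \<Longrightarrow> norm_H0 a (S t p) \<le> norm_H0 a p"
  using semigroup by (simp add: contraction_semigroup_def)

lemma S_add: "0 \<le> s \<Longrightarrow> 0 \<le> t \<Longrightarrow> p \<in> H0 a \<Longrightarrow> state_eq (S (s + t) p) (S s (S t p))"
  using semigroup by (simp add: contraction_semigroup_def)

lemma S_continuous_0: "p \<in> H0 a \<Longrightarrow> ((\<lambda>t. dist_H0 a (S t p) p) \<longlongrightarrow> 0) (at_right 0)"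
  using semigroup by (simp add: contraction_semigroup_def)

lemma S_dist:
  assumes "0 \<le> t" "p \<in> H0 a" "q \<in> H0 a"
  shows "dist_H0 a (S t p) (S t q) \<le> dist_H0 a p q"
proof -
  have "dist_H0 a (S t p) (S t q) = norm_H0 a (S t (lincomb 1 p (-1) q))"
    unfolding dist_H0_def
    by (intro norm_H0_cong state_eq_sym[OF S_lincomb] H0_lincomb S_H0 assms)
  then show ?thesis unfolding dist_H0_def using S_norm[OF assms(1) H0_lincomb[OF assms(2,3)]] by simp
qed

text \<open>The semigroup law splits off the smaller time and contractivity discards it, so
  continuity at time 0 controls continuity everywhere.\<close>

lemma S_orbit_dist:
  assumes "0 \<le> s" "0 \<le> t" "p \<in> H0 a"
  shows "dist_H0 a (S s p) (S t p) \<le> dist_H0 a (S \<bar>s - t\<bar> p) p"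
proof -
  have le: "dist_H0 a (S s p) (S t p) \<le> dist_H0 a (S (s - t) p) p" if "0 \<le> t" "t \<le> s" for s t
  proof -
    have "state_eq (S s p) (S t (S (s - t) p))" using S_add[of t "s - t" p] that assms by simp
    then have "dist_H0 a (S s p) (S t p) = dist_H0 a (S t (S (s - t) p)) (S t p)"
      by (rule dist_H0_cong[OF _ state_eq_refl]) (use that assms in \<open>auto intro!: S_H0\<close>)
    also have "\<dots> \<le> dist_H0 a (S (s - t) p) p" by (rule S_dist) (use that assms in \<open>auto intro!: S_H0\<close>)
    finally show ?thesis .
  qed
  show ?thesis
  proof (cases "t \<le> s")
    case True
    then show ?thesis using le[of t s] assms by simp
  next
    case False
    have "dist_H0 a (S s p) (S t p) = dist_H0 a (S t p) (S s p)" by (intro dist_H0_commute S_H0 assms)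
    then show ?thesis using le[of s t] assms False by simp
  qed
qed

text \<open>Transfers right-hand limits at 0 to limits at \<open>t\<close> from both sides; the
  filter excludes \<open>t\<close> itself, so the absolute difference is positive.\<close>

lemma filterlim_abs_diff: "filterlim (\<lambda>s. \<bar>s - t\<bar>) (at_right 0) (at t within A)" for t :: real
proof -
  have "((\<lambda>s. \<bar>s - t\<bar>) \<longlongrightarrow> \<bar>t - t\<bar>) (at t within A)" by (intro tendsto_intros)
  then show ?thesis
    unfolding filterlim_at by (auto simp: eventually_at_filter)
qed

lemma S_orbit_tendsto:
  assumes "0 \<le> t" "p \<in> H0 a"
  shows "((\<lambda>s. dist_H0 a (S s p) (S t p)) \<longlongrightarrow> 0) (at t within {0..T})"
proof (rule Lim_null_comparison)
  show "((\<lambda>s. dist_H0 a (S \<bar>s - t\<bar> p) p) \<longlongrightarrow> 0) (at t within {0..T})"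
    by (rule filterlim_compose[OF S_continuous_0[OF assms(2)] filterlim_abs_diff])
  show "\<forall>\<^sub>F s in at t within {0..T}. norm (dist_H0 a (S s p) (S t p)) \<le> dist_H0 a (S \<bar>s - t\<bar> p) p"
    unfolding eventually_at_filter
    using S_orbit_dist[OF _ assms] by (auto simp: dist_H0_nonneg)
qed

section \<open>Differentiability of orbits with data in the domain\<close>

lemma generator_tendsto:
  assumes "p \<in> dom_wave_op a"
  shows "((\<lambda>h. dist_H0 a (lincomb (1 / h) (S h p) (- 1 / h) p) (wave_op a p)) \<longlongrightarrow> 0) (at_right 0)"
  using generator assms dom_H0[OF assms] wave_op_H0[OF assms] state_eq_refl
  unfolding generated_by_wave_op_def by blast

lemma S_difference_quotient:
  assumes "0 \<le> t" "0 < h" "p \<in> H0 a"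
  shows "state_eq (lincomb c (S (t + h) p) d (S t p)) (S t (lincomb c (S h p) d p))"
proof -
  have "state_eq (S (t + h) p) (S t (S h p))" using assms by (intro S_add) auto
  then have "state_eq (lincomb c (S (t + h) p) d (S t p)) (lincomb c (S t (S h p)) d (S t p))"
    by (rule state_eq_lincomb[OF _ state_eq_refl])
  moreover have "state_eq (S t (lincomb c (S h p) d p)) (lincomb c (S t (S h p)) d (S t p))"
    using assms by (intro S_lincomb S_H0) auto
  ultimately show ?thesis using state_eq_trans state_eq_sym by blast
qed

text \<open>\<open>S t\<close> commutes with difference quotients and does not increase distances,
  so the quotients at \<open>S t p\<close> converge to \<open>S t (wave_op a p)\<close>. The
  equivalence that characterises the generator, read from convergence to membership, gives both
  claims.\<close>

lemma S_dom:
  assumes t: "0 \<le> t" and p: "p \<in> dom_wave_op a"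
  shows "S t p \<in> dom_wave_op a" "state_eq (S t (wave_op a p)) (wave_op a (S t p))"
proof -
  note pH = dom_H0[OF p] and qH = wave_op_H0[OF p]
  have "((\<lambda>h. dist_H0 a (lincomb (1 / h) (S h (S t p)) (- 1 / h) (S t p)) (S t (wave_op a p))) \<longlongrightarrow> 0) (at_right 0)"
  proof (rule Lim_null_comparison[OF _ generator_tendsto[OF p]])
    show "\<forall>\<^sub>F h in at_right 0. norm (dist_H0 a (lincomb (1 / h) (S h (S t p)) (- 1 / h) (S t p)) (S t (wave_op a p)))
        \<le> dist_H0 a (lincomb (1 / h) (S h p) (- 1 / h) p) (wave_op a p)"
      using eventually_at_right_less[of 0]
    proof eventually_elim
      case (elim h)
      let ?l = "lincomb (1 / h) (S h p) (- 1 / h) p"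
      have lH: "?l \<in> H0 a" by (intro H0_lincomb S_H0 pH) (use elim in simp)
      have "state_eq (S h (S t p)) (S (t + h) p)"
        using S_add[of h t p] elim t pH state_eq_sym by (simp add: add.commute)
      then have "state_eq (lincomb (1 / h) (S h (S t p)) (- 1 / h) (S t p)) (lincomb (1 / h) (S (t + h) p) (- 1 / h) (S t p))"
        by (rule state_eq_lincomb[OF _ state_eq_refl])
      then have "state_eq (lincomb (1 / h) (S h (S t p)) (- 1 / h) (S t p)) (S t ?l)"
        using S_difference_quotient[OF t elim pH] state_eq_trans by blast
      then have "dist_H0 a (lincomb (1 / h) (S h (S t p)) (- 1 / h) (S t p)) (S t (wave_op a p)) = dist_H0 a (S t ?l) (S t (wave_op a p))"
        by (rule dist_H0_cong[OF _ state_eq_refl])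
          (use elim t pH qH lH in \<open>auto intro!: H0_lincomb S_H0\<close>)
      also have "\<dots> \<le> dist_H0 a ?l (wave_op a p)" by (rule S_dist[OF t lH qH])
      finally show ?case by (simp add: dist_H0_nonneg)
    qed
  qed
  then have "S t p \<in> dom_wave_op a \<and> state_eq (S t (wave_op a p)) (wave_op a (S t p))"
    using generator S_H0[OF t pH] S_H0[OF t qH] unfolding generated_by_wave_op_def by blast
  then show "S t p \<in> dom_wave_op a" "state_eq (S t (wave_op a p)) (wave_op a (S t p))" by auto
qed

text \<open>For \<open>s\<close> before \<open>t\<close> the quotient is a forward quotient
  transported by \<open>S s\<close>, whereas the target is transported by \<open>S t\<close>; the
  second summand pays for moving the target through the time \<open>h\<close>.\<close>

lemma S_quotient_dist:
  assumes s: "0 \<le> s" "0 \<le> t" "s \<noteq> t" and p: "p \<in> dom_wave_op a"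
  defines "h \<equiv> \<bar>s - t\<bar>"
  shows "dist_H0 a (lincomb (1 / (s - t)) (S s p) (- 1 / (s - t)) (S t p)) (S t (wave_op a p))
    \<le> dist_H0 a (lincomb (1 / h) (S h p) (- 1 / h) p) (wave_op a p) + dist_H0 a (S h (wave_op a p)) (wave_op a p)"
    (is "dist_H0 a ?Q _ \<le> dist_H0 a ?l ?q + _")
proof -
  note pH = dom_H0[OF p] and qH = wave_op_H0[OF p]
  have h: "0 < h" using s by (simp add: h_def)
  have lH: "?l \<in> H0 a" by (intro H0_lincomb S_H0 pH) (use h in simp)
  have QH: "?Q \<in> H0 a" by (intro H0_lincomb S_H0 pH s)
  show ?thesis
  proof (cases "t < s")
    case True
    then have hs: "s = t + h" "s - t = h" by (auto simp: h_def)
    have "state_eq ?Q (S t ?l)" unfolding hs(2) unfolding hs(1) by (rule S_difference_quotient[OF s(2) h pH])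
    then have "dist_H0 a ?Q (S t ?q) = dist_H0 a (S t ?l) (S t ?q)"
      by (rule dist_H0_cong[OF _ state_eq_refl QH]) (intro S_H0 s lH qH)+
    also have "\<dots> \<le> dist_H0 a ?l ?q" by (rule S_dist[OF s(2) lH qH])
    finally show ?thesis using dist_H0_nonneg[of "S h ?q" ?q] by linarith
  next
    case False
    then have hs: "t = s + h" "s - t = - h" using s by (auto simp: h_def)
    \<comment> \<open>Numerator and denominator change sign together.\<close>
    have "?Q = lincomb (1 / h) (S t p) (- 1 / h) (S s p)" unfolding hs(2) by (auto simp: lincomb_def)
    then have "state_eq ?Q (S s ?l)" unfolding hs(1) using S_difference_quotient[OF s(1) h pH, of "1 / h" "- 1 / h"] by simp
    moreover have "state_eq (S t ?q) (S s (S h ?q))" unfolding hs(1) using h s by (intro S_add qH) auto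
    ultimately have "dist_H0 a ?Q (S t ?q) = dist_H0 a (S s ?l) (S s (S h ?q))"
      by (rule dist_H0_cong[OF _ _ QH]) (use h s lH qH in \<open>auto intro!: S_H0\<close>)
    also have "\<dots> \<le> dist_H0 a ?l (S h ?q)" by (intro S_dist s lH S_H0 qH) (use h in simp)
    also have "\<dots> \<le> dist_H0 a ?l ?q + dist_H0 a ?q (S h ?q)"
      by (intro dist_H0_triangle lH qH S_H0) (use h in simp)
    also have "dist_H0 a ?q (S h ?q) = dist_H0 a (S h ?q) ?q"
      by (intro dist_H0_commute qH S_H0) (use h in simp)
    finally show ?thesis .
  qed
qed

lemma S_quotient_tendsto:
  assumes t: "0 \<le> t" and p: "p \<in> dom_wave_op a"
  shows "((\<lambda>s. dist_H0 a (lincomb (1 / (s - t)) (S s p) (- 1 / (s - t)) (S t p)) (S t (wave_op a p))) \<longlongrightarrow> 0) (at t within {0..T})"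
proof (rule Lim_null_comparison)
  let ?b = "\<lambda>h. dist_H0 a (lincomb (1 / h) (S h p) (- 1 / h) p) (wave_op a p) + dist_H0 a (S h (wave_op a p)) (wave_op a p)"
  have "(?b \<longlongrightarrow> 0) (at_right 0)"
    using tendsto_add[OF generator_tendsto[OF p] S_continuous_0[OF wave_op_H0[OF p]]] by simp
  then show "((\<lambda>s. ?b \<bar>s - t\<bar>) \<longlongrightarrow> 0) (at t within {0..T})"
    by (rule filterlim_compose[OF _ filterlim_abs_diff])
  show "\<forall>\<^sub>F s in at t within {0..T}. norm (dist_H0 a (lincomb (1 / (s - t)) (S s p) (- 1 / (s - t)) (S t p)) (S t (wave_op a p))) \<le> ?b \<bar>s - t\<bar>"
    unfolding eventually_at_filter
    using S_quotient_dist[OF _ t _ p] by (auto simp: dist_H0_nonneg intro!: always_eventually)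
qed

end

subsection \<open>The trace along an orbit\<close>

lemma continuous_sq_int_interval:
  fixes f :: "real \<Rightarrow> real"
  assumes "continuous_on {0..T} f"
  shows "sq_int (lebesgue_on {0<..<T}) f"
    and "(\<integral>t. (f t)\<^sup>2 \<partial>lebesgue_on {0<..<T}) = integral {0..T} (\<lambda>t. (f t)\<^sup>2)"
proof -
  have "(\<lambda>t. (f t)\<^sup>2) absolutely_integrable_on {0..T}"
    by (intro absolutely_integrable_continuous_real continuous_intros assms)
  then have "(\<lambda>t. (f t)\<^sup>2) absolutely_integrable_on {0<..<T}"
    by (simp add: absolutely_integrable_on_Icc_iff_Ioo)
  then have i: "integrable (lebesgue_on {0<..<T}) (\<lambda>t. (f t)\<^sup>2)"
    by (rule absolutely_integrable_imp_integrable) simp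
  moreover have "f \<in> borel_measurable (lebesgue_on {0<..<T})"
    by (intro continuous_imp_measurable_on_sets_lebesgue continuous_on_subset[OF assms]) auto
  ultimately show "sq_int (lebesgue_on {0<..<T}) f" by (simp add: sq_int_def)
  show "(\<integral>t. (f t)\<^sup>2 \<partial>lebesgue_on {0<..<T}) = integral {0..T} (\<lambda>t. (f t)\<^sup>2)"
    using lebesgue_integral_eq_integral[OF i] by (simp add: integral_open_interval_real)
qed

context degenerate_semigroup
begin

abbreviation rho :: "state \<Rightarrow> real \<Rightarrow> real" where
  "rho p t \<equiv> multiplier_form (S t p) (S t p)"

abbreviation rho_deriv :: "state \<Rightarrow> real \<Rightarrow> real" where
  "rho_deriv p t \<equiv> multiplier_form (S t (wave_op a p)) (S t p) + multiplier_form (S t p) (S t (wave_op a p))"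

lemma eventually_S_H0:
  assumes "p \<in> H0 a"
  shows "\<forall>\<^sub>F s in at t within {0..T}. S s p \<in> H0 a"
  unfolding eventually_at_filter using S_H0[OF _ assms] by (auto intro!: always_eventually)

lemma dist_H0_same: "p \<in> H0 a \<Longrightarrow> dist_H0 a p p = 0"
  using norm_H0_lincomb[of p p 0 0] norm_H0_nonneg[of "lincomb 0 p 0 p"]
  by (simp add: dist_H0_def lincomb_def)

text \<open>The product rule: the mixed value at \<open>S t p\<close> and \<open>S s p\<close> is
  inserted into the increment, so that each part contains a single difference quotient.\<close>

lemma rho_has_derivative:
  assumes p: "p \<in> dom_wave_op a" and t: "t \<in> {0..T}"
  shows "(rho p has_real_derivative rho_deriv p t) (at t within {0..T})"
  unfolding has_field_derivative_iff
proof (rule Lim_transform_eventually)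
  let ?F = "at t within {0..T}"
  define Q where "Q s = lincomb (1 / (s - t)) (S s p) (- 1 / (s - t)) (S t p)" for s
  note pH = dom_H0[OF p] and qH = wave_op_H0[OF p]
  have t0: "0 \<le> t" using t by simp
  note tH = S_H0[OF t0 pH] S_H0[OF t0 qH]
  have QH: "\<forall>\<^sub>F s in ?F. Q s \<in> H0 a"
    using eventually_S_H0[OF pH] by eventually_elim (simp add: Q_def H0_lincomb tH)
  have Ql: "((\<lambda>s. dist_H0 a (Q s) (S t (wave_op a p))) \<longlongrightarrow> 0) ?F"
    unfolding Q_def by (rule S_quotient_tendsto[OF t0 p])
  have cl: "((\<lambda>s. dist_H0 a (S t p) (S t p)) \<longlongrightarrow> 0) ?F" by (simp add: dist_H0_same tH)
  show "((\<lambda>s. multiplier_form (Q s) (S s p) + multiplier_form (S t p) (Q s)) \<longlongrightarrow> rho_deriv p t) ?F"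
    by (intro tendsto_add multiplier_form_tendsto QH Ql eventually_S_H0 tH pH S_orbit_tendsto[OF t0 pH] cl always_eventually allI)
  show "\<forall>\<^sub>F s in ?F. multiplier_form (Q s) (S s p) + multiplier_form (S t p) (Q s) = (rho p s - rho p t) / (s - t)"
    using eventually_S_H0[OF pH] eventually_neq_at_within[of t]
  proof eventually_elim
    case (elim s)
    then have d: "s - t \<noteq> 0" by simp
    have "multiplier_form (Q s) (S s p) = 1 / (s - t) * rho p s + (- 1 / (s - t)) * multiplier_form (S t p) (S s p)"
      unfolding Q_def by (rule multiplier_form_lincomb_left[OF elim(1) tH(1) elim(1)])
    moreover have "multiplier_form (S t p) (Q s) = 1 / (s - t) * multiplier_form (S t p) (S s p) + (- 1 / (s - t)) * rho p t"
      unfolding Q_def by (rule multiplier_form_lincomb_right[OF elim(1) tH(1) tH(1)])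
    ultimately show ?case using d by (simp add: diff_divide_distrib)
  qed
qed

abbreviation orbit_trace :: "state \<Rightarrow> real \<Rightarrow> real" where
  "orbit_trace p t \<equiv> trace_xx (fst (S t p))"

text \<open>The Rellich inequality at \<open>S t p\<close>; \<open>S_dom\<close> moves the generator
  inside the semigroup, which matches the derivative of \<open>rho p\<close>, and contractivity
  brings the norm back to time 0.\<close>

lemma trace_power2_le:
  assumes p: "p \<in> dom_wave_op a" and t: "0 \<le> t"
  shows "(orbit_trace p t)\<^sup>2 \<le> 2 * rho_deriv p t + 3 * (norm_H0 a p)\<^sup>2"
proof -
  note pH = dom_H0[OF p] and qH = wave_op_H0[OF p]
  note d = S_dom[OF t p]
  note e = state_eq_sym[OF d(2)]
  have "(orbit_trace p t)\<^sup>2 \<le> 2 * (multiplier_form (wave_op a (S t p)) (S t p) + multiplier_form (S t p) (wave_op a (S t p)))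
      + 3 * (norm_H0 a (S t p))\<^sup>2"
    by (rule rellich_inequality(1)[OF d(1)])
  also have "multiplier_form (wave_op a (S t p)) (S t p) = multiplier_form (S t (wave_op a p)) (S t p)"
    by (rule multiplier_form_cong[OF e state_eq_refl wave_op_H0[OF d(1)] S_H0[OF t pH] S_H0[OF t qH]])
  also have "multiplier_form (S t p) (wave_op a (S t p)) = multiplier_form (S t p) (S t (wave_op a p))"
    by (rule multiplier_form_cong[OF state_eq_refl e S_H0[OF t pH] wave_op_H0[OF d(1)] S_H0[OF t pH]])
  also have "(norm_H0 a (S t p))\<^sup>2 \<le> (norm_H0 a p)\<^sup>2"
    by (intro power_mono S_norm t pH norm_H0_nonneg)
  finally show ?thesis by simp
qed

text \<open>Applied to the difference of two states of the orbit, the Rellich inequality also gives the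
  continuity of the trace in time.\<close>

lemma trace_difference:
  assumes p: "p \<in> dom_wave_op a" and s: "0 \<le> s" and t: "0 \<le> t"
  shows "(orbit_trace p s - orbit_trace p t)\<^sup>2 \<le>
     4 * (1 / sqrt (a 1) * (dist_H0 a (S s (wave_op a p)) (S t (wave_op a p)) * dist_H0 a (S s p) (S t p)))
     + 3 * (dist_H0 a (S s p) (S t p))\<^sup>2"
proof -
  note pH = dom_H0[OF p] and qH = wave_op_H0[OF p]
  note ds = S_dom[OF s p] and dt = S_dom[OF t p]
  let ?r = "lincomb 1 (S s p) (-1) (S t p)"
  let ?r' = "lincomb 1 (S s (wave_op a p)) (-1) (S t (wave_op a p))"
  have r: "?r \<in> dom_wave_op a" by (rule dom_wave_op_lincomb[OF ds(1) dt(1)])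
  have rH: "?r \<in> H0 a" by (rule dom_H0[OF r])
  have r'H: "?r' \<in> H0 a" by (intro H0_lincomb S_H0 s t qH)
  have e: "state_eq (wave_op a ?r) ?r'"
    by (rule state_eq_trans[OF wave_op_lincomb[OF ds(1) dt(1)] state_eq_lincomb[OF state_eq_sym[OF ds(2)] state_eq_sym[OF dt(2)]]])
  have 1: "multiplier_form (wave_op a ?r) ?r = multiplier_form ?r' ?r"
    by (rule multiplier_form_cong[OF e state_eq_refl wave_op_H0[OF r] rH r'H])
  have 2: "multiplier_form ?r (wave_op a ?r) = multiplier_form ?r ?r'"
    by (rule multiplier_form_cong[OF state_eq_refl e rH wave_op_H0[OF r] rH])
  have 3: "trace_xx (fst ?r) = orbit_trace p s - orbit_trace p t"
    using trace_lincomb[OF ds(1) dt(1), of 1 "-1"] by simp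
  have 4: "\<bar>multiplier_form ?r' ?r\<bar> \<le> 1 / sqrt (a 1) * (norm_H0 a ?r' * norm_H0 a ?r)"
    by (rule multiplier_form_bound[OF r'H rH])
  have 5: "\<bar>multiplier_form ?r ?r'\<bar> \<le> 1 / sqrt (a 1) * (norm_H0 a ?r' * norm_H0 a ?r)"
    using multiplier_form_bound[OF rH r'H] by (simp add: mult.commute)
  have "(orbit_trace p s - orbit_trace p t)\<^sup>2 \<le> 2 * (multiplier_form ?r' ?r + multiplier_form ?r ?r') + 3 * (norm_H0 a ?r)\<^sup>2"
    using rellich_inequality(1)[OF r] unfolding 1 2 3 .
  also have "\<dots> \<le> 2 * (1 / sqrt (a 1) * (norm_H0 a ?r' * norm_H0 a ?r) + 1 / sqrt (a 1) * (norm_H0 a ?r' * norm_H0 a ?r))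
      + 3 * (norm_H0 a ?r)\<^sup>2"
    by (intro add_right_mono mult_left_mono add_mono order.trans[OF abs_ge_self 4] order.trans[OF abs_ge_self 5]) simp
  finally show ?thesis
    unfolding dist_H0_def by (simp only: mult_2[symmetric] mult.assoc[symmetric])
qed

text \<open>The orbits of \<open>p\<close> and of \<open>wave_op a p\<close> are both continuous in
  the norm, so the bound of \<open>trace_difference\<close> tends to 0. Continuity supplies the
  measurability and integrability in time needed for the integrated estimate.\<close>

lemma trace_continuous:
  assumes p: "p \<in> dom_wave_op a"
  shows "continuous_on {0..T} (orbit_trace p)"
  unfolding continuous_on_def
proof
  fix t assume "t \<in> {0..T}"
  then have t: "0 \<le> t" by simp
  let ?F = "at t within {0..T}"
  note pH = dom_H0[OF p] and qH = wave_op_H0[OF p]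
  let ?b = "\<lambda>s. 4 * (1 / sqrt (a 1) * (dist_H0 a (S s (wave_op a p)) (S t (wave_op a p)) * dist_H0 a (S s p) (S t p)))
     + 3 * (dist_H0 a (S s p) (S t p))\<^sup>2"
  have "(?b \<longlongrightarrow> 4 * (1 / sqrt (a 1) * (0 * 0)) + 3 * 0\<^sup>2) ?F"
    by (intro tendsto_add tendsto_mult tendsto_power tendsto_const S_orbit_tendsto t pH qH)
  then have b: "(?b \<longlongrightarrow> 0) ?F" by simp
  have "((\<lambda>s. (orbit_trace p s - orbit_trace p t)\<^sup>2) \<longlongrightarrow> 0) ?F"
  proof (rule Lim_null_comparison[OF _ b])
    show "\<forall>\<^sub>F s in ?F. norm ((orbit_trace p s - orbit_trace p t)\<^sup>2) \<le> ?b s"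
      unfolding eventually_at_filter
      by (rule always_eventually) (use trace_difference[OF p _ t] in auto)
  qed
  then have "((\<lambda>s. sqrt ((orbit_trace p s - orbit_trace p t)\<^sup>2)) \<longlongrightarrow> sqrt 0) ?F" by (rule tendsto_real_sqrt)
  then have "((\<lambda>s. \<bar>orbit_trace p s - orbit_trace p t\<bar>) \<longlongrightarrow> 0) ?F" by simp
  then have "((\<lambda>s. orbit_trace p s - orbit_trace p t) \<longlongrightarrow> 0) ?F" by (rule tendsto_rabs_zero_cancel)
  then show "(orbit_trace p \<longlongrightarrow> orbit_trace p t) ?F" by (simp add: LIM_zero_iff)
qed

text \<open>\<open>3 * T\<close> comes from integrating the norm term of the Rellich inequality, and
  each of the two end times of \<open>rho p\<close> contributes one maximum.\<close>

definition observability_const :: "real \<Rightarrow> real" where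
  "observability_const T = 3 * T + 2 * max (1 / a 1) 1"

lemma trace_integral_le:
  assumes p: "p \<in> dom_wave_op a" and T: "0 \<le> T"
  shows "integral {0..T} (\<lambda>t. (orbit_trace p t)\<^sup>2) \<le> observability_const T * (norm_H0 a p)\<^sup>2"
proof -
  note pH = dom_H0[OF p]
  let ?N = "(norm_H0 a p)\<^sup>2" and ?m = "max (1 / a 1) 1"
  have hi: "((\<lambda>t. 2 * rho_deriv p t + 3 * ?N) has_integral (2 * rho p T + 3 * ?N * T) - (2 * rho p 0 + 3 * ?N * 0)) {0..T}"
  proof (rule has_integral_real_derivative[of 0 T "\<lambda>t. 2 * rho p t + 3 * ?N * t"])
    fix t assume "t \<in> {0..T}"
    from rho_has_derivative[OF p this]
    show "((\<lambda>t. 2 * rho p t + 3 * ?N * t) has_real_derivative 2 * rho_deriv p t + 3 * ?N) (at t within {0..T})"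
      by (intro DERIV_add DERIV_cmult) (auto intro!: derivative_eq_intros)
  qed fact
  have "integral {0..T} (\<lambda>t. (orbit_trace p t)\<^sup>2) \<le> integral {0..T} (\<lambda>t. 2 * rho_deriv p t + 3 * ?N)"
  proof (rule integral_le)
    show "(\<lambda>t. (orbit_trace p t)\<^sup>2) integrable_on {0..T}"
      by (intro integrable_continuous_real continuous_intros trace_continuous p)
    show "(\<lambda>t. 2 * rho_deriv p t + 3 * ?N) integrable_on {0..T}" using hi by blast
    show "(orbit_trace p t)\<^sup>2 \<le> 2 * rho_deriv p t + 3 * ?N" if "t \<in> {0..T}" for t
      using trace_power2_le[OF p, of t] that by simp
  qed
  also have "\<dots> = 2 * rho p T - 2 * rho p 0 + 3 * ?N * T" using integral_unique[OF hi] by simp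
  also have "\<dots> \<le> 2 * \<bar>rho p T\<bar> + 2 * \<bar>rho p 0\<bar> + 3 * ?N * T" by linarith
  also have "\<dots> \<le> ?m * ?N + ?m * ?N + 3 * ?N * T"
  proof -
    have "2 * \<bar>rho p t\<bar> \<le> ?m * ?N" if t: "0 \<le> t" for t
    proof -
      have "2 * \<bar>rho p t\<bar> \<le> ?m * (norm_H0 a (S t p))\<^sup>2" by (rule multiplier_form_diag_bound[OF S_H0[OF t pH]])
      also have "\<dots> \<le> ?m * ?N" by (intro mult_left_mono power_mono S_norm t pH norm_H0_nonneg) auto
      finally show ?thesis .
    qed
    from this[OF T] this[of 0] show ?thesis by linarith
  qed
  also have "\<dots> = observability_const T * ?N" by (simp add: observability_const_def algebra_simps)
  finally show ?thesis .
qed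

lemma observability_const_nonneg: "0 \<le> T \<Longrightarrow> 0 \<le> observability_const T"
  by (simp add: observability_const_def add_nonneg_nonneg le_max_iff_disj)

lemma trace_sq_int: "p \<in> dom_wave_op a \<Longrightarrow> sq_int (lebesgue_on {0<..<T}) (orbit_trace p)"
  by (rule continuous_sq_int_interval(1)[OF trace_continuous])

lemma trace_l2norm_le:
  assumes p: "p \<in> dom_wave_op a" and T: "0 \<le> T"
  shows "l2norm (lebesgue_on {0<..<T}) (orbit_trace p) \<le> sqrt (observability_const T) * norm_H0 a p"
proof -
  have "(l2norm (lebesgue_on {0<..<T}) (orbit_trace p))\<^sup>2 \<le> observability_const T * (norm_H0 a p)\<^sup>2"
    unfolding l2norm_power2 continuous_sq_int_interval(2)[OF trace_continuous[OF p]]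
    by (rule trace_integral_le[OF p T])
  then have "sqrt ((l2norm (lebesgue_on {0<..<T}) (orbit_trace p))\<^sup>2) \<le> sqrt (observability_const T * (norm_H0 a p)\<^sup>2)"
    by (rule real_sqrt_le_mono)
  then show ?thesis by (simp add: real_sqrt_mult norm_H0_nonneg)
qed

text \<open>By linearity of the semigroup and of the trace, the difference of traces is the trace
  along the orbit of the difference. The trace map is thus Lipschitz from the norm of
  \<open>H0 a\<close> to \<open>L2\<close> in time.\<close>

lemma trace_l2norm_diff_le:
  assumes p: "p \<in> dom_wave_op a" and q: "q \<in> dom_wave_op a" and T: "0 \<le> T"
  shows "l2norm (lebesgue_on {0<..<T}) (\<lambda>t. orbit_trace p t - orbit_trace q t) \<le> sqrt (observability_const T) * dist_H0 a p q"
proof -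
  let ?r = "lincomb 1 p (-1) q"
  have r: "?r \<in> dom_wave_op a" by (rule dom_wave_op_lincomb[OF p q])
  have tr: "orbit_trace ?r t = orbit_trace p t - orbit_trace q t" if t: "0 \<le> t" for t
  proof -
    have "orbit_trace ?r t = trace_xx (fst (lincomb 1 (S t p) (-1) (S t q)))"
      by (rule trace_xx_cong_AE[OF state_eqD(1)[OF S_lincomb[OF t dom_H0[OF p] dom_H0[OF q]]]])
    then show ?thesis using trace_lincomb[OF S_dom(1)[OF t p] S_dom(1)[OF t q], of 1 "-1"] by simp
  qed
  have "(\<integral>t. (orbit_trace p t - orbit_trace q t)\<^sup>2 \<partial>lebesgue_on {0<..<T}) = (\<integral>t. (orbit_trace ?r t)\<^sup>2 \<partial>lebesgue_on {0<..<T})"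
    by (rule Bochner_Integration.integral_cong) (auto simp: tr simp del: lincomb_simps)
  then have "l2norm (lebesgue_on {0<..<T}) (\<lambda>t. orbit_trace p t - orbit_trace q t) = l2norm (lebesgue_on {0<..<T}) (orbit_trace ?r)"
    by (simp add: l2norm_def)
  then show ?thesis using trace_l2norm_le[OF r T] by (simp add: dist_H0_def)
qed

lemma classical_solution_S:
  assumes "p \<in> dom_wave_op a"
  shows "classical_solution a (\<lambda>t. S t p) p"
  using assms dom_H0[OF assms] semigroup generator state_eq_refl
  unfolding classical_solution_def mild_solution_def by blast

text \<open>A Lipschitz map on a dense subset extends by completeness of the target; the data are
  approximated within \<open>1 / (real n + 1)\<close>.\<close>

lemma mild_trace_xx_exists:
  assumes p: "p \<in> H0 a" and T: "0 < T"
  shows "\<exists>z. mild_trace_xx a T p z"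
proof -
  have "\<exists>q. q \<in> dom_wave_op a \<and> dist_H0 a q p < 1 / (real n + 1)" for n
    using dom_wave_op_dense[OF p, of "1 / (real n + 1)"] by (metis add_nonneg_pos divide_pos_pos of_nat_0_le_iff zero_less_one)
  then obtain P where P: "\<And>n. P n \<in> dom_wave_op a" and Pd: "\<And>n. dist_H0 a (P n) p < 1 / (real n + 1)" by metis
  note PH = dom_H0[OF P]
  let ?M = "lebesgue_on {0<..<T}" and ?K = "sqrt (observability_const T)"
  have T0: "0 \<le> T" using T by simp
  have K0: "0 \<le> ?K" using observability_const_nonneg[OF T0] by simp
  have fin: "finite_measure ?M" by (rule finite_measure_lebesgue_on) simp
  obtain z where z: "sq_int ?M z" "(\<lambda>n. l2norm ?M (\<lambda>t. orbit_trace (P n) t - z t)) \<longlonglongrightarrow> 0"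
  proof (rule l2_complete[OF fin, of "\<lambda>n. orbit_trace (P n)"])
    show "sq_int ?M (orbit_trace (P n))" for n by (rule trace_sq_int[OF P])
    fix e :: real assume e: "0 < e"
    \<comment> \<open>The factor 2 accounts for the approximation errors of \<open>P i\<close> and
      of \<open>P j\<close>.\<close>
    obtain N :: nat where N: "2 * ?K / e < real N" using reals_Archimedean2 by blast
    have "l2norm ?M (\<lambda>t. orbit_trace (P i) t - orbit_trace (P j) t) < e" if ij: "i \<ge> N" "j \<ge> N" for i j
    proof -
      have "dist_H0 a (P i) (P j) \<le> dist_H0 a (P i) p + dist_H0 a p (P j)" by (rule dist_H0_triangle[OF PH p PH])
      also have "dist_H0 a p (P j) = dist_H0 a (P j) p" by (rule dist_H0_commute[OF p PH])
      also have "dist_H0 a (P i) p + dist_H0 a (P j) p \<le> 1 / (real N + 1) + 1 / (real N + 1)"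
      proof (intro add_mono)
        have le: "1 / (real k + 1) \<le> 1 / (real N + 1)" if "k \<ge> N" for k
          using that by (intro divide_left_mono) auto
        show "dist_H0 a (P i) p \<le> 1 / (real N + 1)" "dist_H0 a (P j) p \<le> 1 / (real N + 1)"
          using Pd[of i] Pd[of j] le[OF ij(1)] le[OF ij(2)] by linarith+
      qed
      finally have d: "dist_H0 a (P i) (P j) \<le> 2 / (real N + 1)" by simp
      have "l2norm ?M (\<lambda>t. orbit_trace (P i) t - orbit_trace (P j) t) \<le> ?K * dist_H0 a (P i) (P j)"
        by (rule trace_l2norm_diff_le[OF P P T0])
      also have "\<dots> \<le> ?K * (2 / (real N + 1))" by (rule mult_left_mono[OF d K0])
      also have "\<dots> < e"
      proof -
        have "2 * ?K < real N * e" using N e by (simp add: field_simps)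
        also have "\<dots> < (real N + 1) * e" using e by (intro mult_strict_right_mono) auto
        finally show ?thesis by (simp add: field_simps)
      qed
      finally show ?thesis .
    qed
    then show "\<exists>N. \<forall>i\<ge>N. \<forall>j\<ge>N. l2norm ?M (\<lambda>t. orbit_trace (P i) t - orbit_trace (P j) t) < e" by blast
  qed blast
  have "(\<lambda>n. dist_H0 a (P n) p) \<longlonglongrightarrow> 0"
  proof (rule Lim_null_comparison)
    show "\<forall>\<^sub>F n in sequentially. norm (dist_H0 a (P n) p) \<le> 1 / (real n + 1)"
      using Pd by (intro always_eventually) (auto simp: dist_H0_nonneg less_imp_le)
    show "(\<lambda>n. 1 / (real n + 1)) \<longlonglongrightarrow> 0"
      using LIMSEQ_inverse_real_of_nat by (simp add: inverse_eq_divide add.commute)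
  qed
  moreover have "tendsto_L2 {0<..<T} (\<lambda>n t. trace_xx (fst (S t (P n)))) z"
    unfolding tendsto_L2_def L2_iff_sq_int
    using trace_sq_int[OF P] z by (simp add: l2norm_tendsto_iff)
  ultimately show ?thesis
    unfolding mild_trace_xx_def
    by (intro exI[of _ z] exI[of _ P] exI[of _ "\<lambda>n t. S t (P n)"]) (use classical_solution_S[OF P] in auto)
qed

end

section \<open>Estimates for arbitrary solutions and the initial energy\<close>

context degenerate_coefficient
begin

text \<open>Each classical solution brings a semigroup of its own, so the semigroup locale is
  interpreted inside the proof. The bound does not mention the semigroup and is thus uniform along
  any approximating sequence.\<close>

lemma classical_trace_l2norm_le:
  assumes W: "classical_solution a W P" and T: "0 \<le> T"
  shows "l2norm (lebesgue_on {0<..<T}) (\<lambda>t. trace_xx (fst (W t)))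
    \<le> sqrt (3 * T + 2 * max (1 / a 1) 1) * norm_H0 a P"
proof -
  obtain S where S: "contraction_semigroup a S" "generated_by_wave_op a S"
    and WS: "\<And>t. 0 \<le> t \<Longrightarrow> state_eq (W t) (S t P)" and P: "P \<in> dom_wave_op a"
    using W unfolding classical_solution_def mild_solution_def by blast
  interpret degenerate_semigroup a a' S by unfold_locales (rule S)+
  have "(\<integral>t. (trace_xx (fst (W t)))\<^sup>2 \<partial>lebesgue_on {0<..<T}) = (\<integral>t. (orbit_trace P t)\<^sup>2 \<partial>lebesgue_on {0<..<T})"
  proof (rule Bochner_Integration.integral_cong)
    fix t assume "t \<in> space (lebesgue_on {0<..<T})"
    then have "0 \<le> t" by simp
    then show "(trace_xx (fst (W t)))\<^sup>2 = (orbit_trace P t)\<^sup>2"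
      using trace_xx_cong_AE[OF state_eqD(1)[OF WS]] by simp
  qed simp
  then show ?thesis
    using trace_l2norm_le[OF P T] by (simp add: l2norm_def observability_const_def)
qed

text \<open>Works for any approximating sequence that may stand behind \<open>z\<close>: the
  \<open>L2\<close> norm of the trace and the norm of the data are both continuous in the
  limit.\<close>

lemma mild_trace_l2norm_le:
  assumes p: "p \<in> H0 a" and T: "0 \<le> T" and z: "mild_trace_xx a T p z"
  shows "l2norm (lebesgue_on {0<..<T}) z \<le> sqrt (3 * T + 2 * max (1 / a 1) 1) * norm_H0 a p"
proof -
  let ?M = "lebesgue_on {0<..<T}" and ?K = "sqrt (3 * T + 2 * max (1 / a 1) 1)"
  obtain P W where W: "\<And>n::nat. classical_solution a (W n) (P n)"
    and Pp: "(\<lambda>n. dist_H0 a (P n) p) \<longlonglongrightarrow> 0"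
    and L2: "tendsto_L2 {0<..<T} (\<lambda>n t. trace_xx (fst (W n t))) z"
    using z unfolding mild_trace_xx_def by blast
  define f where "f n t = trace_xx (fst (W n t))" for n t
  have f: "sq_int ?M (f n)" and zs: "sq_int ?M z" and fz: "(\<lambda>n. l2norm ?M (\<lambda>t. f n t - z t)) \<longlonglongrightarrow> 0" for n
    using L2 unfolding tendsto_L2_def L2_iff_sq_int f_def[abs_def] by (auto simp: l2norm_tendsto_iff)
  have K0: "0 \<le> ?K" using T by (simp add: add_nonneg_nonneg le_max_iff_disj)
  have bound: "l2norm ?M z \<le> ?K * (norm_H0 a p + dist_H0 a (P n) p) + l2norm ?M (\<lambda>t. f n t - z t)" for n
  proof -
    have PH: "P n \<in> H0 a" using W[of n] unfolding classical_solution_def mild_solution_def by blast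
    have "l2norm ?M z \<le> l2norm ?M (f n) + l2norm ?M (\<lambda>t. f n t - z t)"
      using l2norm_diff_abs[OF f zs, of n] by linarith
    also have "l2norm ?M (f n) \<le> ?K * norm_H0 a (P n)"
      using classical_trace_l2norm_le[OF W T, of n] by (simp add: f_def[abs_def])
    also have "\<dots> \<le> ?K * (norm_H0 a p + dist_H0 a (P n) p)"
      by (intro mult_left_mono norm_H0_le_dist PH p K0)
    finally show ?thesis by simp
  qed
  have "(\<lambda>n. ?K * (norm_H0 a p + dist_H0 a (P n) p) + l2norm ?M (\<lambda>t. f n t - z t)) \<longlonglongrightarrow> ?K * (norm_H0 a p + 0) + 0"
    by (intro tendsto_add tendsto_mult tendsto_const Pp fz)
  then have "l2norm ?M z \<le> ?K * (norm_H0 a p + 0) + 0"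
    by (rule LIMSEQ_le_const) (use bound in blast)
  then show ?thesis by simp
qed

text \<open>At time 0 the solution agrees with its data only almost everywhere; measurability of its
  velocity is recovered from completeness of Lebesgue measure, after extension by 0 to the
  line.\<close>

lemma mild_solution_energy_0:
  assumes Y: "mild_solution a Y p"
  shows "energy a Y 0 = (norm_H0 a p)\<^sup>2 / 2"
proof -
  obtain S where S: "contraction_semigroup a S" and YS: "state_eq (Y 0) (S 0 p)" and p: "p \<in> H0 a"
    using Y unfolding mild_solution_def by force
  have "state_eq (S 0 p) p" using S p by (simp add: contraction_semigroup_def)
  then have Yp: "state_eq (Y 0) p" by (rule state_eq_trans[OF YS])
  have u: "weak_deriv 2 (fst (Y 0)) = weak_deriv 2 (fst p)" by (rule weak_deriv_cong_AE[OF state_eqD(1)[OF Yp]])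
  have "AE x in lebesgue. (if x \<in> {0<..<1} then snd p x else 0) = (if x \<in> {0<..<1} then snd (Y 0) x else 0)"
    using state_eqD(2)[OF Yp] by (simp add: AE_restrict_space_iff) (erule eventually_mono, auto)
  moreover have "(\<lambda>x. if x \<in> {0<..<1} then snd p x else 0) \<in> borel_measurable lebesgue"
    by (rule borel_measurable_if_I[OF sq_int_measurable[OF H0_sq_int(3)[OF p]]]) simp
  ultimately have "(\<lambda>x. if x \<in> {0<..<1} then snd (Y 0) x else 0) \<in> borel_measurable lebesgue"
    by (rule borel_measurable_AE[rotated])
  then have vm: "snd (Y 0) \<in> borel_measurable unit_leb" by (rule borel_measurable_if_D)
  note gm = sq_int_measurable[OF H0_sq_int(1)[OF p]] and vpm = sq_int_measurable[OF H0_sq_int(3)[OF p]]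
  have "(\<integral>x. (snd (Y 0) x)\<^sup>2 / a x + (weak_deriv 2 (fst (Y 0)) x)\<^sup>2 \<partial>unit_leb)
     = (\<integral>x. (snd p x)\<^sup>2 / a x + (weak_deriv 2 (fst p) x)\<^sup>2 \<partial>unit_leb)"
    unfolding u
  proof (rule integral_cong_AE)
    show "AE x in unit_leb. (snd (Y 0) x)\<^sup>2 / a x + (weak_deriv 2 (fst p) x)\<^sup>2 = (snd p x)\<^sup>2 / a x + (weak_deriv 2 (fst p) x)\<^sup>2"
      using state_eqD(2)[OF Yp] by eventually_elim simp
  qed (intro borel_measurable_add borel_measurable_divide borel_measurable_power vm vpm gm a_measurable)+
  also have "\<dots> = (\<integral>x. (snd p x)\<^sup>2 / a x \<partial>unit_leb) + (\<integral>x. (weak_deriv 2 (fst p) x)\<^sup>2 \<partial>unit_leb)"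
  proof (rule Bochner_Integration.integral_add)
    have "snd p \<in> L2_weighted a" using p by (simp add: H0_iff)
    then show "integrable unit_leb (\<lambda>x. (snd p x)\<^sup>2 / a x)" by (simp add: L2_weighted_def)
  qed (rule sq_int_integrable_sq[OF H0_sq_int(1)[OF p]])
  also have "\<dots> = (norm_H0 a p)\<^sup>2"
    unfolding norm_H0_power2 l2norm_wt by (simp add: l2norm_power2)
  finally show ?thesis by (simp add: energy_def)
qed

end

text \<open>Both upper bounds on the supremum give \<open>degeneracy a < 2\<close>, and every
  quotient lies below the supremum. The derivative occurring there coincides with the one from
  \<open>C1_on\<close> by uniqueness of derivatives on the closed interval.\<close>

lemma degenerate_coefficient_exists:
  assumes "weakly_degenerate a \<or> strongly_degenerate a"
  obtains a' where "degenerate_coefficient a a'"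
proof -
  have "\<exists>I. C1_on I a \<and> {0<..1} \<subseteq> I"
    using assms unfolding weakly_degenerate_def strongly_degenerate_def
    by (metis greaterThanAtMost_subseteq_atLeastAtMost_iff order_refl)
  then obtain a' where a': "\<And>x. x \<in> {0<..1} \<Longrightarrow> (a has_vector_derivative a' x) (at x within {0..1})"
    unfolding C1_on_def by (meson subset_iff)
  have pos: "\<And>x. x \<in> {0<..1} \<Longrightarrow> 0 < a x"
    using assms unfolding weakly_degenerate_def strongly_degenerate_def by blast
  have deg: "degeneracy a < 2"
  proof -
    have "(1::ereal) < 2" by simp
    then show ?thesis
      using assms unfolding weakly_degenerate_def strongly_degenerate_def by (meson less_trans)
  qed
  have "degenerate_coefficient a a'"
  proof
    fix x :: real assume x: "x \<in> {0<..1}"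
    show "(a has_real_derivative a' x) (at x within {0..1})"
      using a'[OF x] by (simp add: has_real_derivative_iff_has_vector_derivative)
    show "0 < a x" by (rule pos[OF x])
    have vd: "vector_derivative a (at x within {0..1}) = a' x"
      by (rule vector_derivative_within_closed_interval[OF _ _ a'[OF x]]) (use x in auto)
    have "ereal (x * \<bar>a' x\<bar> / a x) \<le> degeneracy a"
      unfolding degeneracy_def vd[symmetric] by (rule SUP_upper[OF x])
    also have "degeneracy a < ereal 2" using deg by simp
    finally have "x * \<bar>a' x\<bar> / a x < 2" by (simp only: less_ereal.simps)
    then show "x * \<bar>a' x\<bar> \<le> 2 * a x" using pos[OF x] by (simp add: divide_less_eq)
  qed
  then show thesis by (rule that)
qed

theorem theorem3p3:
  fixes a :: "real \<Rightarrow> real" and y y_t :: "real \<Rightarrow> real \<Rightarrow> real"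
    and y0 y1 :: "real \<Rightarrow> real" and T :: real
  assumes "weakly_degenerate a \<or> strongly_degenerate a"
    and "(y0, y1) \<in> H0 a"
    and "mild_solution a (\<lambda>t. (y t, y_t t)) (y0, y1)"
    and "T > 0"
  shows "(\<exists>z. mild_trace_xx a T (y0, y1) z) \<and>
    (\<forall>z. mild_trace_xx a T (y0, y1) z \<longrightarrow>
      (\<integral>t. (z t)\<^sup>2 \<partial>lebesgue_on {0<..<T})
        \<le> (12 * T + 4 * max (4 / a 1) 1) * energy a (\<lambda>t. (y t, y_t t)) 0)"
proof -
  obtain a' where "degenerate_coefficient a a'"
    using degenerate_coefficient_exists[OF assms(1)] by blast
  then interpret degenerate_coefficient a a' .
  obtain S where S: "contraction_semigroup a S" "generated_by_wave_op a S"
    using assms(3) unfolding mild_solution_def by blast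
  interpret degenerate_semigroup a a' S by unfold_locales (rule S)+
  let ?C = "3 * T + 2 * max (1 / a 1) 1" and ?N = "norm_H0 a (y0, y1)"
  have C0: "0 \<le> ?C" using assms(4) by (simp add: add_nonneg_nonneg le_max_iff_disj)
  have "(\<integral>t. (z t)\<^sup>2 \<partial>lebesgue_on {0<..<T}) \<le> (12 * T + 4 * max (4 / a 1) 1) * energy a (\<lambda>t. (y t, y_t t)) 0"
    if z: "mild_trace_xx a T (y0, y1) z" for z
  proof -
    have "l2norm (lebesgue_on {0<..<T}) z \<le> sqrt ?C * ?N"
      by (rule mild_trace_l2norm_le[OF assms(2) less_imp_le[OF assms(4)] z])
    then have "(l2norm (lebesgue_on {0<..<T}) z)\<^sup>2 \<le> (sqrt ?C * ?N)\<^sup>2" by (rule power_mono) simp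
    also have "\<dots> = ?C * ?N\<^sup>2" using C0 by (simp add: power_mult_distrib)
    \<comment> \<open>The factor is enlarged to half of the stated one, because the squared norm
      equals twice the initial energy.\<close>
    also have "\<dots> \<le> (6 * T + 2 * max (4 / a 1) 1) * ?N\<^sup>2"
    proof (rule mult_right_mono)
      have "1 / a 1 \<le> 4 / a 1" using a_1_pos by (intro divide_right_mono) auto
      then have "max (1 / a 1) 1 \<le> max (4 / a 1) 1" by (intro max.mono) auto
      then show "?C \<le> 6 * T + 2 * max (4 / a 1) 1" using assms(4) by linarith
    qed simp
    also have "\<dots> = (12 * T + 4 * max (4 / a 1) 1) * energy a (\<lambda>t. (y t, y_t t)) 0"
      unfolding mild_solution_energy_0[OF assms(3)] by (simp add: algebra_simps)
    finally show ?thesis by (simp add: l2norm_power2)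
  qed
  then show ?thesis using mild_trace_xx_exists[OF assms(2,4)] by blast
qed

end
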